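(* There is an isomorphism of $({\boldsymbol{\mathcal S}}(\infty,r),{\boldsymbol{\mathcal H}})$-bimodules $${\bf\Omega}_\infty^{\otimes r}\cong\bigoplus_{\mu\in\Lambda^+(r)}W(\infty,\mu)\otimes S^\mu.$$ Hence ${\bf\Omega}_\infty^{\otimes r}$ is completely reducible as a left ${\boldsymbol{\mathcal S}}(\infty,r)$-module.
   Context: $v$ indeterminate. ${\bf\Omega}_\infty$ is the $\mathbb Q(v)$-space with basis $\{\omega_i\}_{i\in\mathbb Z}$. ${\boldsymbol{\mathcal H}}$ is the Hecke algebra of the symmetric group $\mathfrak S_r$ over $\mathbb Q(v)$ with basis $\{\mathcal T_w\}$: $\mathcal T_s\mathcal T_w=\mathcal T_{sw}$ if $\ell(sw)>\ell(w)$ and $=(v-v^{-1})\mathcal T_w+\mathcal T_{sw}$ otherwise ($s$ simple transposition); $T_w=v^{\ell(w)}\mathcal T_w$. ${\boldsymbol{\mathcal H}}$ acts on the right of ${\bf\Omega}_\infty^{\otimes r}$ by $(\omega_{i_1}\cdots\omega_{i_r})\mathcal T_{(j,j+1)}=\omega_{i_1}\cdots\omega_{i_{j+1}}\omega_{i_j}\cdots\omega_{i_r}$ if $i_j<i_{j+1}$; $=v\,\omega_{i_1}\cdots\omega_{i_r}$ if $i_j=i_{j+1}$; $=(v-v^{-1})\omega_{i_1}\cdots\omega_{i_r}+\omega_{i_1}\cdots\omega_{i_{j+1}}\omega_{i_j}\cdots\omega_{i_r}$ if $i_j>i_{j+1}$. ${\boldsymbol{\mathcal S}}(\infty,r)=\operatorname{End}_{\boldsymbol{\mathcal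 H}}({\bf\Omega}_\infty^{\otimes r})$ (infinite $q$-Schur algebra). Compositions: $\Lambda(\infty,r)$ is the set of finitely supported $\lambda\in\mathbb N^{\mathbb Z}$ with $\sum\lambda_i=r$; $\Lambda^+(r)\subseteq\Lambda(\infty,r)$ the partitions of $r$ ($\lambda_i=0$ for $i\le0$, $\lambda_1\ge\lambda_2\ge\cdots$). For $\lambda\in\Lambda(\infty,r)$, let $\Omega_\lambda$ be the span of the $\omega_{i_1}\otimes\cdots\otimes\omega_{i_r}$ with $\#\{j:i_j=k\}=\lambda_k$ for all $k$, and $\omega_\lambda$ the such tensor with $i_1\le\cdots\le i_r$; $\mathfrak S_\lambda$ is the Young subgroup stabilizing the consecutive blocks of $\{1,\dots,r\}$ of sizes $\lambda_i$ (in increasing order of $i$), $x_\lambda=\sum_{w\in\mathfrak S_\lambda}T_w$; then $\Omega_\lambda\cong x_\lambda{\boldsymbol{\mathcal H}}$ via $\omega_\lambda h\mapsto x_\lambda h$. $\varpi\in\Lambda(\infty,r)$ has $\varpi_i=1$ for $1\le i\le r$ and $0$ otherwise; $\Omega_\varpi$ is free of rank one over ${\boldsymbol{\mathcal H}}$ on $\omega_\varpi=\omega_1\otimes\cdots\otimes\omega_r$. For $\lambda\in\Lambda(\infty,r)$ let $\lambda^t\in\Lambda(\infty,r)$ with $\lambda^t_i=\#\{j:\lambda_j\ge i\}$ for $i\ge1$ and $0$ for $i\le0$; $w_\lambda$ is the unique distinguished $(\mathfrak S_\lambda,\mathfrak S_{\lambda^t})$-double coset representative with $w_\lambda^{-1}\mathfrak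 S_\lambda w_\lambda\cap\mathfrak S_{\lambda^t}=\{1\}$; $y_{\lambda^t}=\sum_{w\in\mathfrak S_{\lambda^t}}(-v^2)^{-\ell(w)}T_w$. The Specht module is $S^\mu=x_\mu T_{w_\mu}y_{\mu^t}{\boldsymbol{\mathcal H}}$. Let $z_\mu\in{\boldsymbol{\mathcal S}}(\infty,r)$ vanish on $\Omega_\nu$ for $\nu\ne\varpi$ and satisfy $z_\mu(\omega_\varpi h)=\omega_\mu T_{w_\mu}y_{\mu^t}h$ ($h\in{\boldsymbol{\mathcal H}}$). The Weyl module is $W(\infty,\mu)={\boldsymbol{\mathcal S}}(\infty,r)z_\mu$. In the bimodule $W(\infty,\mu)\otimes S^\mu$, ${\boldsymbol{\mathcal S}}(\infty,r)$ acts on the first factor and ${\boldsymbol{\mathcal H}}$ on the second. *)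

theory Defs
  imports "HOL-Combinatorics.Combinatorics"
          "HOL-Computational_Algebra.Polynomial"
          "HOL-Computational_Algebra.Fraction_Field"
begin

type_synonym K = "rat poly fract"
type_synonym perm = "nat \<Rightarrow> nat"
type_synonym vec = "int list \<Rightarrow> K"       (* elements of Omega_infty^{tensprod r}: coefficient functions on words *)
type_synonym hecke = "perm \<Rightarrow> K"        (* elements of H: coefficients w.r.t. the basis (calT_w) *)

definition vv :: K where "vv = Fract [:0, 1:] 1"

definition perms :: "nat \<Rightarrow> perm set" where
  "perms r = {w. w permutes {0..<r}}"

definition slen :: "nat \<Rightarrow> perm \<Rightarrow> nat" where
  "slen r w = card {(a, b). a < b \<and> b < r \<and> w b < w a}"

definition sgen :: "nat \<Rightarrow> perm" where
  "sgen j = transpose j (Suc j)"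

definition reduced_word :: "nat \<Rightarrow> perm \<Rightarrow> nat list \<Rightarrow> bool" where
  "reduced_word r w js \<longleftrightarrow> (\<forall>j\<in>set js. Suc j < r)
     \<and> foldr (\<lambda>j p. sgen j \<circ> p) js id = w \<and> length js = slen r w"

definition rword :: "nat \<Rightarrow> perm \<Rightarrow> nat list" where
  "rword r w = (SOME js. reduced_word r w js)"

definition Vcarrier :: "nat \<Rightarrow> vec set" where
  "Vcarrier r = {x. finite {l. x l \<noteq> 0} \<and> (\<forall>l. x l \<noteq> 0 \<longrightarrow> length l = r)}"

definition vzero :: vec where "vzero = (\<lambda>l. 0)"
definition vadd :: "vec \<Rightarrow> vec \<Rightarrow> vec" where "vadd x y = (\<lambda>l. x l + y l)"
definition vsmul :: "K \<Rightarrow> vec \<Rightarrow> vec" where "vsmul c x = (\<lambda>l. c * x l)"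

definition bvec :: "int list \<Rightarrow> vec" where
  "bvec m = (\<lambda>l. if l = m then 1 else 0)"

definition swapl :: "nat \<Rightarrow> int list \<Rightarrow> int list" where
  "swapl j l = l[j := l ! Suc j, Suc j := l ! j]"

text \<open>Right action of calT_(j+1,j+2) (positions 0-indexed: swaps positions j, j+1),
  written coefficientwise; it is the linear extension of the action on basis words.\<close>
definition Vgen :: "nat \<Rightarrow> vec \<Rightarrow> vec" where
  "Vgen j x = (\<lambda>l. if Suc j < length l then
      (if l ! j = l ! Suc j then vv * x l
       else if l ! j < l ! Suc j then x (swapl j l)
       else (vv - inverse vv) * x l + x (swapl j l))
    else x l)"

definition VT :: "nat \<Rightarrow> perm \<Rightarrow> vec \<Rightarrow> vec" where
  "VT r w x = fold Vgen (rword r w) x"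

definition Hcarrier :: "nat \<Rightarrow> hecke set" where
  "Hcarrier r = {h. \<forall>w. h w \<noteq> 0 \<longrightarrow> w \<in> perms r}"

definition Vact :: "nat \<Rightarrow> vec \<Rightarrow> hecke \<Rightarrow> vec" where
  "Vact r x h = (\<lambda>l. \<Sum>w\<in>perms r. h w * VT r w x l)"

text \<open>Left multiplication by calT_s: calT_s calT_w = calT_(sw) if l(sw) > l(w),
  and (v - v^-1) calT_w + calT_(sw) otherwise, written coefficientwise.\<close>
definition Hgen :: "nat \<Rightarrow> nat \<Rightarrow> hecke \<Rightarrow> hecke" where
  "Hgen r j h = (\<lambda>u. h (sgen j \<circ> u)
      + (if slen r (sgen j \<circ> u) < slen r u then (vv - inverse vv) * h u else 0))"

definition Hleft :: "nat \<Rightarrow> perm \<Rightarrow> hecke \<Rightarrow> hecke" where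
  "Hleft r w h = foldr (Hgen r) (rword r w) h"

definition Hmult :: "nat \<Rightarrow> hecke \<Rightarrow> hecke \<Rightarrow> hecke" where
  "Hmult r h h' = (\<lambda>u. \<Sum>w\<in>perms r. h w * Hleft r w h' u)"

definition Tw :: "nat \<Rightarrow> perm \<Rightarrow> hecke" where
  "Tw r w = (\<lambda>u. if u = w then vv ^ slen r w else 0)"

definition comps :: "nat \<Rightarrow> (int \<Rightarrow> nat) set" where
  "comps r = {la. finite {i. la i \<noteq> 0} \<and> (\<Sum>i\<in>{i. la i \<noteq> 0}. la i) = r}"

definition partitions :: "nat \<Rightarrow> (int \<Rightarrow> nat) set" where
  "partitions r = {la\<in>comps r. (\<forall>i\<le>0. la i = 0) \<and> (\<forall>i\<ge>1. la (i + 1) \<le> la i)}"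

definition varpi :: "nat \<Rightarrow> int \<Rightarrow> nat" where
  "varpi r = (\<lambda>i. if 1 \<le> i \<and> i \<le> int r then 1 else 0)"

definition conjp :: "(int \<Rightarrow> nat) \<Rightarrow> int \<Rightarrow> nat" where
  "conjp la = (\<lambda>i. if 1 \<le> i then card {j. nat i \<le> la j} else 0)"

definition omega_list :: "(int \<Rightarrow> nat) \<Rightarrow> int list" where
  "omega_list la = concat (map (\<lambda>k. replicate (la k) k) (sorted_list_of_set {i. la i \<noteq> 0}))"

definition omega :: "(int \<Rightarrow> nat) \<Rightarrow> vec" where
  "omega la = bvec (omega_list la)"

text \<open>Young subgroup: permutations preserving the consecutive blocks of sizes lambda_i.\<close>
definition young :: "nat \<Rightarrow> (int \<Rightarrow> nat) \<Rightarrow> perm set" where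
  "young r la = {w\<in>perms r. \<forall>a<r. omega_list la ! (w a) = omega_list la ! a}"

definition hsum :: "perm set \<Rightarrow> (perm \<Rightarrow> hecke) \<Rightarrow> hecke" where
  "hsum A f = (\<lambda>u. \<Sum>w\<in>A. f w u)"

definition xh :: "nat \<Rightarrow> (int \<Rightarrow> nat) \<Rightarrow> hecke" where
  "xh r la = hsum (young r la) (Tw r)"

definition yh :: "nat \<Rightarrow> (int \<Rightarrow> nat) \<Rightarrow> hecke" where
  "yh r la = hsum (young r la) (\<lambda>w u. inverse ((uminus (vv ^ 2)) ^ slen r w) * Tw r w u)"

definition distinguished :: "nat \<Rightarrow> perm set \<Rightarrow> perm set \<Rightarrow> perm \<Rightarrow> bool" where
  "distinguished r A B w \<longleftrightarrow> w \<in> perms r \<and>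
     (\<forall>a\<in>A. \<forall>b\<in>B. slen r w \<le> slen r (a \<circ> w \<circ> b))"

definition wlam :: "nat \<Rightarrow> (int \<Rightarrow> nat) \<Rightarrow> perm" where
  "wlam r la = (THE w. distinguished r (young r la) (young r (conjp la)) w \<and>
      (\<forall>u\<in>young r la. inv w \<circ> u \<circ> w \<in> young r (conjp la) \<longrightarrow> inv w \<circ> u \<circ> w = id))"

definition specht :: "nat \<Rightarrow> (int \<Rightarrow> nat) \<Rightarrow> hecke set" where
  "specht r \<mu> = {Hmult r (Hmult r (Hmult r (xh r \<mu>) (Tw r (wlam r \<mu>))) (yh r (conjp \<mu>))) h
                 | h. h \<in> Hcarrier r}"

definition Salg :: "nat \<Rightarrow> (vec \<Rightarrow> vec) set" where
  "Salg r = {f. (\<forall>x. x \<notin> Vcarrier r \<longrightarrow> f x = vzero) \<and>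
      (\<forall>x\<in>Vcarrier r. f x \<in> Vcarrier r) \<and>
      (\<forall>x\<in>Vcarrier r. \<forall>y\<in>Vcarrier r. f (vadd x y) = vadd (f x) (f y)) \<and>
      (\<forall>c. \<forall>x\<in>Vcarrier r. f (vsmul c x) = vsmul c (f x)) \<and>
      (\<forall>x\<in>Vcarrier r. \<forall>h\<in>Hcarrier r. f (Vact r x h) = Vact r (f x) h)}"

definition wproj :: "(int \<Rightarrow> nat) \<Rightarrow> vec \<Rightarrow> vec" where
  "wproj \<nu> x = (\<lambda>l. if (\<forall>k. count_list l k = \<nu> k) then x l else 0)"

text \<open>z_mu: zero on Omega_nu (nu /= varpi), and omega_varpi h |-> omega_mu T_(w_mu) y_(mu^t) h.\<close>
definition zmu :: "nat \<Rightarrow> (int \<Rightarrow> nat) \<Rightarrow> vec \<Rightarrow> vec" where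
  "zmu r \<mu> x = (if x \<in> Vcarrier r then
      Vact r (omega \<mu>) (Hmult r (Hmult r (Tw r (wlam r \<mu>)) (yh r (conjp \<mu>)))
        (THE h. h \<in> Hcarrier r \<and> Vact r (omega (varpi r)) h = wproj (varpi r) x))
    else vzero)"

definition weyl :: "nat \<Rightarrow> (int \<Rightarrow> nat) \<Rightarrow> (vec \<Rightarrow> vec) set" where
  "weyl r \<mu> = {\<phi> \<circ> zmu r \<mu> | \<phi>. \<phi> \<in> Salg r}"

section \<open>Tensor products W \<otimes> S as spans of elementary tensors in a function space\<close>

type_synonym tens = "(vec \<times> int list) \<times> perm \<Rightarrow> K"

definition etens :: "(vec \<Rightarrow> vec) \<Rightarrow> hecke \<Rightarrow> tens" where
  "etens f h = (\<lambda>((x, l), u). f x l * h u)"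

definition tensprod :: "(vec \<Rightarrow> vec) set \<Rightarrow> hecke set \<Rightarrow> tens set" where
  "tensprod A B = {F. \<exists>(n::nat) a b. (\<forall>i<n. a i \<in> A \<and> b i \<in> B) \<and>
       F = (\<lambda>p. \<Sum>i<n. etens (a i) (b i) p)}"

definition tzero :: tens where "tzero = (\<lambda>p. 0)"
definition tadd :: "tens \<Rightarrow> tens \<Rightarrow> tens" where "tadd F G = (\<lambda>p. F p + G p)"
definition tsmul :: "K \<Rightarrow> tens \<Rightarrow> tens" where "tsmul c F = (\<lambda>p. c * F p)"

text \<open>Left S-action on the first factor: s.(f \<otimes> h) = (s o f) \<otimes> h.\<close>
definition tSact :: "(vec \<Rightarrow> vec) \<Rightarrow> tens \<Rightarrow> tens" where
  "tSact s F = (\<lambda>((x, l), u). s (\<lambda>l'. F ((x, l'), u)) l)"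

text \<open>Right H-action on the second factor: (f \<otimes> h).h' = f \<otimes> (h h').\<close>
definition tHact :: "nat \<Rightarrow> tens \<Rightarrow> hecke \<Rightarrow> tens" where
  "tHact r F h' = (\<lambda>((x, l), u). Hmult r (\<lambda>u'. F ((x, l), u')) h' u)"

definition Ssubmod :: "nat \<Rightarrow> vec set \<Rightarrow> bool" where
  "Ssubmod r U \<longleftrightarrow> U \<subseteq> Vcarrier r \<and> vzero \<in> U \<and>
     (\<forall>x\<in>U. \<forall>y\<in>U. vadd x y \<in> U) \<and> (\<forall>c. \<forall>x\<in>U. vsmul c x \<in> U) \<and>
     (\<forall>s\<in>Salg r. \<forall>x\<in>U. s x \<in> U)"

definition completely_reducible :: "nat \<Rightarrow> bool" where
  "completely_reducible r \<longleftrightarrow> (\<forall>U. Ssubmod r U \<longrightarrow>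
     (\<exists>U'. Ssubmod r U' \<and> U \<inter> U' = {vzero} \<and>
        (\<forall>x\<in>Vcarrier r. \<exists>u\<in>U. \<exists>u'\<in>U'. x = vadd u u')))"

end

(*
  Write n = n_mu = x_mu T_(w_mu) y_(mu^t) in H.  The double cosets of the two Young subgroups show that
  x_mu H y_(mu^t) = K n and that x_mu H y_(nu^t) can be nonzero only if nu dominates mu.  As Q(v) is an
  ordered field, the form for which the T_w are orthonormal is positive definite, and the T_s are
  self-adjoint for it.  Hence n n* n = c n with c nonzero, e_mu = n* n / c is a self-adjoint idempotent,
  and e_mu H e_nu is K e_mu for mu = nu and 0 otherwise.  The Casimir elements
  sum_w T_w* e_mu T_w yield orthogonal central idempotents eps_mu.  There are no others, since a
  central element is determined by its coefficients at representatives of the conjugacy classes: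
  specialize v = 1.  So 1 is the sum of the eps_mu and V = Omega_infty^(tensor r) is the direct sum of
  the V eps_mu.  Here W(infty, mu) is V e_mu by evaluation at omega_varpi, S^mu = n H, and
  q (x) n h |-> q h identifies their tensor product with V eps_mu.  Complete reducibility needs
  only the positive definite form: a submodule of V is V p for an orthogonal projection p in H.
*)
theory Submission
  imports Defs "HOL-Library.Function_Algebras"
begin

text \<open>H and its action are defined through arbitrarily chosen reduced words, so even
  associativity has to be proved. It rests on one fact: left and right multiplications by generators
  commute. \<open>H_induct\<close> then reduces a linear statement about H to one generator, and
  \<open>wembed\<close>, which maps each summand Omega_la to x_la H, turns identities in the tensor
  space into identities in H. The order on Q(v) is the one by the sign of leading coefficients.
  Positivity enters wherever a scalar must be invertible: in n n* n = c n, in the normalization of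
  eps_mu, in the orthogonal projections, and in the proof that averaged maps on the tensor space do
  not vanish. The tensor space V has infinite dimension, so its endomorphisms are reached through
  two explicit families: \<open>reg_hom\<close> prescribes the image of omega_varpi, and
  \<open>dyad\<close> averages a rank-one map over the T_w. Tensors are coefficient functions.
  Injectivity of the isomorphism is obtained by recovering every coefficient of a tensor from its
  image by a trace formula.\<close>

lemmas pointwise = plus_fun_apply zero_fun_apply minus_apply uminus_apply o_apply id_apply

text \<open>Vectors are functions here; induction rules leave eta-expanded vectors behind, and these rules
  would then dissolve them into pointwise abstractions.\<close>

declare pointwise [simp del]

lemma sum_fun_apply: "(\<Sum>a\<in>A. f a) x = (\<Sum>a\<in>A. f a x)"
  for f :: "'a \<Rightarrow> 'i \<Rightarrow> 'b::comm_monoid_add"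
  by (induction A rule: infinite_finite_induct) (auto simp: pointwise)

abbreviation vdiff :: K where "vdiff \<equiv> vv - inverse vv"

lemma vv_nz [simp]: "vv \<noteq> 0"
  by (simp add: vv_def Zero_fract_def eq_fract)

text \<open>v and -1/v are the two eigenvalues of a generator, and \<open>xTy_zero\<close> rests on
  their being distinct. Equality would make v^2 = -1, against the order.\<close>

lemma vv_neq: "vv \<noteq> - inverse vv"
proof
  assume "vv = - inverse vv"
  then have "vv * vv = - 1" by (metis mult_minus_right right_inverse vv_nz)
  moreover have "vv * vv \<ge> 0" by (rule zero_le_square)
  ultimately show False by simp
qed

text \<open>One scalar multiplication for coefficient functions over any index set, so that words
  and permutations share the same rules; addition is that of functions.\<close>

definition scl :: "K \<Rightarrow> ('i \<Rightarrow> K) \<Rightarrow> 'i \<Rightarrow> K" where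
  "scl c f = (\<lambda>i. c * f i)"

lemma scl_apply: "scl c f i = c * f i" by (simp add: scl_def)
lemma scl_simps [simp]: "scl 1 f = f" "scl 0 f = 0" "scl c 0 = 0" "scl c (scl d f) = scl (c * d) f"
  by (auto simp: pointwise scl_apply fun_eq_iff)
lemma scl_add: "scl c (f + g) = scl c f + scl c g" "scl (c + d) f = scl c f + scl d f"
  by (auto simp: pointwise scl_apply fun_eq_iff algebra_simps)
lemma scl_sum: "scl c (\<Sum>a\<in>A. f a) = (\<Sum>a\<in>A. scl c (f a))"
  by (auto simp: pointwise scl_apply fun_eq_iff sum_fun_apply sum_distrib_left)
lemma scl_sum_left: "scl (\<Sum>a\<in>A. c a) f = (\<Sum>a\<in>A. scl (c a) f)"
  by (auto simp: pointwise scl_apply fun_eq_iff sum_fun_apply sum_distrib_right)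
lemma minus_scl: "- f = scl (-1) f" by (auto simp: pointwise scl_apply fun_eq_iff)

section \<open>Inversions\<close>

text \<open>The length for maps into any linear order: besides permutations it is applied to words,
  where it measures how far a word is from being sorted.\<close>

definition invs :: "nat \<Rightarrow> (nat \<Rightarrow> 'a::linorder) \<Rightarrow> nat" where
  "invs n F = card {(a, b). a < b \<and> b < n \<and> F b < F a}"

lemma slen_invs: "slen r w = invs r w"
  by (simp add: slen_def invs_def)

lemma finite_invs: "finite {(a, b). a < b \<and> b < n \<and> (F b :: 'a::linorder) < F a}" for n :: nat
  by (rule finite_subset[of _ "{..<n} \<times> {..<n}"]) auto

lemma sgen_sgen [simp]: "sgen j (sgen j a) = a" "sgen j \<circ> sgen j = id" "sgen j \<circ> (sgen j \<circ> w) = w"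
    "w \<circ> sgen j \<circ> sgen j = w"
  by (auto simp: pointwise sgen_def fun_eq_iff)

lemma sgen_apply: "sgen j a = (if a = j then Suc j else if a = Suc j then j else a)"
  by (auto simp: sgen_def transpose_def)

lemma sgen_simps [simp]: "sgen j j = Suc j" "sgen j (Suc j) = j"
  by (auto simp: sgen_apply)

lemma inv_sgen [simp]: "inv (sgen j) = sgen j" by (simp add: sgen_def)

text \<open>Applying \<open>sgen j\<close> to both entries keeps every ordered pair ordered except
  (j, j+1). So the inversions of F correspond to those of F o s_j other than the new one at (j,
  j+1).\<close>

lemma invs_swap:
  assumes j: "Suc j < n" and lt: "F j < F (Suc j)"
  shows "invs n (F \<circ> sgen j) = Suc (invs n F)"
proof -
  let ?I = "\<lambda>F. {(a, b). a < b \<and> b < n \<and> (F b :: 'a) < F a}"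
  let ?m = "map_prod (sgen j) (sgen j)"
  have mono: "sgen j a < sgen j b" if "a < b" "(a, b) \<noteq> (j, Suc j)" for a b
    using that by (auto simp: sgen_apply)
  have bd: "sgen j b < n" if "b < n" for b using that j by (auto simp: sgen_apply)
  have nin: "(j, Suc j) \<notin> ?I F" using lt by auto
  have "?I (F \<circ> sgen j) = insert (j, Suc j) (?m ` ?I F)"
  proof (intro set_eqI iffI)
    fix p assume p: "p \<in> ?I (F \<circ> sgen j)"
    show "p \<in> insert (j, Suc j) (?m ` ?I F)"
    proof (cases "p = (j, Suc j)")
      case False
      obtain a b where ab: "p = (a, b)" by (cases p)
      then have "a < b" "b < n" "F (sgen j b) < F (sgen j a)" using p by (auto simp: pointwise)
      then have "?m p \<in> ?I F" using mono[of a b] bd[of b] False ab by simp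
      moreover have "?m (?m p) = p" by (cases p) auto
      ultimately show ?thesis by (intro insertI2 image_eqI[of p ?m "?m p"]) simp_all
    qed simp
  next
    fix p assume p: "p \<in> insert (j, Suc j) (?m ` ?I F)"
    show "p \<in> ?I (F \<circ> sgen j)"
    proof (cases "p = (j, Suc j)")
      case True then show ?thesis using lt j by (auto simp: pointwise)
    next
      case False
      then obtain a b where ab: "p = (sgen j a, sgen j b)" "a < b" "b < n" "F b < F a" using p by auto
      moreover have "(a, b) \<noteq> (j, Suc j)" using ab lt by auto
      ultimately show ?thesis using mono[of a b] bd[of b] by (simp add: pointwise)
    qed
  qed
  moreover have "(j, Suc j) \<notin> ?m ` ?I F"
  proof
    assume "(j, Suc j) \<in> ?m ` ?I F"
    then obtain a b where "j = sgen j a" "Suc j = sgen j b" "a < b" by auto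
    then have "a = Suc j" "b = j" by (metis sgen_sgen(1) sgen_simps)+
    with \<open>a < b\<close> show False by simp
  qed
  moreover have "card (?m ` ?I F) = card (?I F)"
    by (intro card_image inj_on_inverseI[of _ ?m]) auto
  moreover have "finite (?m ` ?I F)" by (intro finite_imageI finite_invs)
  ultimately show ?thesis by (simp add: invs_def)
qed

lemma invs_inj_eq: "invs n F = 0 \<longleftrightarrow> (\<forall>a b. a < b \<longrightarrow> b < n \<longrightarrow> F a \<le> F b)"
  unfolding invs_def card_0_eq[OF finite_invs] by (simp add: set_eq_iff not_less) (meson not_less)

section \<open>Permutations\<close>

lemma perms_finite [simp]: "finite (perms r)"
  by (simp add: perms_def finite_permutations)

lemma perms_id [simp]: "id \<in> perms r" by (simp add: perms_def permutes_id)

lemma perms_comp [simp]: "u \<in> perms r \<Longrightarrow> w \<in> perms r \<Longrightarrow> u \<circ> w \<in> perms r"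
  by (simp add: perms_def permutes_compose)

lemma perms_inv [simp]: "u \<in> perms r \<Longrightarrow> inv u \<in> perms r"
  by (simp add: perms_def permutes_inv)

lemma perms_sgen [simp]: "Suc j < r \<Longrightarrow> sgen j \<in> perms r"
  by (simp add: perms_def sgen_def permutes_swap_id)

lemma perms_sgen_right [simp]: "Suc j < r \<Longrightarrow> w \<circ> sgen j \<in> perms r \<longleftrightarrow> w \<in> perms r"
  by (metis perms_comp perms_sgen sgen_sgen(4))

lemma perms_sgen_left [simp]: "Suc j < r \<Longrightarrow> sgen j \<circ> w \<in> perms r \<longleftrightarrow> w \<in> perms r"
  by (metis perms_comp perms_sgen sgen_sgen(3))

lemma perms_bij: "w \<in> perms r \<Longrightarrow> bij w"
  by (auto simp: perms_def permutes_bij)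

lemma perms_inv_apply:
  assumes "w \<in> perms r" shows "w (inv w a) = a" "inv w (w a) = a" "inv (inv w) = w" "inv w \<circ> w = id"
      "w \<circ> inv w = id"
  using assms permutes_inverses[of w "{0..<r}"] permutes_inv_inv[of w "{0..<r}"] permutes_inv_o[of w
      "{0..<r}"]
  by (simp_all add: perms_def)

lemma perms_inv_comp: "u \<in> perms r \<Longrightarrow> w \<in> perms r \<Longrightarrow> inv (u \<circ> w) = inv w \<circ> inv u"
  by (intro o_inv_distrib) (auto intro: perms_bij)

lemma perms_lt: "w \<in> perms r \<Longrightarrow> w a < r \<longleftrightarrow> a < r"
  using permutes_in_image[of w "{0..<r}" a] by (simp add: perms_def)

lemma perms_eq_iff: "w \<in> perms r \<Longrightarrow> w a = w b \<longleftrightarrow> a = b"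
  by (rule inj_eq, rule bij_is_inj, rule perms_bij)

lemma perms_inv_inv [simp]: "w \<in> perms r \<Longrightarrow> inv (inv w) = w"
  by (rule perms_inv_apply)

lemma perms_fix: "w \<in> perms r \<Longrightarrow> \<not> a < r \<Longrightarrow> w a = a"
  unfolding perms_def by (drule CollectD, erule permutes_not_in, simp)

lemma sum_perms_right: "Suc j < r \<Longrightarrow> (\<Sum>w\<in>perms r. G (w \<circ> sgen j)) = (\<Sum>w\<in>perms r. G w)"
  by (rule sum.reindex_bij_witness[of _ "\<lambda>w. w \<circ> sgen j" "\<lambda>w. w \<circ> sgen j"]) auto

lemma sum_perms_inv: "(\<Sum>w\<in>perms r. G (inv w)) = (\<Sum>w\<in>perms r. G w)"
  by (rule sum.reindex_bij_witness[of _ inv inv]) auto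

lemma slen_asc: "Suc j < r \<Longrightarrow> w j < w (Suc j) \<Longrightarrow> slen r (w \<circ> sgen j) = Suc (slen r w)"
  by (simp add: slen_invs invs_swap)

lemma slen_desc: "Suc j < r \<Longrightarrow> w (Suc j) < w j \<Longrightarrow> slen r w = Suc (slen r (w \<circ> sgen j))"
  using slen_asc[of j r "w \<circ> sgen j"] by (simp add: pointwise)

lemma slen_desc_iff: "w \<in> perms r \<Longrightarrow> Suc j < r \<Longrightarrow> slen r (w \<circ> sgen j) < slen r w \<longleftrightarrow> w (Suc j) < w j"
  using slen_asc[of j r w] slen_desc[of j r w] perms_eq_iff[of w r j "Suc j"]
  by (cases "w j" "w (Suc j)" rule: linorder_cases) auto

lemma slen_inv [simp]:
  assumes w: "w \<in> perms r" shows "slen r (inv w) = slen r w"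
  unfolding slen_def
proof (rule bij_betw_same_card[of "\<lambda>(a, b). (inv w b, inv w a)"],
       rule bij_betw_byWitness[where f' = "\<lambda>(a, b). (w b, w a)"])
qed (use w in \<open>auto simp: perms_lt[OF perms_inv[OF w]] perms_lt[OF w] perms_inv_apply[OF w]\<close>)

lemma slen_left:
  assumes "w \<in> perms r" "Suc j < r" shows "slen r (sgen j \<circ> w) = slen r (inv w \<circ> sgen j)"
proof -
  have "slen r (sgen j \<circ> w) = slen r (inv (sgen j \<circ> w))" using assms by simp
  also have "inv (sgen j \<circ> w) = inv w \<circ> sgen j" using assms by (simp add: perms_inv_comp[of _ r])
  finally show ?thesis .
qed

lemma slen_left_iff:
  assumes "w \<in> perms r" "Suc j < r"
  shows "slen r (sgen j \<circ> w) < slen r w \<longleftrightarrow> inv w (Suc j) < inv w j"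
  using slen_desc_iff[of "inv w" r j] slen_left assms by simp

lemma slen_id [simp]: "slen r id = 0"
  by (simp add: slen_invs invs_inj_eq pointwise)

text \<open>Without descents w increases strictly below r, gaining at least one at each step; the
  bounds from 0 up to a and from a up to r - 1 leave only w a = a.\<close>

lemma perm_id_if_no_desc:
  assumes w: "w \<in> perms r" and nd: "\<And>j. Suc j < r \<Longrightarrow> \<not> w (Suc j) < w j"
  shows "w = id"
proof
  fix a
  have lt: "w j < w (Suc j)" if "Suc j < r" for j
    using nd[OF that] perms_eq_iff[OF w, of j "Suc j"] by (metis linorder_neqE_nat n_not_Suc_n)
  have gr: "w i + k \<le> w (i + k)" if "i + k < r" for i k
    using that
  proof (induction k)
    case (Suc k) then show ?case using lt[of "i + k"] by simp
  qed simp
  show "w a = id a"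
  proof (cases "a < r")
    case True
    have "w 0 + a \<le> w a" using gr[of 0 a] True by simp
    moreover have "w a + (r - 1 - a) \<le> w (r - 1)" using gr[of a "r - 1 - a"] True by simp
    moreover have "w (r - 1) < r" using True perms_lt[OF w] by simp
    ultimately show ?thesis using True by (simp add: pointwise)
  qed (simp add: perms_fix[OF w] pointwise)
qed

lemma perm_desc_ex: "w \<in> perms r \<Longrightarrow> w \<noteq> id \<Longrightarrow> \<exists>j. Suc j < r \<and> w (Suc j) < w j"
  using perm_id_if_no_desc by blast

lemma slen_induct [consumes 1, case_names id desc]:
  assumes "w \<in> perms r" and "P id"
    and step: "\<And>w j. w \<in> perms r \<Longrightarrow> Suc j < r \<Longrightarrow> w (Suc j) < w j \<Longrightarrow> P (w \<circ> sgen j) \<Longrightarrow> P w"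
  shows "P w"
  using assms(1)
proof (induction "slen r w" arbitrary: w rule: less_induct)
  case less
  show ?case
  proof (cases "w = id")
    case False
    then obtain j where "Suc j < r" "w (Suc j) < w j" using perm_desc_ex less.prems by blast
    then show ?thesis using less step slen_desc[of j r w] by simp
  qed (simp add: assms(2))
qed

section \<open>Reduced words\<close>

definition wperm :: "nat list \<Rightarrow> perm" where
  "wperm js = foldr (\<lambda>j p. sgen j \<circ> p) js id"

lemma wperm_simps [simp]: "wperm [] = id" "wperm (j # js) = sgen j \<circ> wperm js"
  by (simp_all add: wperm_def pointwise)

lemma reduced_word_iff: "reduced_word r w js \<longleftrightarrow> (\<forall>j\<in>set js. Suc j < r) \<and> wperm js = w \<and> length js = slen r w"
  by (simp add: reduced_word_def wperm_def)

lemma wperm_perms: "\<forall>j\<in>set js. Suc j < r \<Longrightarrow> wperm js \<in> perms r"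
  by (induction js) auto

lemma slen_left_cases:
  assumes "w \<in> perms r" "Suc j < r"
  shows "slen r (sgen j \<circ> w) = Suc (slen r w) \<or> slen r w = Suc (slen r (sgen j \<circ> w))"
proof -
  have "inv w j \<noteq> inv w (Suc j)" using perms_eq_iff[OF perms_inv[OF assms(1)]] by simp
  then show ?thesis using slen_asc[of j r "inv w"] slen_desc[of j r "inv w"] slen_left[OF assms] assms
    by (auto simp: neq_iff)
qed

lemma slen_wperm_le: "\<forall>j\<in>set js. Suc j < r \<Longrightarrow> slen r (wperm js) \<le> length js"
proof (induction js)
  case (Cons j js)
  then have "slen r (wperm js) \<le> length js" "wperm js \<in> perms r" "Suc j < r"
    by (simp_all add: wperm_perms)
  then have "slen r (sgen j \<circ> wperm js) \<le> length (j # js)"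
    using slen_left_cases[of "wperm js" r j] by auto
  then show ?case unfolding wperm_simps .
qed simp

text \<open>Each letter changes the length by exactly one, and the length never exceeds the number
  of letters. A reduced word wastes no letter, so its tail is again reduced.\<close>

lemma reduced_word_Cons:
  assumes "reduced_word r w (j # js)"
  shows "Suc j < r" "reduced_word r (sgen j \<circ> w) js" "slen r w = Suc (slen r (sgen j \<circ> w))" "sgen j
      \<circ> w \<in> perms r"
proof -
  have w: "w = sgen j \<circ> wperm js" and js: "\<forall>j\<in>set js. Suc j < r" and j: "Suc j < r"
    and len: "Suc (length js) = slen r w"
    using assms by (auto simp: reduced_word_iff)
  have sw: "sgen j \<circ> w = wperm js" by (simp add: w)
  have "slen r w = Suc (slen r (wperm js))" and "length js = slen r (wperm js)"
    using slen_left_cases[of "wperm js" r j] slen_wperm_le[OF js] len w wperm_perms[OF js] j by auto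
  then show "slen r w = Suc (slen r (sgen j \<circ> w))" "reduced_word r (sgen j \<circ> w) js"
    using js sw by (auto simp: reduced_word_iff)
  show "Suc j < r" by (rule j)
  show "sgen j \<circ> w \<in> perms r" using wperm_perms[OF js] sw by simp
qed

lemma reduced_word_ex:
  assumes w: "w \<in> perms r" shows "\<exists>js. reduced_word r w js"
proof -
  \<comment> \<open>\<open>slen_induct\<close> strips letters on the right, whereas a list grows at
    its head; passing to inverses reconciles the two.\<close>
  have *: "\<exists>js. reduced_word r (inv u) js" if "u \<in> perms r" for u
    using that
  proof (induction rule: slen_induct)
    case id
    have "reduced_word r id []" by (simp add: reduced_word_iff)
    then show ?case by (metis inv_id)
  next
    case (desc w j)
    then obtain js where js: "reduced_word r (inv (w \<circ> sgen j)) js" by blast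
    have "inv (w \<circ> sgen j) = sgen j \<circ> inv w" using desc by (simp add: perms_inv_comp[of _ r])
    moreover have "slen r w = Suc (slen r (w \<circ> sgen j))" using desc by (simp add: slen_desc)
    ultimately have "reduced_word r (inv w) (j # js)" using js desc
      by (auto simp: reduced_word_iff slen_left)
    then show ?case by blast
  qed
  show ?thesis using *[of "inv w"] w by simp
qed

section \<open>The Hecke algebra\<close>

definition bas :: "perm \<Rightarrow> hecke" where
  "bas w = (\<lambda>u. if u = w then 1 else 0)"

text \<open>Right multiplication by the generator \<open>bas (sgen j)\<close>, the mirror image of
  \<open>Hgen\<close>; the condition u (j+1) < u j says that u s_j is shorter than u.\<close>

definition Rgen :: "nat \<Rightarrow> hecke \<Rightarrow> hecke" where
  "Rgen j h = (\<lambda>u. h (u \<circ> sgen j) + (if u (Suc j) < u j then vdiff * h u else 0))"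

lemma bas_apply: "bas w u = (if u = w then 1 else 0)" by (simp add: bas_def)

context fixes r :: nat begin

lemma HcD: "h \<in> Hcarrier r \<Longrightarrow> u \<notin> perms r \<Longrightarrow> h u = 0"
  by (auto simp: Hcarrier_def)

lemma HcI: "(\<And>u. u \<notin> perms r \<Longrightarrow> h u = 0) \<Longrightarrow> h \<in> Hcarrier r"
  by (auto simp: Hcarrier_def)

lemma Hc_eqI: "a \<in> Hcarrier r \<Longrightarrow> b \<in> Hcarrier r \<Longrightarrow> (\<And>u. u \<in> perms r \<Longrightarrow> a u = b u) \<Longrightarrow> a = b"
  by (rule ext) (metis HcD)

lemma Hc_basic [simp]: "0 \<in> Hcarrier r"
  "a \<in> Hcarrier r \<Longrightarrow> b \<in> Hcarrier r \<Longrightarrow> a + b \<in> Hcarrier r"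
  "a \<in> Hcarrier r \<Longrightarrow> b \<in> Hcarrier r \<Longrightarrow> a - b \<in> Hcarrier r"
  "a \<in> Hcarrier r \<Longrightarrow> scl c a \<in> Hcarrier r"
  "w \<in> perms r \<Longrightarrow> bas w \<in> Hcarrier r"
  by (auto simp: Hcarrier_def bas_def pointwise scl_apply) (metis add.right_neutral, metis)

lemma Hc_sum [simp]: "(\<And>i. i \<in> A \<Longrightarrow> f i \<in> Hcarrier r) \<Longrightarrow> (\<Sum>i\<in>A. f i) \<in> Hcarrier r"
  by (induction A rule: infinite_finite_induct) auto

lemma Hc_gen [simp]:
  assumes "Suc j < r" "h \<in> Hcarrier r"
  shows "Rgen j h \<in> Hcarrier r" "Hgen r j h \<in> Hcarrier r"
  using assms by (auto intro!: HcI simp: Rgen_def Hgen_def HcD)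

lemma Hgen_apply:
  assumes "u \<in> perms r" "Suc j < r"
  shows "Hgen r j h u = h (sgen j \<circ> u) + (if inv u (Suc j) < inv u j then vdiff * h u else 0)"
  using slen_left_iff[OF assms] by (simp add: Hgen_def)

lemma Rgen_lin: "Rgen j (a + b) = Rgen j a + Rgen j b" "Rgen j (scl c a) = scl c (Rgen j a)" "Rgen j 0 = 0"
  "Rgen j (\<Sum>i\<in>A. f i) = (\<Sum>i\<in>A. Rgen j (f i))"
proof -
  show *: "Rgen j (a + b) = Rgen j a + Rgen j b" "Rgen j 0 = 0" for a b
    by (auto simp: pointwise scl_apply fun_eq_iff Rgen_def algebra_simps)
  show "Rgen j (scl c a) = scl c (Rgen j a)" by (auto simp: pointwise scl_apply fun_eq_iff Rgen_def
      algebra_simps)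
  show "Rgen j (\<Sum>i\<in>A. f i) = (\<Sum>i\<in>A. Rgen j (f i))"
    by (induction A rule: infinite_finite_induct) (auto simp: *)
qed

lemma Hgen_lin: "Hgen r j (a + b) = Hgen r j a + Hgen r j b" "Hgen r j (scl c a) = scl c (Hgen r j
    a)" "Hgen r j 0 = 0"
  "Hgen r j (\<Sum>i\<in>A. f i) = (\<Sum>i\<in>A. Hgen r j (f i))"
proof -
  show *: "Hgen r j (a + b) = Hgen r j a + Hgen r j b" "Hgen r j 0 = 0" for a b
    by (auto simp: pointwise scl_apply fun_eq_iff Hgen_def algebra_simps)
  show "Hgen r j (scl c a) = scl c (Hgen r j a)" by (auto simp: pointwise scl_apply fun_eq_iff
      Hgen_def algebra_simps)
  show "Hgen r j (\<Sum>i\<in>A. f i) = (\<Sum>i\<in>A. Hgen r j (f i))"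
    by (induction A rule: infinite_finite_induct) (auto simp: *)
qed

text \<open>The left and right descents of \<open>u\<close> are both affected by \<open>s\<^sub>i\<close> and \<open>s\<^sub>j\<close> only if
  \<open>s\<^sub>i u = u s\<^sub>j\<close>, and then the two extra terms cancel.\<close>

lemma Hgen_Rgen:
  assumes i: "Suc i < r" and j: "Suc j < r" and h: "h \<in> Hcarrier r"
  shows "Hgen r i (Rgen j h) = Rgen j (Hgen r i h)"
proof (rule Hc_eqI)
  fix u assume u: "u \<in> perms r"
  let ?s = "sgen i" and ?t = "sgen j"
  have ne: "u j \<noteq> u (Suc j)" "inv u i \<noteq> inv u (Suc i)"
    using perms_eq_iff[OF u, of j "Suc j"] perms_eq_iff[OF perms_inv[OF u], of i "Suc i"] by auto
  have iut: "inv (u \<circ> ?t) = ?t \<circ> inv u" using perms_inv_comp[OF u perms_sgen[OF j]] by simp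
  have L: "Hgen r i (Rgen j h) u = h (?s \<circ> u \<circ> ?t) + (if ?s (u (Suc j)) < ?s (u j) then vdiff * h
      (?s \<circ> u) else 0)
     + (if inv u (Suc i) < inv u i then vdiff * (h (u \<circ> ?t) + (if u (Suc j) < u j then vdiff * h u
         else 0)) else 0)"
    using u i by (simp add: Hgen_apply Rgen_def pointwise)
  have R: "Rgen j (Hgen r i h) u = h (?s \<circ> u \<circ> ?t) + (if ?t (inv u (Suc i)) < ?t (inv u i) then
      vdiff * h (u \<circ> ?t) else 0)
     + (if u (Suc j) < u j then vdiff * (h (?s \<circ> u) + (if inv u (Suc i) < inv u i then vdiff * h u
         else 0)) else 0)"
    using u i j iut by (simp add: Hgen_apply Rgen_def comp_assoc pointwise)
  show "Hgen r i (Rgen j h) u = Rgen j (Hgen r i h) u"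
  proof (cases "(u j = i \<and> u (Suc j) = Suc i) \<or> (u j = Suc i \<and> u (Suc j) = i)")
    case True
    have eq: "?s \<circ> u = u \<circ> ?t"
    proof
      fix a
      consider "a = j" | "a = Suc j" | "a \<noteq> j" "a \<noteq> Suc j" by blast
      then show "(?s \<circ> u) a = (u \<circ> ?t) a"
      proof cases
        case 3
        then have "u a \<noteq> u j" "u a \<noteq> u (Suc j)" using perms_eq_iff[OF u] by blast+
        then have "u a \<noteq> i" "u a \<noteq> Suc i" using True by metis+
        then show ?thesis using 3 by (simp add: o_apply sgen_apply)
      qed (use True in \<open>auto simp: o_apply\<close>)
    qed
    have "inv u i = (if u j = i then j else Suc j)" "inv u (Suc i) = (if u j = i then Suc j else j)"
      using True perms_inv_apply(2)[OF u, of j] perms_inv_apply(2)[OF u, of "Suc j"] by auto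
    then show ?thesis using True unfolding L R eq by (auto simp: algebra_simps)
  next
    case False
    have a: "?s (u (Suc j)) < ?s (u j) \<longleftrightarrow> u (Suc j) < u j"
      using False ne by (auto simp: sgen_apply)
    have "\<not> ((inv u i = j \<and> inv u (Suc i) = Suc j) \<or> (inv u i = Suc j \<and> inv u (Suc i) = j))"
      using False perms_inv_apply(1)[OF u, of i] perms_inv_apply(1)[OF u, of "Suc i"] by auto
    then have b: "?t (inv u (Suc i)) < ?t (inv u i) \<longleftrightarrow> inv u (Suc i) < inv u i"
      using ne by (auto simp: sgen_apply)
    show ?thesis unfolding L R a b by (auto simp: algebra_simps)
  qed
qed (use assms in auto)

lemma Rgen_bas: "Rgen j (bas w) = bas (w \<circ> sgen j) + (if w (Suc j) < w j then scl vdiff (bas w) else 0)"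
proof -
  have "u \<circ> sgen j = w \<longleftrightarrow> u = w \<circ> sgen j" for u by (metis sgen_sgen(4))
  then show ?thesis by (auto simp: pointwise scl_apply fun_eq_iff Rgen_def bas_def)
qed

lemma Hgen_bas:
  assumes w: "w \<in> perms r" and j: "Suc j < r"
  shows "Hgen r j (bas w) = bas (sgen j \<circ> w) + (if inv w (Suc j) < inv w j then scl vdiff (bas w) else 0)"
proof (rule Hc_eqI)
  fix u assume u: "u \<in> perms r"
  have "sgen j \<circ> u = w \<longleftrightarrow> u = sgen j \<circ> w" by (metis sgen_sgen(3))
  then show "Hgen r j (bas w) u = (bas (sgen j \<circ> w) + (if inv w (Suc j) < inv w j then scl vdiff
      (bas w) else 0)) u"
    using Hgen_apply[OF u j, of "bas w"] by (auto simp: bas_def pointwise scl_apply)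
qed (use assms in auto)

lemma Hgen_bas_asc:
  assumes w: "w \<in> perms r" and j: "Suc j < r" and "slen r (sgen j \<circ> w) = Suc (slen r w)"
  shows "Hgen r j (bas w) = bas (sgen j \<circ> w)"
  using Hgen_bas[OF w j] slen_left_iff[OF w j] assms(3) by auto

lemma gen_bas_id:
  assumes "Suc j < r" shows "Hgen r j (bas id) = bas (sgen j)" "Rgen j (bas id) = bas (sgen j)"
proof -
  have "inv (id :: perm) = id" by (rule inv_id)
  then show "Hgen r j (bas id) = bas (sgen j)" using Hgen_bas[OF perms_id assms] by (simp add: id_apply)
qed (use Rgen_bas[of j id] in \<open>simp add: id_apply\<close>)

lemma rword_reduced: "w \<in> perms r \<Longrightarrow> reduced_word r w (rword r w)"
  unfolding rword_def by (rule someI_ex) (rule reduced_word_ex)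

lemma rword_gen: "w \<in> perms r \<Longrightarrow> j \<in> set (rword r w) \<Longrightarrow> Suc j < r"
  using rword_reduced by (auto simp: reduced_word_iff)

lemma foldr_Hgen_bas: "reduced_word r w js \<Longrightarrow> foldr (Hgen r) js (bas id) = bas w"
proof (induction js arbitrary: w)
  case Nil
  then show ?case by (simp add: reduced_word_iff id_apply[abs_def])
next
  case (Cons j js)
  note c = reduced_word_Cons[OF Cons.prems]
  have "Hgen r j (bas (sgen j \<circ> w)) = bas (sgen j \<circ> (sgen j \<circ> w))"
    by (rule Hgen_bas_asc) (use c in simp_all)
  moreover have "foldr (Hgen r) (j # js) (bas id) = Hgen r j (foldr (Hgen r) js (bas id))" by (simp
      add: o_apply)
  ultimately show ?case unfolding Cons.IH[OF c(2)] by simp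
qed

lemma Hc_foldr [simp]: "\<forall>j\<in>set js. Suc j < r \<Longrightarrow> h \<in> Hcarrier r \<Longrightarrow> foldr (Hgen r) js h \<in> Hcarrier r"
  by (induction js) (auto simp: pointwise)

lemma foldr_Rgen: "\<forall>j\<in>set js. Suc j < r \<Longrightarrow> h \<in> Hcarrier r \<Longrightarrow> Suc i < r \<Longrightarrow>
    foldr (Hgen r) js (Rgen i h) = Rgen i (foldr (Hgen r) js h)"
  by (induction js) (auto simp: Hgen_Rgen pointwise)

lemma fold_Hgen: "\<forall>j\<in>set js. Suc j < r \<Longrightarrow> h \<in> Hcarrier r \<Longrightarrow> Suc i < r \<Longrightarrow>
    fold Rgen js (Hgen r i h) = Hgen r i (fold Rgen js h)"
  by (induction js arbitrary: h) (auto simp: Hgen_Rgen[symmetric] pointwise)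

text \<open>Since left and right generators commute, the letter applied first from the right can be
  pulled out to the left. There it lengthens the remaining product, so both ways of multiplying out
  a reduced word give \<open>bas w\<close>.\<close>

lemma fold_Rgen_bas: "reduced_word r w js \<Longrightarrow> fold Rgen js (bas id) = bas w"
proof (induction js arbitrary: w)
  case Nil
  then show ?case by (simp add: reduced_word_iff id_apply[abs_def])
next
  case (Cons j js)
  note c = reduced_word_Cons[OF Cons.prems]
  have js: "\<forall>j\<in>set js. Suc j < r" using Cons.prems by (simp add: reduced_word_iff)
  have "fold Rgen (j # js) (bas id) = Hgen r j (fold Rgen js (bas id))"
    using fold_Hgen[OF js _ c(1), of "bas id"] gen_bas_id[OF c(1)] by (simp add: o_apply)
  also have "\<dots> = Hgen r j (bas (sgen j \<circ> w))" using Cons.IH[OF c(2)] by simp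
  also have "\<dots> = bas (sgen j \<circ> (sgen j \<circ> w))"
    by (rule Hgen_bas_asc) (use c in simp_all)
  finally show ?case by simp
qed

lemma H_expand: "h \<in> Hcarrier r \<Longrightarrow> h = (\<Sum>w\<in>perms r. scl (h w) (bas w))"
  by (rule Hc_eqI) (simp_all add: sum_fun_apply scl_apply bas_apply if_distrib cong: if_cong)

text \<open>Every \<open>bas w\<close> arises from 1 by right generators, so a property closed under
  linear combinations need only be followed through one right generator. This keeps the chosen
  reduced words out of most later proofs.\<close>

lemma H_induct [consumes 1, case_names one add scl gen]:
  assumes h: "h \<in> Hcarrier r" and one: "P (bas id)"
    and add: "\<And>a b. a \<in> Hcarrier r \<Longrightarrow> b \<in> Hcarrier r \<Longrightarrow> P a \<Longrightarrow> P b \<Longrightarrow> P (a + b)"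
    and scl: "\<And>c a. a \<in> Hcarrier r \<Longrightarrow> P a \<Longrightarrow> P (scl c a)"
    and gen: "\<And>j a. Suc j < r \<Longrightarrow> a \<in> Hcarrier r \<Longrightarrow> P a \<Longrightarrow> P (Rgen j a)"
  shows "P h"
proof -
  have fold: "P (fold Rgen js a)" if "\<forall>j\<in>set js. Suc j < r" "a \<in> Hcarrier r" "P a" for js a
    using that by (induction js arbitrary: a) (simp_all add: gen pointwise)
  have bas: "P (bas w)" if "w \<in> perms r" for w
    using fold[of "rword r w" "bas id"] fold_Rgen_bas[OF rword_reduced[OF that]] one rword_gen[OF
        that] by simp
  have "P (\<Sum>w\<in>A. scl (h w) (bas w))" if "A \<subseteq> perms r" for A
    using finite_subset[OF that perms_finite] that
  proof (induction A)
    case empty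
    show ?case using scl[OF _ one, of 0] by simp
  next
    case (insert w A)
    then show ?case by (simp add: add scl bas subset_eq)
  qed
  from this[OF order_refl] show ?thesis unfolding H_expand[OF h, symmetric] .
qed

section \<open>Multiplication in the Hecke algebra\<close>

lemma Hmult_eq: "Hmult r a b = (\<Sum>w\<in>perms r. scl (a w) (Hleft r w b))"
  by (auto simp: pointwise scl_apply fun_eq_iff Hmult_def sum_fun_apply)

lemma Hleft_lin: "Hleft r w (a + b) = Hleft r w a + Hleft r w b" "Hleft r w (scl c a) = scl c (Hleft r w a)"
proof -
  have "foldr (Hgen r) js (a + b) = foldr (Hgen r) js a + foldr (Hgen r) js b"
    "foldr (Hgen r) js (scl c a) = scl c (foldr (Hgen r) js a)" for js
    by (induction js) (auto simp: Hgen_lin pointwise)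
  then show "Hleft r w (a + b) = Hleft r w a + Hleft r w b" "Hleft r w (scl c a) = scl c (Hleft r w a)"
    by (simp_all add: Hleft_def)
qed

lemma Hmult_lin:
  "Hmult r a (b + c) = Hmult r a b + Hmult r a c" "Hmult r a (scl d b) = scl d (Hmult r a b)"
  "Hmult r (a + b) c = Hmult r a c + Hmult r b c" "Hmult r (scl d a) b = scl d (Hmult r a b)"
  by (simp_all add: Hmult_eq Hleft_lin scl_add scl_sum sum.distrib mult.commute pointwise scl_apply)

lemma Hmult_0 [simp]: "Hmult r a 0 = 0" "Hmult r 0 b = 0"
  using Hmult_lin(2)[of a 0 0] Hmult_lin(4)[of 0 0 b] by simp_all

lemma Hmult_sum: "Hmult r a (\<Sum>i\<in>A. f i) = (\<Sum>i\<in>A. Hmult r a (f i))"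
  "Hmult r (\<Sum>i\<in>A. f i) a = (\<Sum>i\<in>A. Hmult r (f i) a)"
  by (induction A rule: infinite_finite_induct) (auto simp: Hmult_lin)

lemma Hmult_diff: "Hmult r a (b - c) = Hmult r a b - Hmult r a c" "Hmult r (a - b) c = Hmult r a c -
    Hmult r b c"
  unfolding diff_conv_add_uminus minus_scl by (simp_all add: Hmult_lin)

lemma Hc_Hmult [simp]: "b \<in> Hcarrier r \<Longrightarrow> Hmult r a b \<in> Hcarrier r"
  unfolding Hmult_eq Hleft_def by (intro Hc_sum Hc_basic(4) Hc_foldr) (auto simp: rword_gen)

lemma Hmult_Rgen: "b \<in> Hcarrier r \<Longrightarrow> Suc j < r \<Longrightarrow> Hmult r a (Rgen j b) = Rgen j (Hmult r a b)"
  unfolding Hmult_eq Hleft_def Rgen_lin by (intro sum.cong refl) (simp add: foldr_Rgen rword_gen)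

lemma Hleft_one: "w \<in> perms r \<Longrightarrow> Hleft r w (bas id) = bas w"
  by (simp add: Hleft_def foldr_Hgen_bas[OF rword_reduced])

lemma Hmult_one_right [simp]: "a \<in> Hcarrier r \<Longrightarrow> Hmult r a (bas id) = a"
  using H_expand[of a] by (simp add: Hmult_eq Hleft_one)

text \<open>Both sides commute with right generators in c (\<open>Hmult_Rgen\<close>), because left
  multiplications are made of left generators; so the case c = 1 decides.\<close>

lemma Hmult_assoc:
  assumes a: "a \<in> Hcarrier r" and b: "b \<in> Hcarrier r" and c: "c \<in> Hcarrier r"
  shows "Hmult r (Hmult r a b) c = Hmult r a (Hmult r b c)"
  using c by (induction rule: H_induct) (use a b in \<open>simp_all add: Hmult_lin Hmult_Rgen\<close>)

lemma Hmult_one_left [simp]: "a \<in> Hcarrier r \<Longrightarrow> Hmult r (bas id) a = a"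
  by (induction rule: H_induct) (simp_all add: Hmult_lin Hmult_Rgen)

lemma Rgen_Hmult: "a \<in> Hcarrier r \<Longrightarrow> Suc j < r \<Longrightarrow> Rgen j a = Hmult r a (bas (sgen j))"
  using Hmult_Rgen[of "bas id" j a] by (simp add: gen_bas_id)

lemma Hgen_Hmult:
  assumes "a \<in> Hcarrier r" and j: "Suc j < r" shows "Hgen r j a = Hmult r (bas (sgen j)) a"
  using assms(1) by (induction rule: H_induct) (use j in \<open>simp_all add: Hmult_lin Hmult_Rgen
      Hgen_lin Hgen_Rgen gen_bas_id\<close>)

lemma bas_fold: "w \<in> perms r \<Longrightarrow> bas w = fold Rgen (rword r w) (bas id)"
  using fold_Rgen_bas[OF rword_reduced] by metis

lemma Hmult_bas_fold: "w \<in> perms r \<Longrightarrow> a \<in> Hcarrier r \<Longrightarrow> Hmult r a (bas w) = fold Rgen (rword r w) a"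
proof -
  assume w: "w \<in> perms r" and a: "a \<in> Hcarrier r"
  have "Hmult r a (fold Rgen js b) = fold Rgen js (Hmult r a b)" if "\<forall>j\<in>set js. Suc j < r" "b \<in>
      Hcarrier r" for js b
    using that by (induction js arbitrary: b) (auto simp: Hmult_Rgen pointwise)
  then show ?thesis using w a rword_gen[OF w] bas_fold[OF w] by simp
qed

lemma Hmult_bas_sgen:
  assumes "w \<in> perms r" "Suc j < r"
  shows "Hmult r (bas w) (bas (sgen j)) = bas (w \<circ> sgen j) + (if w (Suc j) < w j then scl vdiff (bas
      w) else 0)"
  using assms by (simp add: Rgen_Hmult[symmetric] Rgen_bas)

lemma Hmult_sgen_bas:
  assumes "w \<in> perms r" "Suc j < r"
  shows "Hmult r (bas (sgen j)) (bas w) = bas (sgen j \<circ> w) + (if inv w (Suc j) < inv w j then scl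
      vdiff (bas w) else 0)"
  using assms by (simp add: Hgen_Hmult[symmetric] Hgen_bas)

end

section \<open>The anti-involution and the symmetrizing trace\<close>

definition hstar :: "nat \<Rightarrow> hecke \<Rightarrow> hecke" where
  "hstar r h = (\<lambda>u. if u \<in> perms r then h (inv u) else 0)"

text \<open>Also the coefficient of \<open>id\<close> in the product of a with
  \<open>hstar r b\<close> (\<open>trace_mult\<close>): a standard scalar product and a trace form
  at once.\<close>

definition hform :: "nat \<Rightarrow> hecke \<Rightarrow> hecke \<Rightarrow> K" where
  "hform r a b = (\<Sum>w\<in>perms r. a w * b w)"

context fixes r :: nat begin

lemma Hc_star [simp]: "hstar r h \<in> Hcarrier r"
  by (auto simp: hstar_def Hcarrier_def)

lemma star_star [simp]: "h \<in> Hcarrier r \<Longrightarrow> hstar r (hstar r h) = h"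
  by (rule Hc_eqI[of _ r]) (auto simp: hstar_def Hcarrier_def)

lemma star_lin: "hstar r (a + b) = hstar r a + hstar r b" "hstar r (scl c a) = scl c (hstar r a)"
    "hstar r 0 = 0"
  by (auto simp: pointwise scl_apply fun_eq_iff hstar_def)

lemma star_bas: "w \<in> perms r \<Longrightarrow> hstar r (bas w) = bas (inv w)"
  by (rule Hc_eqI[of _ r]) (auto simp: hstar_def bas_def Hcarrier_def)

lemma star_one [simp]: "hstar r (bas id) = bas id"
  by (metis star_bas perms_id inv_id)

lemma star_Rgen:
  assumes j: "Suc j < r" and h: "h \<in> Hcarrier r" shows "hstar r (Rgen j h) = Hgen r j (hstar r h)"
proof (rule Hc_eqI)
  fix u assume u: "u \<in> perms r"
  have "inv (sgen j \<circ> u) = inv u \<circ> sgen j" using perms_inv_comp[OF perms_sgen[OF j] u] by simp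
  then show "hstar r (Rgen j h) u = Hgen r j (hstar r h) u"
    using u j Hgen_apply[OF u j, of "hstar r h"] by (simp add: hstar_def Rgen_def)
qed (use assms in auto)

lemma star_Hmult:
  assumes a: "a \<in> Hcarrier r" and b: "b \<in> Hcarrier r"
  shows "hstar r (Hmult r a b) = Hmult r (hstar r b) (hstar r a)"
  using b
proof (induction rule: H_induct)
  case (gen j b)
  then show ?case using a by (simp add: Hmult_Rgen star_Rgen Hgen_Hmult Hmult_assoc)
qed (use a in \<open>simp_all add: Hmult_lin star_lin\<close>)

lemma hform_lin: "hform r (a + b) c = hform r a c + hform r b c" "hform r (scl d a) c = d * hform r a c"
  "hform r c (a + b) = hform r c a + hform r c b" "hform r c (scl d a) = d * hform r c a"
  by (simp_all add: hform_def algebra_simps sum.distrib sum_distrib_left pointwise scl_apply)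

lemma hform_sum: "hform r (\<Sum>i\<in>A. f i) a = (\<Sum>i\<in>A. hform r (f i) a)" "hform r a (\<Sum>i\<in>A. f i) = (\<Sum>i\<in>A.
    hform r a (f i))"
  by (induction A rule: infinite_finite_induct) (simp_all add: hform_lin hform_def[of r 0]
      hform_def[of r _ 0] pointwise)

lemma hform_commute: "hform r a b = hform r b a"
  by (simp add: hform_def mult.commute)

lemma hform_pos: "h \<in> Hcarrier r \<Longrightarrow> h \<noteq> 0 \<Longrightarrow> hform r h h > 0"
proof -
  assume h: "h \<in> Hcarrier r" "h \<noteq> 0"
  then obtain w where w: "w \<in> perms r" "h w \<noteq> 0" using HcD[OF h(1)] by (fastforce simp: fun_eq_iff
      zero_fun_apply)
  have "0 < h w * h w" using w by (auto simp: zero_less_mult_iff linorder_neq_iff)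
  then show ?thesis unfolding hform_def using w by (intro sum_pos2[of _ w]) auto
qed

text \<open>In the basis \<open>bas w\<close> the matrix of \<open>Rgen j\<close> is symmetric: it
  swaps w and w s_j and has the diagonal entry v - 1/v at descents.\<close>

lemma hform_Rgen: "Suc j < r \<Longrightarrow> hform r (Rgen j a) b = hform r a (Rgen j b)"
proof -
  assume j: "Suc j < r"
  have "(\<Sum>w\<in>perms r. a (w \<circ> sgen j) * b w) = (\<Sum>w\<in>perms r. a w * b (w \<circ> sgen j))"
    using sum_perms_right[OF j, of "\<lambda>w. a w * b (w \<circ> sgen j)"] by simp
  then show ?thesis
    by (simp add: hform_def Rgen_def algebra_simps sum.distrib)
       (intro sum.cong refl, simp)
qed

lemma hform_mult:
  assumes a: "a \<in> Hcarrier r" and c: "c \<in> Hcarrier r" and h: "h \<in> Hcarrier r"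
  shows "hform r (Hmult r a h) c = hform r a (Hmult r c (hstar r h))"
  using h c
proof (induction arbitrary: c rule: H_induct)
  case (gen j h)
  have "hform r (Hmult r a (Rgen j h)) c = hform r (Hmult r a h) (Rgen j c)"
    using gen by (simp add: Hmult_Rgen hform_Rgen)
  also have "\<dots> = hform r a (Hmult r (Rgen j c) (hstar r h))" using gen by simp
  also have "Hmult r (Rgen j c) (hstar r h) = Hmult r c (Hmult r (bas (sgen j)) (hstar r h))"
    using gen by (simp add: Rgen_Hmult Hmult_assoc)
  also have "\<dots> = Hmult r c (hstar r (Rgen j h))" using gen by (simp add: star_Rgen Hgen_Hmult)
  finally show ?case .
qed (use a in \<open>simp_all add: Hmult_lin star_lin hform_lin\<close>)

lemma hform_trace: "a \<in> Hcarrier r \<Longrightarrow> hform r a (bas id) = a id"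
  by (simp add: hform_def bas_def if_distrib cong: if_cong)

lemma hform_star: "hform r (hstar r a) (hstar r b) = hform r a b"
  using sum_perms_inv[of "\<lambda>w. a w * b w" r] by (simp add: hform_def hstar_def)

lemma trace_mult:
  assumes a: "a \<in> Hcarrier r" and b: "b \<in> Hcarrier r"
  shows "Hmult r a b id = hform r a (hstar r b)"
  using hform_mult[OF a _ b, of "bas id"] hform_trace[of "Hmult r a b"] a b by simp

text \<open>With tau the coefficient at \<open>id\<close>, tau(a b) is the form of a and
  \<open>hstar r b\<close>, and the form is symmetric and invariant under
  \<open>hstar\<close>.\<close>

lemma trace_commute:
  assumes a: "a \<in> Hcarrier r" and b: "b \<in> Hcarrier r"
  shows "Hmult r a b id = Hmult r b a id"
  using assms hform_star[of "hstar r b" a] by (simp add: trace_mult hform_commute)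

text \<open>The step behind all averaging over the T_w: a generator acting on one slot may be moved
  to the other. It serves both \<open>casimir\<close> and \<open>dyad\<close>, where the terms at
  descents already agree.\<close>

lemma casimir_right:
  fixes G :: "perm \<Rightarrow> perm \<Rightarrow> 'b::ab_group_add"
  assumes j: "Suc j < r"
  shows "(\<Sum>w\<in>perms r. G (w \<circ> sgen j) w) = (\<Sum>w\<in>perms r. G w (w \<circ> sgen j))"
  using sum_perms_right[OF j, of "\<lambda>w. G w (w \<circ> sgen j)"] by simp

end

section \<open>The tensor space\<close>

lemma vec_ops: "vzero = 0" "vadd x y = x + y" "vsmul c x = scl c x"
  by (auto simp: vzero_def vadd_def vsmul_def scl_def pointwise)

lemma swapl_nth: "Suc j < length l \<Longrightarrow> i < length l \<Longrightarrow> swapl j l ! i = l ! sgen j i"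
  by (auto simp: swapl_def nth_list_update sgen_apply)

lemma length_swapl [simp]: "length (swapl j l) = length l" by (simp add: swapl_def)

lemma swapl_swapl [simp]: "Suc j < length l \<Longrightarrow> swapl j (swapl j l) = l"
  by (rule nth_equalityI) (auto simp: swapl_nth sgen_apply split: if_splits)

lemma Vgen_lin: "Vgen j (x + y) = Vgen j x + Vgen j y" "Vgen j (scl c x) = scl c (Vgen j x)" "Vgen j 0 = 0"
  by (auto simp: fun_eq_iff Vgen_def pointwise scl_apply algebra_simps)

context fixes r :: nat begin

lemma Vc_length: "x \<in> Vcarrier r \<Longrightarrow> length l \<noteq> r \<Longrightarrow> x l = 0"
  by (auto simp: Vcarrier_def)

lemma Vc_finite: "x \<in> Vcarrier r \<Longrightarrow> finite {l. x l \<noteq> 0}"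
  by (auto simp: Vcarrier_def)

lemma Vc_I: "finite S \<Longrightarrow> (\<And>l. x l \<noteq> 0 \<Longrightarrow> l \<in> S \<and> length l = r) \<Longrightarrow> x \<in> Vcarrier r"
  unfolding Vcarrier_def using finite_subset[of "{l. x l \<noteq> 0}" S] by blast

lemma Vc_basic [simp]: "0 \<in> Vcarrier r"
  "x \<in> Vcarrier r \<Longrightarrow> y \<in> Vcarrier r \<Longrightarrow> x + y \<in> Vcarrier r"
  "x \<in> Vcarrier r \<Longrightarrow> scl c x \<in> Vcarrier r"
  "length l = r \<Longrightarrow> bvec l \<in> Vcarrier r"
proof -
  show "0 \<in> Vcarrier r" by (rule Vc_I[of "{}"]) (auto simp: pointwise)
  show "x + y \<in> Vcarrier r" if x: "x \<in> Vcarrier r" and y: "y \<in> Vcarrier r"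
  proof (rule Vc_I[of "{l. x l \<noteq> 0} \<union> {l. y l \<noteq> 0}"])
    fix l assume "(x + y) l \<noteq> 0"
    then have "x l \<noteq> 0 \<or> y l \<noteq> 0" by (auto simp: pointwise)
    then show "l \<in> {l. x l \<noteq> 0} \<union> {l. y l \<noteq> 0} \<and> length l = r"
      using Vc_length[OF x, of l] Vc_length[OF y, of l] by auto
  qed (use x y Vc_finite in auto)
  show "scl c x \<in> Vcarrier r" if x: "x \<in> Vcarrier r"
    by (rule Vc_I[OF Vc_finite[OF x]]) (use Vc_length[OF x] in \<open>auto simp: scl_apply\<close>)
  show "bvec l \<in> Vcarrier r" if "length l = r"
    by (rule Vc_I[of "{l}"]) (use that in \<open>auto simp: bvec_def split: if_splits\<close>)
qed

lemma Vc_sum [simp]: "(\<And>i. i \<in> A \<Longrightarrow> f i \<in> Vcarrier r) \<Longrightarrow> (\<Sum>i\<in>A. f i) \<in> Vcarrier r"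
  by (induction A rule: infinite_finite_induct) auto

lemma Vc_Vgen [simp]:
  assumes j: "Suc j < r" and x: "x \<in> Vcarrier r" shows "Vgen j x \<in> Vcarrier r"
proof (rule Vc_I[of "{l. x l \<noteq> 0} \<union> swapl j ` {l. x l \<noteq> 0}"])
  fix l assume l: "Vgen j x l \<noteq> 0"
  show "l \<in> {l. x l \<noteq> 0} \<union> swapl j ` {l. x l \<noteq> 0} \<and> length l = r"
  proof (cases "x l \<noteq> 0")
    case True
    then show ?thesis using Vc_length[OF x] by auto
  next
    case False
    then have s: "Suc j < length l" "x (swapl j l) \<noteq> 0" using l by (auto simp: Vgen_def split: if_splits)
    then show ?thesis using Vc_length[OF x, of "swapl j l"]
      by (auto intro!: image_eqI[of l "swapl j" "swapl j l"])
  qed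
qed (use Vc_finite[OF x] in auto)

lemma Vc_fold [simp]: "\<forall>j\<in>set js. Suc j < r \<Longrightarrow> x \<in> Vcarrier r \<Longrightarrow> fold Vgen js x \<in> Vcarrier r"
  by (induction js arbitrary: x) (auto simp: pointwise)

lemma Vc_VT [simp]: "w \<in> perms r \<Longrightarrow> x \<in> Vcarrier r \<Longrightarrow> VT r w x \<in> Vcarrier r"
  unfolding VT_def by (rule Vc_fold) (auto simp: rword_gen)

lemma Vact_eq: "Vact r x h = (\<Sum>w\<in>perms r. scl (h w) (VT r w x))"
  by (auto simp: fun_eq_iff Vact_def sum_fun_apply scl_apply)

lemma Vc_Vact [simp]: "x \<in> Vcarrier r \<Longrightarrow> Vact r x h \<in> Vcarrier r"
  unfolding Vact_eq by simp

end

text \<open>For a sorted word \<open>f\<close> the words with the same content form a copy of \<open>x\<^sub>f H\<close>; this is the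
  coefficientwise form of \<open>\<omega>\<^sub>f h \<mapsto> x\<^sub>f h\<close>.\<close>

definition wembed :: "nat \<Rightarrow> int list \<Rightarrow> vec \<Rightarrow> hecke" where
  "wembed r f x = (\<lambda>w. if w \<in> perms r
     then vv ^ slen r w * inverse vv ^ invs r (\<lambda>p. f ! w p) * x (permute_list w f) else 0)"

text \<open>Words are orthonormal. Summing over the support of x keeps the sum finite although there
  are infinitely many words; for vectors in \<open>Vcarrier r\<close> the roles of x and y can be
  exchanged.\<close>

definition vform :: "vec \<Rightarrow> vec \<Rightarrow> K" where
  "vform x y = (\<Sum>l | x l \<noteq> 0. x l * y l)"

context fixes r :: nat begin

lemma wembed_lin: "wembed r f (x + y) = wembed r f x + wembed r f y" "wembed r f (scl c x) = scl c
    (wembed r f x)" "wembed r f 0 = 0"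
  by (auto simp: fun_eq_iff wembed_def pointwise scl_apply algebra_simps)

lemma wembed_sum: "wembed r f (\<Sum>i\<in>A. x i) = (\<Sum>i\<in>A. wembed r f (x i))"
  by (induction A rule: infinite_finite_induct) (auto simp: wembed_lin)

lemma Hc_wembed [simp]: "wembed r f x \<in> Hcarrier r"
  by (auto simp: wembed_def Hcarrier_def)

lemma permute_list_swapl:
  assumes "Suc j < length f" "w \<in> perms (length f)"
  shows "permute_list (w \<circ> sgen j) f = swapl j (permute_list w f)"
  using assms by (intro nth_equalityI)
    (auto simp: swapl_nth permute_list_def o_apply sgen_apply)

text \<open>Write w = a d with a in the Young subgroup of f and d shortest in its coset:
  \<open>slen r w\<close> minus the inversions of the word f o w is the length of a, the exponent of
  v in x_f. If the letters at j and j+1 agree, w s_j stays in the coset and this exponent changes by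
  one; otherwise sortedness of f makes w j and w (j+1) compare like the letters.\<close>

lemma wembed_Vgen:
  assumes f: "length f = r" "sorted f" and j: "Suc j < r"
  shows "wembed r f (Vgen j x) = Rgen j (wembed r f x)"
proof (rule Hc_eqI[of _ r])
  fix w assume w: "w \<in> perms r"
  define l where "l = permute_list w f"
  define F where "F = (\<lambda>p. f ! w p)"
  have len: "length l = r" using f by (simp add: l_def)
  have nth: "l ! i = F i" if "i < r" for i using that f by (simp add: l_def F_def permute_list_def)
  have sw: "permute_list (w \<circ> sgen j) f = swapl j l"
    using permute_list_swapl[of j f w] f j w by (simp add: l_def)
  have E: "wembed r f y w = vv ^ slen r w * inverse vv ^ invs r F * y l" for y
    using w by (simp add: wembed_def F_def l_def)
  have Fs: "(\<lambda>p. f ! (w \<circ> sgen j) p) = F \<circ> sgen j" by (auto simp: F_def o_apply)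
  have R: "Rgen j (wembed r f x) w = vv ^ slen r (w \<circ> sgen j) * inverse vv ^ invs r (F \<circ> sgen j) * x
      (swapl j l)
     + (if w (Suc j) < w j then vdiff * (vv ^ slen r w * inverse vv ^ invs r F * x l) else 0)"
    using w j unfolding Rgen_def E Fs[symmetric] by (simp add: wembed_def sw)
  have ne: "w j \<noteq> w (Suc j)" using perms_eq_iff[OF w, of j "Suc j"] by simp
  have mono: "F a \<le> F b" if "w a \<le> w b" "b < r" for a b
    using that f perms_lt[OF w] by (auto simp: F_def intro: sorted_nth_mono)
  consider "F j = F (Suc j)" | "F j < F (Suc j)" | "F j > F (Suc j)" by linarith
  then show "wembed r f (Vgen j x) w = Rgen j (wembed r f x) w"
  proof cases
    case 1
    have "F \<circ> sgen j = F" using 1 by (auto simp: fun_eq_iff o_apply sgen_apply)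
    moreover have "swapl j l = l"
      using 1 len j nth by (intro nth_equalityI) (auto simp: swapl_nth sgen_apply)
    moreover have "Vgen j x l = vv * x l" using 1 j nth[of j] nth[of "Suc j"] len by (simp add: Vgen_def)
    ultimately show ?thesis using slen_asc[OF j, of w] slen_desc[OF j, of w] ne
      unfolding E R by (auto simp: neq_iff field_simps)
  next
    case 2
    have asc: "w j < w (Suc j)" using mono[of "Suc j" j] 2 j by (meson Suc_lessD leD leI)
    have "Vgen j x l = x (swapl j l)" using 2 j nth[of j] nth[of "Suc j"] len by (simp add: Vgen_def)
    then show ?thesis using slen_asc[OF j asc] invs_swap[of j r F] 2 j asc
      unfolding E R by (simp add: field_simps)
  next
    case 3
    have desc: "w (Suc j) < w j" using mono[of j "Suc j"] 3 j by (meson leD leI)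
    have V: "Vgen j x l = vdiff * x l + x (swapl j l)"
      using 3 j nth[of j] nth[of "Suc j"] len by (simp add: Vgen_def)
    have i: "invs r F = Suc (invs r (F \<circ> sgen j))"
      using invs_swap[of j r "F \<circ> sgen j"] 3 j by (simp add: o_apply comp_assoc)
    show ?thesis using desc unfolding E R V slen_desc[OF j desc] i by (simp add: field_simps)
  qed
qed (use j in auto)

lemma wembed_VT:
  assumes f: "length f = r" "sorted f" and w: "w \<in> perms r"
  shows "wembed r f (VT r w x) = Hmult r (wembed r f x) (bas w)"
proof -
  have "wembed r f (fold Vgen js x) = fold Rgen js (wembed r f x)" if "\<forall>j\<in>set js. Suc j < r" for js
    using that by (induction js arbitrary: x) (auto simp: wembed_Vgen[OF f] pointwise)
  then show ?thesis using rword_gen[OF w] by (simp add: VT_def Hmult_bas_fold w)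
qed

lemma wembed_Vact:
  assumes f: "length f = r" "sorted f" and h: "h \<in> Hcarrier r"
  shows "wembed r f (Vact r x h) = Hmult r (wembed r f x) h"
proof -
  have "wembed r f (Vact r x h) = (\<Sum>w\<in>perms r. Hmult r (wembed r f x) (scl (h w) (bas w)))"
    unfolding Vact_eq by (simp add: wembed_sum wembed_lin wembed_VT f Hmult_lin)
  then show ?thesis using H_expand[OF h] by (simp add: Hmult_sum[symmetric])
qed

lemma perms_lessThan: "perms r = {w. w permutes {..<r}}"
  by (simp add: perms_def lessThan_atLeast0)

text \<open>A word l is a rearrangement of \<open>sort l\<close>, and its coefficient occurs in the
  image for f = \<open>sort l\<close> with an invertible factor. Identities in the tensor space can
  thereby be checked in H.\<close>

lemma wembed_inj:
  assumes x: "x \<in> Vcarrier r" and y: "y \<in> Vcarrier r"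
    and eq: "\<And>f. length f = r \<Longrightarrow> sorted f \<Longrightarrow> wembed r f x = wembed r f y"
  shows "x = y"
proof
  fix l
  show "x l = y l"
  proof (cases "length l = r")
    case True
    have "mset l = mset (sort l)" by simp
    then obtain w where w: "w permutes {..<length (sort l)}" "permute_list w (sort l) = l"
      by (rule mset_eq_permutation)
    then have "w \<in> perms r" using True by (simp add: perms_lessThan)
    then show ?thesis using fun_cong[OF eq[of "sort l"], of w] True w by (simp add: wembed_def)
  qed (use Vc_length x y in metis)
qed

lemma VT_eq: "w \<in> perms r \<Longrightarrow> VT r w x = Vact r x (bas w)"
  unfolding Vact_eq by (simp add: bas_apply if_distrib[where f = "\<lambda>c. scl c _"] cong: if_cong)

lemma Vact_lin_right: "Vact r x (a + b) = Vact r x a + Vact r x b" "Vact r x (scl c a) = scl c (Vact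
    r x a)" "Vact r x 0 = 0"
  by (simp_all add: Vact_eq pointwise scl_apply scl_add sum.distrib scl_sum)

lemma Vact_sum_right: "Vact r x (\<Sum>i\<in>A. h i) = (\<Sum>i\<in>A. Vact r x (h i))"
  by (induction A rule: infinite_finite_induct) (auto simp: Vact_lin_right)

lemma Vact_lin:
  assumes "x \<in> Vcarrier r" "y \<in> Vcarrier r" "h \<in> Hcarrier r"
  shows "Vact r (x + y) h = Vact r x h + Vact r y h" "Vact r (scl c x) h = scl c (Vact r x h)"
  by (rule wembed_inj; simp add: assms wembed_Vact wembed_lin Hmult_lin)+

lemma Vact_0 [simp]: "h \<in> Hcarrier r \<Longrightarrow> Vact r 0 h = 0"
  using Vact_lin(2)[of 0 0 h 0] by simp

lemma Vact_sum: "(\<And>i. i \<in> A \<Longrightarrow> x i \<in> Vcarrier r) \<Longrightarrow> h \<in> Hcarrier r \<Longrightarrow>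
    Vact r (\<Sum>i\<in>A. x i) h = (\<Sum>i\<in>A. Vact r (x i) h)"
  by (induction A rule: infinite_finite_induct) (auto simp: Vact_lin)

lemma Vact_one [simp]: "x \<in> Vcarrier r \<Longrightarrow> Vact r x (bas id) = x"
  by (rule wembed_inj) (simp_all add: wembed_Vact)

lemma Vact_Vact:
  "x \<in> Vcarrier r \<Longrightarrow> a \<in> Hcarrier r \<Longrightarrow> b \<in> Hcarrier r \<Longrightarrow> Vact r (Vact r x a) b = Vact r x (Hmult r a b)"
  by (rule wembed_inj) (simp_all add: wembed_Vact Hmult_assoc)

lemma Vact_Rgen:
  "x \<in> Vcarrier r \<Longrightarrow> h \<in> Hcarrier r \<Longrightarrow> Suc j < r \<Longrightarrow> Vact r x (Rgen j h) = Vgen j (Vact r x h)"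
  by (rule wembed_inj) (simp_all add: wembed_Vact wembed_Vgen Hmult_Rgen)

lemma Vgen_VT:
  assumes "x \<in> Vcarrier r" "w \<in> perms r" "Suc j < r"
  shows "Vgen j (VT r w x) = VT r (w \<circ> sgen j) x + (if w (Suc j) < w j then scl vdiff (VT r w x) else 0)"
  using assms Vact_Rgen[of x "bas w" j] by (auto simp: VT_eq Rgen_bas Vact_lin_right split: if_splits)

section \<open>The bilinear form on the tensor space\<close>

lemma vform_superset: "finite S \<Longrightarrow> {l. x l \<noteq> 0} \<subseteq> S \<Longrightarrow> vform x y = (\<Sum>l\<in>S. x l * y l)"
  unfolding vform_def by (intro sum.mono_neutral_left) auto

lemma vform_right: "vform x (y + z) = vform x y + vform x z" "vform x (scl c y) = c * vform x y"
    "vform x 0 = 0" "vform 0 x = 0"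
  by (simp_all add: vform_def pointwise scl_apply algebra_simps sum.distrib sum_distrib_left)

lemma vform_commute:
  assumes "x \<in> Vcarrier r" "y \<in> Vcarrier r" shows "vform x y = vform y x"
proof -
  let ?S = "{l. x l \<noteq> 0} \<union> {l. y l \<noteq> 0}"
  have S: "finite ?S" using assms Vc_finite by auto
  show ?thesis using vform_superset[OF S, of x y] vform_superset[OF S, of y x] by (simp add: mult.commute)
qed

lemma vform_left:
  assumes "x \<in> Vcarrier r" "y \<in> Vcarrier r" "z \<in> Vcarrier r"
  shows "vform (x + y) z = vform x z + vform y z" "vform (scl c x) z = c * vform x z"
  using assms by (simp_all add: vform_commute[of _ z] vform_right)

lemma vform_pos: "x \<in> Vcarrier r \<Longrightarrow> x \<noteq> 0 \<Longrightarrow> vform x x > 0"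
proof -
  assume x: "x \<in> Vcarrier r" "x \<noteq> 0"
  then obtain l where l: "x l \<noteq> 0" by (fastforce simp: fun_eq_iff zero_fun_apply)
  then have "0 < x l * x l" by (auto simp: zero_less_mult_iff linorder_neq_iff)
  then show ?thesis unfolding vform_def using l Vc_finite[OF x(1)] by (intro sum_pos2[of _ l]) auto
qed

text \<open>On words \<open>Vgen j\<close> is a symmetric matrix: apart from the diagonal it has
  only the entries 1 between l and \<open>swapl j l\<close>.\<close>

lemma vform_Vgen:
  assumes x: "x \<in> Vcarrier r" and y: "y \<in> Vcarrier r" and j: "Suc j < r"
  shows "vform (Vgen j x) y = vform x (Vgen j y)"
proof -
  define T where "T = {l. x l \<noteq> 0} \<union> {l. y l \<noteq> 0} \<union> {l. Vgen j x l \<noteq> 0}"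
  \<comment> \<open>The supports are closed up under \<open>swapl j\<close>, so that the
    off-diagonal terms can be reindexed by the swap.\<close>
  define S where "S = T \<union> swapl j ` T"
  have T: "finite T" "\<And>l. l \<in> T \<Longrightarrow> length l = r"
    using Vc_finite[OF x] Vc_finite[OF y] Vc_finite[OF Vc_Vgen[OF j x]]
      Vc_length[OF x] Vc_length[OF y] Vc_length[OF Vc_Vgen[OF j x]] by (auto simp: T_def)
  have S: "finite S" "\<And>l. l \<in> S \<Longrightarrow> length l = r" "\<And>l. l \<in> S \<Longrightarrow> swapl j l \<in> S"
    using T j by (auto simp: S_def)
  let ?g = "\<lambda>l. if l ! j = l ! Suc j then 0 else x (swapl j l) * y l"
  let ?g' = "\<lambda>l. if l ! j = l ! Suc j then 0 else x l * y (swapl j l)"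
  have gg: "(\<Sum>l\<in>S. ?g l) = (\<Sum>l\<in>S. ?g' l)"
    by (rule sum.reindex_bij_witness[of _ "swapl j" "swapl j"]) (use S j in \<open>auto simp: swapl_nth\<close>)
  have pt: "Vgen j x l * y l = x l * Vgen j y l + (?g l - ?g' l)" if "l \<in> S" for l
    using S(2)[OF that] j by (auto simp: Vgen_def algebra_simps)
  have "vform (Vgen j x) y = (\<Sum>l\<in>S. Vgen j x l * y l)"
    by (rule vform_superset[OF S(1)]) (auto simp: S_def T_def)
  also have "\<dots> = (\<Sum>l\<in>S. x l * Vgen j y l) + ((\<Sum>l\<in>S. ?g l) - (\<Sum>l\<in>S. ?g' l))"
    unfolding sum_subtractf[symmetric] sum.distrib[symmetric] by (rule sum.cong) (simp_all only: pt)
  also have "\<dots> = (\<Sum>l\<in>S. x l * Vgen j y l)" unfolding gg by simp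
  also have "\<dots> = vform x (Vgen j y)"
    by (rule vform_superset[OF S(1), symmetric]) (auto simp: S_def T_def)
  finally show ?thesis .
qed

lemma vform_Vact:
  assumes x: "x \<in> Vcarrier r" and y: "y \<in> Vcarrier r" and h: "h \<in> Hcarrier r"
  shows "vform (Vact r x h) y = vform x (Vact r y (hstar r h))"
  using h y
proof (induction arbitrary: y rule: H_induct)
  case (gen j h)
  have "vform (Vact r x (Rgen j h)) y = vform (Vact r x h) (Vgen j y)"
    using gen x by (simp add: Vact_Rgen vform_Vgen)
  also have "\<dots> = vform x (Vact r (Vgen j y) (hstar r h))" using gen by simp
  also have "Vgen j y = Vact r y (bas (sgen j))"
    using Vact_Rgen[of y "bas id" j] gen by (simp add: gen_bas_id[of j r])
  also have "Vact r \<dots> (hstar r h) = Vact r y (hstar r (Rgen j h))"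
    using gen by (simp add: Vact_Vact star_Rgen Hgen_Hmult)
  finally show ?case .
qed (use x in \<open>simp_all add: Vact_lin_right star_lin vform_left vform_right\<close>)

section \<open>Endomorphisms of the tensor space\<close>

lemma Salg_iff: "s \<in> Salg r \<longleftrightarrow> (\<forall>x. x \<notin> Vcarrier r \<longrightarrow> s x = 0) \<and> (\<forall>x\<in>Vcarrier r. s x \<in> Vcarrier r) \<and>
   (\<forall>x\<in>Vcarrier r. \<forall>y\<in>Vcarrier r. s (x + y) = s x + s y) \<and> (\<forall>c. \<forall>x\<in>Vcarrier r. s (scl c x) = scl c (s x)) \<and>
   (\<forall>x\<in>Vcarrier r. \<forall>h\<in>Hcarrier r. s (Vact r x h) = Vact r (s x) h)"
  by (simp add: Salg_def vec_ops)

lemma SalgD: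
  assumes "s \<in> Salg r"
  shows "x \<notin> Vcarrier r \<Longrightarrow> s x = 0" "x \<in> Vcarrier r \<Longrightarrow> s x \<in> Vcarrier r"
    "x \<in> Vcarrier r \<Longrightarrow> y \<in> Vcarrier r \<Longrightarrow> s (x + y) = s x + s y"
    "x \<in> Vcarrier r \<Longrightarrow> s (scl c x) = scl c (s x)"
    "x \<in> Vcarrier r \<Longrightarrow> h \<in> Hcarrier r \<Longrightarrow> s (Vact r x h) = Vact r (s x) h"
    "s 0 = 0"
proof -
  show "s 0 = 0" using assms Vc_basic(1)[of r] scl_simps(2)[of "0 :: vec"] scl_simps(2)[of "s 0"]
      unfolding Salg_iff by metis
qed (use assms in \<open>auto simp: Salg_iff\<close>)

lemma Salg_sum:
  "s \<in> Salg r \<Longrightarrow> (\<And>i. i \<in> A \<Longrightarrow> x i \<in> Vcarrier r) \<Longrightarrow> s (\<Sum>i\<in>A. x i) = (\<Sum>i\<in>A. s (x i))"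
  by (induction A rule: infinite_finite_induct) (auto simp: SalgD)

text \<open>The rank-one map x \<mapsto> <a, x> q averaged over the dual bases T_w and
  \<open>hstar\<close> of T_w, with one of the two moved across the form. The value outside
  \<open>Vcarrier r\<close> is the one that \<open>Salg\<close> prescribes.\<close>

definition dyad :: "vec \<Rightarrow> vec \<Rightarrow> vec \<Rightarrow> vec" where
  "dyad a q x = (if x \<in> Vcarrier r then \<Sum>w\<in>perms r. scl (vform (VT r w a) x) (VT r w q) else 0)"

text \<open>Self-adjointness carries the generator from x to a, and \<open>casimir_right\<close>
  carries it on to q.\<close>

lemma dyad_Vgen:
  assumes a: "a \<in> Vcarrier r" and q: "q \<in> Vcarrier r" and x: "x \<in> Vcarrier r" and j: "Suc j < r"
  shows "dyad a q (Vgen j x) = Vgen j (dyad a q x)"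
proof -
  have Vsum: "Vgen j (\<Sum>i\<in>A. f i) = (\<Sum>i\<in>A. Vgen j (f i))" for f :: "perm \<Rightarrow> vec" and A
    by (induction A rule: infinite_finite_induct) (auto simp: Vgen_lin)
  let ?D = "\<lambda>w. if w (Suc j) < w j then scl (vdiff * vform (VT r w a) x) (VT r w q) else 0"
  have "dyad a q (Vgen j x) = (\<Sum>w\<in>perms r. scl (vform (Vgen j (VT r w a)) x) (VT r w q))"
    using x j a by (auto simp: dyad_def vform_Vgen)
  also have "\<dots> = (\<Sum>w\<in>perms r. scl (vform (VT r (w \<circ> sgen j) a) x) (VT r w q) + ?D w)"
    using a x j by (intro sum.cong refl) (simp add: Vgen_VT vform_left vform_right scl_add)
  also have "\<dots> = (\<Sum>w\<in>perms r. scl (vform (VT r w a) x) (VT r (w \<circ> sgen j) q) + ?D w)"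
    unfolding sum.distrib casimir_right[OF j, of "\<lambda>u w. scl (vform (VT r u a) x) (VT r w q)"] ..
  also have "\<dots> = (\<Sum>w\<in>perms r. Vgen j (scl (vform (VT r w a) x) (VT r w q)))"
    using q j by (intro sum.cong refl) (simp add: Vgen_lin Vgen_VT scl_add mult.commute)
  also have "\<dots> = Vgen j (dyad a q x)" using x by (simp add: dyad_def Vsum)
  finally show ?thesis .
qed

lemma dyad_lin:
  assumes "x \<in> Vcarrier r" "y \<in> Vcarrier r"
  shows "dyad a q (x + y) = dyad a q x + dyad a q y" "dyad a q (scl c x) = scl c (dyad a q x)"
  using assms by (simp_all add: dyad_def vform_right scl_add sum.distrib scl_sum)

lemma dyad_Vc [simp]: "q \<in> Vcarrier r \<Longrightarrow> dyad a q x \<in> Vcarrier r"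
  by (simp add: dyad_def)

lemma dyad_Salg:
  assumes a: "a \<in> Vcarrier r" and q: "q \<in> Vcarrier r" shows "dyad a q \<in> Salg r"
proof -
  have "dyad a q (Vact r x h) = Vact r (dyad a q x) h" if x: "x \<in> Vcarrier r" and h: "h \<in> Hcarrier r" for x h
    using h by (induction rule: H_induct)
      (use a q x in \<open>simp_all add: Vact_lin_right dyad_lin Vact_Rgen dyad_Vgen\<close>)
  then show ?thesis using q unfolding Salg_iff by (auto simp: dyad_lin) (simp add: dyad_def)
qed

end

section \<open>Sorted words and the regular summand\<close>

lemma count_list_blocks:
  "distinct ks \<Longrightarrow> count_list (concat (map (\<lambda>k. replicate (la k) k) ks)) i = (if i \<in> set ks then la i else 0)"
proof (induction ks)
  case (Cons k ks)
  have "count_list (replicate n k) i = (if i = k then n else 0)" for n by (induction n) auto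
  then show ?case using Cons by auto
qed simp

lemma sorted_blocks: "sorted ks \<Longrightarrow> sorted (concat (map (\<lambda>k. replicate (la k) k) ks))"
  for ks :: "'a::linorder list"
  by (induction ks) (auto simp: sorted_append)

lemma length_blocks: "distinct ks \<Longrightarrow> length (concat (map (\<lambda>k. replicate (la k) k) ks)) = (\<Sum>k\<in>set ks. la k)"
  by (induction ks) auto

lemma omega_list_props:
  assumes "la \<in> comps r"
  shows "length (omega_list la) = r" "sorted (omega_list la)" "count_list (omega_list la) = la"
  using assms length_blocks[of "sorted_list_of_set {i. la i \<noteq> 0}" la]
  by (auto simp: omega_list_def comps_def sorted_blocks count_list_blocks fun_eq_iff)

lemma invs_cong: "(\<And>i. i < n \<Longrightarrow> F i = G i) \<Longrightarrow> invs n F = invs n G"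
  unfolding invs_def by (rule arg_cong[where f = card]) auto

lemma comps_sorted_unique:
  assumes "la \<in> comps r" "sorted f" "count_list f = la" shows "f = omega_list la"
proof -
  have "mset f = mset (omega_list la)"
    using assms omega_list_props(3)[OF assms(1)] by (auto simp: multiset_eq_iff count_mset fun_eq_iff)
  then show ?thesis using assms(2) omega_list_props(2)[OF assms(1)] by (metis properties_for_sort)
qed

lemma xh_apply: "xh r la u = (if u \<in> young r la then vv ^ slen r u else 0)"
proof -
  have "finite (young r la)" by (rule finite_subset[OF _ perms_finite[of r]]) (auto simp: young_def)
  then show ?thesis by (simp add: xh_def hsum_def Tw_def if_distrib cong: if_cong)
qed

lemma Tw_bas: "Tw r w = scl (vv ^ slen r w) (bas w)"
  by (auto simp: Tw_def bas_def scl_apply fun_eq_iff)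

context fixes r :: nat begin

lemma permute_list_eq_iff:
  "length f = r \<Longrightarrow> permute_list w f = f \<longleftrightarrow> (\<forall>a<r. f ! w a = f ! a)"
  by (auto simp: permute_list_def list_eq_iff_nth_eq)

lemma mset_perms: "w \<in> perms r \<Longrightarrow> length f = r \<Longrightarrow> mset (permute_list w f) = mset f"
  by (simp add: perms_lessThan)

lemma wembed_omega:
  assumes la: "la \<in> comps r"
  shows "wembed r (omega_list la) (omega la) = xh r la"
    and "sorted f \<Longrightarrow> length f = r \<Longrightarrow> f \<noteq> omega_list la \<Longrightarrow> wembed r f (omega la) = 0"
proof -
  note f = omega_list_props[OF la]
  show "wembed r (omega_list la) (omega la) = xh r la"
  proof
    fix w
    have "invs r (\<lambda>p. omega_list la ! w p) = 0" if "w \<in> young r la"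
    proof -
      have "invs r (\<lambda>p. omega_list la ! w p) = invs r (\<lambda>p. omega_list la ! p)"
        using that by (intro invs_cong) (auto simp: young_def)
      also have "\<dots> = 0" using f by (auto simp: invs_inj_eq sorted_nth_mono)
      finally show ?thesis .
    qed
    then show "wembed r (omega_list la) (omega la) w = xh r la w"
      using permute_list_eq_iff[OF f(1), of w] by (auto simp: wembed_def xh_apply omega_def bvec_def
          young_def)
  qed
  assume g: "sorted f" "length f = r" "f \<noteq> omega_list la"
  have "permute_list w f \<noteq> omega_list la" if "w \<in> perms r" for w
    using mset_perms[OF that g(2)] g(1,3) f(2) by (metis properties_for_sort)
  then show "wembed r f (omega la) = 0"
    by (auto simp: wembed_def omega_def bvec_def fun_eq_iff zero_fun_apply)
qed

lemma wembed_wproj: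
  assumes la: "la \<in> comps r" and f: "sorted f" "length f = r"
  shows "wembed r f (wproj la x) = (if f = omega_list la then wembed r f x else 0)"
proof -
  have "(\<forall>k. count_list (permute_list w f) k = la k) \<longleftrightarrow> f = omega_list la" if "w \<in> perms r" for w
  proof -
    have "count_list (permute_list w f) k = count_list f k" for k
      using mset_perms[OF that f(2)] by (metis count_mset)
    then show ?thesis
      using comps_sorted_unique[OF la f(1)] omega_list_props(3)[OF la] by (auto simp: fun_eq_iff)
  qed
  then show ?thesis by (auto simp: wembed_def wproj_def fun_eq_iff zero_fun_apply)
qed

lemma wproj_Vc: "x \<in> Vcarrier r \<Longrightarrow> wproj la x \<in> Vcarrier r"
  by (rule Vc_I[OF Vc_finite, of x]) (auto simp: wproj_def Vc_length split: if_splits intro: Vc_length ccontr)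

lemma varpi_comps: "varpi r \<in> comps r"
proof -
  have "{i. varpi r i \<noteq> 0} = {1..int r}" by (auto simp: varpi_def)
  moreover have "(\<Sum>i\<in>{1..int r}. varpi r i) = (\<Sum>i\<in>{1..int r}. 1)"
    by (rule sum.cong) (auto simp: varpi_def)
  ultimately show ?thesis by (simp add: comps_def id_apply)
qed

definition omega_reg :: vec where "omega_reg = omega (varpi r)"
text \<open>The h for which omega_varpi h is the component of x of content varpi
  (\<open>Vact_omega_reg_coord\<close>). The Young subgroup of varpi is trivial, so on this summand
  the embedding is an isomorphism onto H.\<close>

definition coord :: "vec \<Rightarrow> hecke" where "coord x = wembed r (omega_list (varpi r)) x"

lemma omega_Vc [simp]: "la \<in> comps r \<Longrightarrow> omega la \<in> Vcarrier r"
  by (simp add: omega_def omega_list_props)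

lemma omega_reg_Vc [simp]: "omega_reg \<in> Vcarrier r" by (simp add: omega_reg_def varpi_comps)
lemma coord_Hc [simp]: "coord x \<in> Hcarrier r" by (simp add: coord_def)

lemma young_varpi: "young r (varpi r) = {id}"
proof -
  let ?f = "omega_list (varpi r)"
  note f = omega_list_props[OF varpi_comps]
  have "count_list ?f k \<le> 1" for k unfolding f(3) by (simp add: varpi_def)
  then have "distinct ?f" by (metis count_mset distinct_count_atmost_1 count_list_0_iff le_antisym
      One_nat_def Suc_leI neq0_conv)
  then have "w = id" if "w \<in> young r (varpi r)" for w
  proof -
    have w: "w \<in> perms r" "\<And>a. a < r \<Longrightarrow> ?f ! w a = ?f ! a" using that by (auto simp: young_def)
    have "w a = a" for a
      using w(2)[of a] \<open>distinct ?f\<close> f(1) perms_lt[OF w(1), of a] perms_fix[OF w(1), of a]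
      by (cases "a < r") (auto simp: nth_eq_iff_index_eq)
    then show ?thesis by (auto simp: id_apply)
  qed
  moreover have "id \<in> young r (varpi r)" by (simp add: young_def id_apply)
  ultimately show ?thesis by blast
qed

lemma coord_omega_reg: "coord omega_reg = bas id"
  unfolding coord_def omega_reg_def wembed_omega(1)[OF varpi_comps]
  by (rule ext) (auto simp: xh_apply young_varpi bas_def)

lemma coord_Vact: "h \<in> Hcarrier r \<Longrightarrow> coord (Vact r x h) = Hmult r (coord x) h"
  using omega_list_props[OF varpi_comps] by (simp add: coord_def wembed_Vact)

lemma coord_lin: "coord (x + y) = coord x + coord y" "coord (scl c x) = scl c (coord x)" "coord 0 = 0"
  by (simp_all add: coord_def wembed_lin)

lemma coord_Vact_omega_reg [simp]: "h \<in> Hcarrier r \<Longrightarrow> coord (Vact r omega_reg h) = h"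
  by (simp add: coord_Vact coord_omega_reg)

lemma Vact_omega_reg_coord: "x \<in> Vcarrier r \<Longrightarrow> Vact r omega_reg (coord x) = wproj (varpi r) x"
proof (rule wembed_inj[of _ r])
  fix f :: "int list" assume x: "x \<in> Vcarrier r" and f: "length f = r" "sorted f"
  show "wembed r f (Vact r omega_reg (coord x)) = wembed r f (wproj (varpi r) x)"
  proof (cases "f = omega_list (varpi r)")
    case True
    then show ?thesis using f coord_Vact_omega_reg[of "coord x"] by (simp add: wembed_wproj
        varpi_comps coord_def)
  next
    case False
    then show ?thesis using f by (simp add: wembed_wproj wembed_Vact varpi_comps omega_reg_def wembed_omega)
  qed
qed (simp_all add: wproj_Vc)

lemma The_coord:
  assumes "x \<in> Vcarrier r"
  shows "(THE h. h \<in> Hcarrier r \<and> Vact r (omega (varpi r)) h = wproj (varpi r) x) = coord x"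
proof (rule the_equality)
  show "coord x \<in> Hcarrier r \<and> Vact r (omega (varpi r)) (coord x) = wproj (varpi r) x"
    using Vact_omega_reg_coord[OF assms] by (simp add: omega_reg_def)
  fix h assume "h \<in> Hcarrier r \<and> Vact r (omega (varpi r)) h = wproj (varpi r) x"
  then have "h \<in> Hcarrier r" "Vact r omega_reg h = Vact r omega_reg (coord x)" using
      Vact_omega_reg_coord[OF assms] by (simp_all add: omega_reg_def)
  then show "h = coord x" by (metis coord_Vact_omega_reg coord_Hc)
qed

text \<open>The endomorphism with omega_varpi \<mapsto> q that kills the summands of all other
  contents; z_mu has this form (\<open>zmu_reg_hom\<close>).\<close>

definition reg_hom :: "vec \<Rightarrow> vec \<Rightarrow> vec" where
  "reg_hom q x = (if x \<in> Vcarrier r then Vact r q (coord x) else 0)"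

lemma reg_hom_Salg: "q \<in> Vcarrier r \<Longrightarrow> reg_hom q \<in> Salg r"
  unfolding Salg_iff reg_hom_def by (simp add: coord_lin coord_Vact Vact_lin_right Vact_Vact)

end

section \<open>Linear algebra\<close>

text \<open>Gaussian elimination, one column at a time: a row a0 with nonzero entry in column b
  clears that column in the other rows, and its own coefficient is solved for at the end.\<close>

lemma linear_dependence:
  fixes M :: "'a \<Rightarrow> 'b \<Rightarrow> 'k::field"
  assumes "finite B" "finite A" "card B < card A"
  shows "\<exists>c. (\<exists>a\<in>A. c a \<noteq> 0) \<and> (\<forall>b\<in>B. (\<Sum>a\<in>A. c a * M a b) = 0)"
  using assms
proof (induction B arbitrary: A M rule: finite_induct)
  case empty
  then show ?case by (intro exI[of _ "\<lambda>_. 1"]) (auto simp: card_gt_0_iff)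
next
  case (insert b B)
  show ?case
  proof (cases "\<forall>a\<in>A. M a b = 0")
    case True
    obtain c where "\<exists>a\<in>A. c a \<noteq> 0" "\<forall>b\<in>B. (\<Sum>a\<in>A. c a * M a b) = 0"
      using insert.IH[of A M] insert.prems insert.hyps by auto
    then show ?thesis using True by (intro exI[of _ c]) auto
  next
    case False
    then obtain a0 where a0: "a0 \<in> A" "M a0 b \<noteq> 0" by blast
    define M' where "M' = (\<lambda>a b'. M a b' - M a b / M a0 b * M a0 b')"
    have "card B < card (A - {a0})" using insert.prems insert.hyps a0(1) by simp
    then obtain c where c: "\<exists>a\<in>A - {a0}. c a \<noteq> 0" "\<forall>b\<in>B. (\<Sum>a\<in>A - {a0}. c a * M' a b) = 0"
      using insert.IH[of "A - {a0}" M'] insert.prems(1) by blast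
    define c' where "c' = c(a0 := - (\<Sum>a\<in>A - {a0}. c a * M a b / M a0 b))"
    have "(\<Sum>a\<in>A. c' a * M a b') = (\<Sum>a\<in>A - {a0}. c a * M' a b')" for b'
    proof -
      have "(\<Sum>a\<in>A. c' a * M a b') = c' a0 * M a0 b' + (\<Sum>a\<in>A - {a0}. c' a * M a b')"
        using insert.prems a0 by (simp add: sum.remove)
      also have "(\<Sum>a\<in>A - {a0}. c' a * M a b') = (\<Sum>a\<in>A - {a0}. c a * M a b')"
        by (intro sum.cong) (auto simp: c'_def)
      finally show ?thesis
        by (simp add: c'_def M'_def sum_distrib_right algebra_simps sum_subtractf sum_distrib_left sum_negf)
    qed
    moreover have "(\<Sum>a\<in>A - {a0}. c a * M' a b) = 0" using a0 by (simp add: M'_def)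
    moreover have "\<exists>a\<in>A. c' a \<noteq> 0" using c(1) by (auto simp: c'_def)
    ultimately show ?thesis using c(2) by (intro exI[of _ c']) auto
  qed
qed

context fixes r :: nat begin

lemma hform_ortho_card:
  assumes "finite B" "B \<subseteq> Hcarrier r" "0 \<notin> B"
    and orth: "\<And>a b. a \<in> B \<Longrightarrow> b \<in> B \<Longrightarrow> a \<noteq> b \<Longrightarrow> hform r a b = 0"
  shows "card B \<le> card (perms r)"
proof (rule ccontr)
  assume "\<not> ?thesis"
  then obtain c where c: "\<exists>a\<in>B. c a \<noteq> 0" "\<forall>w\<in>perms r. (\<Sum>a\<in>B. c a * a w) = 0"
    using linear_dependence[OF perms_finite assms(1), of r "\<lambda>a w. a w"] by auto
  then obtain b where b: "b \<in> B" "c b \<noteq> 0" by blast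
  have "hform r (\<Sum>a\<in>B. scl (c a) a) b = 0"
    using c(2) by (simp add: hform_def sum_fun_apply scl_apply)
  moreover have "hform r (\<Sum>a\<in>B. scl (c a) a) b = (\<Sum>a\<in>B. if a = b then c b * hform r b b else 0)"
    unfolding hform_sum by (intro sum.cong) (auto simp: hform_lin orth b)
  ultimately have "c b * hform r b b = 0" using assms(1) b by simp
  moreover have "hform r b b > 0" using hform_pos[of b r] b assms by auto
  ultimately show False using b by simp
qed

text \<open>A largest orthogonal family in A exists by \<open>hform_ortho_card\<close>. It spans A,
  since otherwise the remainder of some a could be adjoined; the orthogonal expansion along it is
  then the projection.\<close>

lemma hform_projection:
  assumes A: "A \<subseteq> Hcarrier r" "0 \<in> A"
    and add: "\<And>a b. a \<in> A \<Longrightarrow> b \<in> A \<Longrightarrow> a + b \<in> A" and scl: "\<And>c a. a \<in> A \<Longrightarrow> scl c a \<in> A"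
    and h: "h \<in> Hcarrier r"
  shows "\<exists>p\<in>A. \<forall>a\<in>A. hform r (h - p) a = 0"
proof -
  let ?P = "\<lambda>B. finite B \<and> B \<subseteq> A \<and> 0 \<notin> B \<and> (\<forall>a\<in>B. \<forall>b\<in>B. a \<noteq> b \<longrightarrow> hform r a b = 0)"
  have bound: "\<forall>B. ?P B \<longrightarrow> card B < Suc (card (perms r))"
  proof (intro allI impI)
    fix B assume "?P B"
    then show "card B < Suc (card (perms r))" using hform_ortho_card[of B] A(1) by (force simp:
        less_Suc_eq_le)
  qed
  have "\<exists>B. ?P B \<and> (\<forall>C. ?P C \<longrightarrow> card C \<le> card B)"
    by (rule ex_has_greatest_nat[OF _ bound, of "{}"]) simp
  then obtain B where B: "?P B" and mx: "\<forall>C. ?P C \<longrightarrow> card C \<le> card B" by blast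
  define pr where "pr = (\<lambda>x. \<Sum>b\<in>B. scl (hform r x b / hform r b b) b)"
  have nz: "hform r b b \<noteq> 0" if "b \<in> B" for b
    using that B A(1) hform_pos[of b r] by force
  have prA: "pr x \<in> A" for x
  proof -
    have "(\<Sum>b\<in>C. scl (hform r x b / hform r b b) b) \<in> A" if "C \<subseteq> B" for C
      using finite_subset[OF that] B that
      by (induction C rule: infinite_finite_induct) (auto intro!: add scl A(2))
    then show ?thesis by (simp add: pr_def)
  qed
  have orth: "hform r (x - pr x) b = 0" if b: "b \<in> B" for x b
  proof -
    have "hform r (pr x) b = (\<Sum>a\<in>B. if a = b then hform r x b else 0)"
      unfolding pr_def hform_sum by (intro sum.cong) (use B b nz in \<open>auto simp: hform_lin\<close>)
    then have "hform r (pr x) b = hform r x b" using B b by simp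
    then show ?thesis unfolding diff_conv_add_uminus minus_scl by (simp add: hform_lin)
  qed
  have self: "a = pr a" if a: "a \<in> A" for a
  proof (rule ccontr)
    assume ne: "a \<noteq> pr a"
    let ?d = "a - pr a"
    have "a + scl (-1) (pr a) = ?d" by (simp add: minus_scl[symmetric])
    then have d: "?d \<in> A" "?d \<noteq> 0" "\<forall>b\<in>B. hform r ?d b = 0"
      using ne add[OF a scl[OF prA, of "-1" a]] orth by auto
    then have "?d \<notin> B" using nz by blast
    moreover have "\<forall>b\<in>B. hform r b ?d = 0" using d(3) by (subst hform_commute) simp
    then have "?P (insert ?d B)" using B d by simp
    then have "card (insert ?d B) \<le> card B" using mx by blast
    ultimately show False using B by simp
  qed
  have "hform r (h - pr h) a = 0" if a: "a \<in> A" for a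
  proof -
    have "hform r (h - pr h) (pr a) = (\<Sum>b\<in>B. hform r a b / hform r b b * hform r (h - pr h) b)"
      by (subst pr_def) (simp add: hform_sum hform_lin)
    also have "\<dots> = 0" using orth by simp
    finally show ?thesis using self[OF a] by simp
  qed
  then show ?thesis using prA by blast
qed

lemma hform_mult_left:
  assumes "a \<in> Hcarrier r" "b \<in> Hcarrier r" "c \<in> Hcarrier r"
  shows "hform r (Hmult r a b) c = hform r b (Hmult r (hstar r a) c)"
proof -
  have "hform r (Hmult r a b) c = hform r (Hmult r (hstar r b) (hstar r a)) (hstar r c)"
    using assms by (simp add: star_Hmult[symmetric] hform_star)
  also have "\<dots> = hform r (hstar r b) (Hmult r (hstar r c) a)"
    using assms by (simp add: hform_mult)
  also have "\<dots> = hform r b (Hmult r (hstar r a) c)"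
    using assms hform_star[of r b "Hmult r (hstar r a) c"] by (simp add: star_Hmult)
  finally show ?thesis .
qed

section \<open>Complete reducibility\<close>

lemma Ssubmod_iff: "Ssubmod r U \<longleftrightarrow> U \<subseteq> Vcarrier r \<and> 0 \<in> U \<and> (\<forall>x\<in>U. \<forall>y\<in>U. x + y \<in> U) \<and>
    (\<forall>c. \<forall>x\<in>U. scl c x \<in> U) \<and> (\<forall>s\<in>Salg r. \<forall>x\<in>U. s x \<in> U)"
  by (simp add: Ssubmod_def vec_ops)

lemma dyad_omega_reg:
  assumes "x \<in> Vcarrier r" "y \<in> Vcarrier r"
  shows "dyad r y (omega_reg r) x = Vact r (omega_reg r) (\<Sum>w\<in>perms r. scl (vform (VT r w y) x) (bas w))"
  using assms by (simp add: dyad_def Vact_sum_right Vact_lin_right VT_eq)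

text \<open>A submodule \<open>U\<close> is \<open>V p\<close>, where \<open>p\<close> is the orthogonal projection of \<open>1\<close> to the left ideal
  of all \<open>h\<close> with \<open>\<omega>\<^sub>\<varpi> h \<in> U\<close>.\<close>

lemma completely_reducible_tensor_space: "completely_reducible r"
  unfolding completely_reducible_def
proof (intro allI impI)
  fix U assume U: "Ssubmod r U"
  define A where "A = {h \<in> Hcarrier r. Vact r (omega_reg r) h \<in> U}"
  have A: "A \<subseteq> Hcarrier r" "0 \<in> A" "\<And>a b. a \<in> A \<Longrightarrow> b \<in> A \<Longrightarrow> a + b \<in> A" "\<And>c a. a \<in> A \<Longrightarrow> scl c a \<in> A"
    using U by (auto simp: A_def Ssubmod_iff Vact_lin_right)
  have ideal: "Hmult r h a \<in> A" if "h \<in> Hcarrier r" "a \<in> A" for h a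
  proof -
    have "reg_hom r (Vact r (omega_reg r) h) (Vact r (omega_reg r) a) \<in> U"
      using U that reg_hom_Salg[of "Vact r (omega_reg r) h" r] by (auto simp: A_def Ssubmod_iff)
    then show ?thesis using that by (simp add: A_def reg_hom_def Vact_Vact)
  qed
  obtain p where p: "p \<in> A" "\<And>a. a \<in> A \<Longrightarrow> hform r (bas id - p) a = 0"
    using hform_projection[OF A, of "bas id"] by auto
  have pH: "p \<in> Hcarrier r" using p A by auto
  define p' where "p' = bas id - p"
  have p'H: "p' \<in> Hcarrier r" using pH by (simp add: p'_def)
  \<comment> \<open>a p' = a - a p lies in A, and so does its left multiple by
    \<open>hstar r a\<close>. Orthogonality of p' to A then makes the form of a p' with itself
    vanish.\<close>
  have kill: "Hmult r a p' = 0" if a: "a \<in> A" for a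
  proof (rule ccontr)
    assume ne: "Hmult r a p' \<noteq> 0"
    have aH: "a \<in> Hcarrier r" using a A by auto
    have "Hmult r a p' = a + scl (-1) (Hmult r a p)" using aH by (simp add: p'_def Hmult_diff minus_scl)
    then have "Hmult r a p' \<in> A" using A ideal[OF aH p(1)] a by auto
    then have "hform r p' (Hmult r (hstar r a) (Hmult r a p')) = 0"
      unfolding p'_def using ideal p(2) by simp
    then have "hform r (Hmult r a p') (Hmult r a p') = 0" using aH p'H by (simp add: hform_mult_left)
    then show False using hform_pos[OF _ ne, of r] p'H by simp
  qed
  have p'p': "Hmult r p' p' = p'"
    using kill[OF p(1)] p'H Hmult_diff(2)[of r "bas id" p p'] unfolding p'_def[symmetric] by simp
  \<comment> \<open>For y = x p' let ?t z be the sum of the <y T_w, z> T_w, so that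
    \<open>dyad\<close> sends z to omega_varpi times ?t z. Then ?t x lies in A, whence ?t y = (?t x)
    p' = 0; but the coefficient of ?t y at \<open>id\<close> is <y, y>.\<close>
  have UK: "Vact r x p' = 0" if x: "x \<in> U" for x
  proof (rule ccontr)
    define y where "y = Vact r x p'"
    assume "Vact r x p' \<noteq> 0"
    then have y0: "y \<noteq> 0" by (simp add: y_def)
    have xV: "x \<in> Vcarrier r" using x U by (auto simp: Ssubmod_iff)
    have yV: "y \<in> Vcarrier r" using xV by (simp add: y_def)
    let ?t = "\<lambda>x. \<Sum>w\<in>perms r. scl (vform (VT r w y) x) (bas w)"
    have tH: "?t z \<in> Hcarrier r" for z by simp
    have "dyad r y (omega_reg r) x \<in> U" using U x dyad_Salg[OF yV, of "omega_reg r"] by (auto simp: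
        Ssubmod_iff)
    then have tA: "?t x \<in> A" using tH by (simp add: A_def dyad_omega_reg xV yV)
    have "Vact r (omega_reg r) (?t y) = dyad r y (omega_reg r) y" by (simp add: dyad_omega_reg yV)
    also have "\<dots> = Vact r (dyad r y (omega_reg r) x) p'"
      unfolding y_def[symmetric] using SalgD(5)[OF dyad_Salg[OF yV omega_reg_Vc] xV p'H] by (simp add: y_def)
    also have "\<dots> = Vact r (omega_reg r) (Hmult r (?t x) p')"
      using tH p'H by (simp add: dyad_omega_reg xV yV Vact_Vact)
    also have "\<dots> = 0" using kill[OF tA] by (simp add: Vact_lin_right)
    finally have "coord r (Vact r (omega_reg r) (?t y)) = 0" by (simp add: coord_lin)
    then have "?t y = 0" using coord_Vact_omega_reg[OF tH] by simp
    then have "?t y id = 0" by (simp add: zero_fun_apply)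
    moreover have "?t y id = vform (VT r id y) y"
      by (simp add: sum_fun_apply scl_apply bas_def if_distrib cong: if_cong)
    moreover have "VT r id y = y" using yV by (simp add: VT_eq)
    ultimately show False using vform_pos[OF yV y0] by simp
  qed
  let ?U' = "{Vact r x p' | x. x \<in> Vcarrier r}"
  have dec: "x = Vact r x p + Vact r x p'" if "x \<in> Vcarrier r" for x
  proof -
    have "Vact r x p + Vact r x p' = Vact r x (p + p')" by (simp only: Vact_lin_right)
    then show ?thesis using that by (simp add: p'_def)
  qed
  have VpU: "Vact r x p \<in> U" if x: "x \<in> Vcarrier r" for x
  proof -
    have "reg_hom r x (Vact r (omega_reg r) p) \<in> U" using U p(1) reg_hom_Salg[OF x] by (auto simp:
        A_def Ssubmod_iff)
    then show ?thesis using pH by (simp add: reg_hom_def)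
  qed
  have "Ssubmod r ?U'"
    unfolding Ssubmod_iff
  proof (intro conjI allI ballI)
    show "?U' \<subseteq> Vcarrier r" by auto
    show "0 \<in> ?U'" using p'H by (intro CollectI exI[of _ 0]) simp
    show "x + y \<in> ?U'" if "x \<in> ?U'" "y \<in> ?U'" for x y
      using that p'H by (auto simp: Vact_lin(1)[symmetric])
    show "scl c x \<in> ?U'" if "x \<in> ?U'" for c x
      using that p'H by (auto simp: Vact_lin(2)[symmetric])
    show "s x \<in> ?U'" if "s \<in> Salg r" "x \<in> ?U'" for s x
      using that p'H SalgD(2,5) by auto
  qed
  moreover have "U \<inter> ?U' = {vzero}"
  proof -
    have "x = 0" if "x \<in> U" "x \<in> ?U'" for x
      using UK[OF that(1)] that(2) p'H by (auto simp: Vact_Vact p'p')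
    moreover have "0 \<in> ?U'" using p'H by (intro CollectI exI[of _ 0]) simp
    moreover have "0 \<in> U" using U by (simp add: Ssubmod_iff)
    ultimately show ?thesis by (auto simp: vec_ops)
  qed
  moreover have "\<forall>x\<in>Vcarrier r. \<exists>u\<in>U. \<exists>u'\<in>?U'. x = vadd u u'"
    using VpU dec by (auto simp: vec_ops)
  ultimately show "\<exists>U'. Ssubmod r U' \<and> U \<inter> U' = {vzero} \<and> (\<forall>x\<in>Vcarrier r. \<exists>u\<in>U. \<exists>u'\<in>U'. x = vadd u u')"
    by blast
qed

end

section \<open>Row and column symmetrizers\<close>

lemma yh_apply: "yh r nu u = (if u \<in> young r nu then (- inverse vv) ^ slen r u else 0)"
proof -
  have "finite (young r nu)" by (rule finite_subset[OF _ perms_finite[of r]]) (auto simp: young_def)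
  moreover have "inverse ((- (vv ^ 2)) ^ n) * vv ^ n = (- inverse vv) ^ n" for n
  proof -
    have "inverse (- (vv ^ 2)) * vv = - inverse vv" by (simp add: power2_eq_square)
    then show ?thesis by (simp only: power_inverse[symmetric] power_mult_distrib[symmetric])
  qed
  ultimately show ?thesis by (simp add: yh_def hsum_def Tw_def if_distrib cong: if_cong)
qed

lemma young_perms: "w \<in> young r la \<Longrightarrow> w \<in> perms r" by (simp add: young_def)

lemma young_nth: "w \<in> young r la \<Longrightarrow> a < r \<Longrightarrow> omega_list la ! w a = omega_list la ! a"
  by (simp add: young_def)

lemma young_inv: "w \<in> young r la \<Longrightarrow> inv w \<in> young r la"
  unfolding young_def using perms_inv_apply(1) perms_lt perms_inv by (smt (verit) mem_Collect_eq)

lemma young_sgen_right: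
  assumes "Suc j < r" "omega_list la ! j = omega_list la ! Suc j"
  shows "w \<circ> sgen j \<in> young r la \<longleftrightarrow> w \<in> young r la"
proof -
  have *: "w \<circ> sgen j \<in> young r la" if "w \<in> young r la" for w
    using that assms by (auto simp: young_def sgen_apply o_apply)
  show ?thesis using *[of w] *[of "w \<circ> sgen j"] by auto
qed

lemma young_sgen_left:
  assumes "Suc j < r" "omega_list la ! j = omega_list la ! Suc j"
  shows "sgen j \<circ> w \<in> young r la \<longleftrightarrow> w \<in> young r la"
proof -
  have *: "sgen j \<circ> w \<in> young r la" if "w \<in> young r la" for w
    using that assms by (auto simp: young_def sgen_apply o_apply)
  show ?thesis using *[of w] *[of "sgen j \<circ> w"] by auto
qed

lemma young_sgen: "Suc j < r \<Longrightarrow> omega_list la ! j = omega_list la ! Suc j \<Longrightarrow> sgen j \<in> young r la"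
  by (auto simp: young_def sgen_apply)

context fixes r :: nat begin

lemma xh_yh_Hc [simp]: "xh r la \<in> Hcarrier r" "yh r la \<in> Hcarrier r"
  by (auto simp: Hcarrier_def xh_apply yh_apply young_perms split: if_splits)

lemma star_xh [simp]: "hstar r (xh r la) = xh r la"
  by (rule Hc_eqI[of _ r], simp, simp) (auto simp: hstar_def xh_apply dest: young_inv)

lemma star_yh [simp]: "hstar r (yh r la) = yh r la"
  by (rule Hc_eqI[of _ r], simp, simp) (auto simp: hstar_def yh_apply dest: young_inv)

lemma xh_gen:
  assumes j: "Suc j < r" "omega_list la ! j = omega_list la ! Suc j"
  shows "Rgen j (xh r la) = scl vv (xh r la)"
proof (rule Hc_eqI[of _ r])
  fix u assume u: "u \<in> perms r"
  have ne: "u j \<noteq> u (Suc j)" using perms_eq_iff[OF u, of j "Suc j"] by simp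
  show "Rgen j (xh r la) u = scl vv (xh r la) u"
    using slen_asc[OF j(1), of u] slen_desc[OF j(1), of u] ne
    by (auto simp: Rgen_def xh_apply scl_apply young_sgen_right[OF j] neq_iff field_simps)
qed (use j in auto)

lemma yh_gen:
  assumes j: "Suc j < r" "omega_list la ! j = omega_list la ! Suc j"
  shows "Hgen r j (yh r la) = scl (- inverse vv) (yh r la)"
proof (rule Hc_eqI[of _ r])
  fix u assume u: "u \<in> perms r"
  have ne: "inv u j \<noteq> inv u (Suc j)" using perms_eq_iff[OF perms_inv[OF u], of j "Suc j"] by simp
  show "Hgen r j (yh r la) u = scl (- inverse vv) (yh r la) u"
    using slen_asc[OF j(1), of "inv u"] slen_desc[OF j(1), of "inv u"] slen_left[OF u j(1)] ne u
    by (auto simp: Hgen_apply[OF u j(1)] yh_apply scl_apply young_sgen_left[OF j] neq_iff field_simps)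
qed (use j in auto)

end

section \<open>Double cosets of Young subgroups\<close>

lemma block_increasing:
  fixes F :: "nat \<Rightarrow> nat"
  assumes g: "sorted g" and step: "\<And>j. Suc j < length g \<Longrightarrow> g ! j = g ! Suc j \<Longrightarrow> F j < F (Suc j)"
    and ij: "i < j" "j < length g" "g ! i = g ! j"
  shows "F i < F j"
  using ij
proof (induction j)
  case (Suc j)
  have "g ! i \<le> g ! j" "g ! j \<le> g ! Suc j" using sorted_nth_mono[OF g, of i j] sorted_nth_mono[OF g,
      of j "Suc j"] Suc.prems by auto
  then have eq: "g ! i = g ! j" "g ! j = g ! Suc j" using Suc.prems by auto
  then show ?case using Suc step[of j] by (cases "i = j") (auto simp: less_Suc_eq intro: less_trans)
qed simp

text \<open>The matrix counting the j with given letters f ! w j and g ! j depends only on the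
  double coset of w. Injectivity says that its entries are 0 or 1, equivalently that no nontrivial
  element of the Young subgroup of g is conjugated by w into that of f.\<close>

definition pairinj :: "nat \<Rightarrow> 'a list \<Rightarrow> 'b list \<Rightarrow> perm \<Rightarrow> bool" where
  "pairinj r f g w \<longleftrightarrow> inj_on (\<lambda>j. (f ! w j, g ! j)) {..<r}"

text \<open>No descent inside a block on either side: the local form of w being shortest in its
  double coset.\<close>

definition blockmono :: "nat \<Rightarrow> 'a list \<Rightarrow> 'b list \<Rightarrow> perm \<Rightarrow> bool" where
  "blockmono r f g w \<longleftrightarrow> (\<forall>j. Suc j < r \<longrightarrow> g ! j = g ! Suc j \<longrightarrow> w j < w (Suc j)) \<and>
     (\<forall>p. Suc p < r \<longrightarrow> f ! p = f ! Suc p \<longrightarrow> inv w p < inv w (Suc p))"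

lemma pairinjD: "pairinj r f g w \<Longrightarrow> i < r \<Longrightarrow> j < r \<Longrightarrow> f ! w i = f ! w j \<Longrightarrow> g ! i = g ! j \<Longrightarrow> i = j"
  by (auto simp: pairinj_def inj_on_def)

lemma pairinj_conj:
  assumes "pairinj r f g w" "w \<in> perms r" "b \<in> perms r"
    and a: "\<And>p. p < r \<Longrightarrow> f ! a p = f ! p" and b: "\<And>j. j < r \<Longrightarrow> g ! b j = g ! j"
  shows "pairinj r f g (a \<circ> w \<circ> b)"
  unfolding pairinj_def
proof (rule inj_onI)
  fix i j assume ij: "i \<in> {..<r}" "j \<in> {..<r}"
    "(f ! (a \<circ> w \<circ> b) i, g ! i) = (f ! (a \<circ> w \<circ> b) j, g ! j)"
  then have "f ! w (b i) = f ! w (b j)" "g ! b i = g ! b j"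
    using a b perms_lt[OF assms(2)] perms_lt[OF assms(3)] by (auto simp: o_apply)
  then have "b i = b j" using pairinjD[OF assms(1)] ij perms_lt[OF assms(3)] by auto
  then show "i = j" using perms_eq_iff[OF assms(3)] by blast
qed

lemma pairinj_sgen_right:
  assumes "Suc j < r" "g ! j = g ! Suc j" "w \<in> perms r"
  shows "pairinj r f g (w \<circ> sgen j) \<longleftrightarrow> pairinj r f g w"
proof -
  have b: "\<And>i. g ! sgen j i = g ! i" using assms by (auto simp: sgen_apply)
  have *: "pairinj r f g (w \<circ> sgen j)" if "pairinj r f g w" "w \<in> perms r" for w
    using pairinj_conj[OF that, of "sgen j" id] assms b by (simp add: id_apply)
  show ?thesis using *[of w] *[of "w \<circ> sgen j"] assms by auto
qed

lemma pairinj_sgen_left: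
  assumes "Suc j < r" "f ! j = f ! Suc j" "w \<in> perms r"
  shows "pairinj r f g (sgen j \<circ> w) \<longleftrightarrow> pairinj r f g w"
proof -
  have a: "\<And>i. f ! sgen j i = f ! i" using assms by (auto simp: sgen_apply)
  have *: "pairinj r f g (sgen j \<circ> w)" if "pairinj r f g w" "w \<in> perms r" for w
    using pairinj_conj[OF that, of id "sgen j"] assms a by (simp add: id_apply)
  show ?thesis using *[of w] *[of "sgen j \<circ> w"] assms by auto
qed

context
  fixes r :: nat and la nu :: "int \<Rightarrow> nat"
  assumes la: "la \<in> comps r" and nu: "nu \<in> comps r"
begin

abbreviation (input) "f \<equiv> omega_list la"
abbreviation (input) "g \<equiv> omega_list nu"

definition xTy :: "perm \<Rightarrow> hecke" where
  "xTy w = Hmult r (Hmult r (xh r la) (bas w)) (yh r nu)"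

lemma xTy_right:
  assumes w: "w \<in> perms r" and j: "Suc j < r" "g ! j = g ! Suc j" and d: "w (Suc j) < w j"
  shows "xTy w = scl (- inverse vv) (xTy (w \<circ> sgen j))"
proof -
  have "bas w = Hmult r (bas (w \<circ> sgen j)) (bas (sgen j))"
    using Hmult_bas_sgen[of "w \<circ> sgen j" r j] w j d by (simp add: o_apply)
  then have "xTy w = Hmult r (Hmult r (xh r la) (bas (w \<circ> sgen j))) (Hmult r (bas (sgen j)) (yh r nu))"
    using w j by (simp add: xTy_def Hmult_assoc)
  then show ?thesis using j w by (simp add: Hgen_Hmult[symmetric] yh_gen Hmult_lin xTy_def)
qed

lemma xTy_left:
  assumes w: "w \<in> perms r" and j: "Suc j < r" "f ! j = f ! Suc j" and d: "inv w (Suc j) < inv w j"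
  shows "xTy w = scl vv (xTy (sgen j \<circ> w))"
proof -
  have "inv (sgen j \<circ> w) = inv w \<circ> sgen j" using perms_inv_comp[OF perms_sgen[OF j(1)] w] by simp
  then have "bas w = Hmult r (bas (sgen j)) (bas (sgen j \<circ> w))"
    using Hmult_sgen_bas[of "sgen j \<circ> w" r j] w j d by (simp add: o_apply)
  then have "xTy w = Hmult r (Hmult r (Hmult r (xh r la) (bas (sgen j))) (bas (sgen j \<circ> w))) (yh r nu)"
    using w j by (simp add: xTy_def Hmult_assoc)
  then show ?thesis using j w by (simp add: Rgen_Hmult[symmetric] xh_gen Hmult_lin xTy_def)
qed

text \<open>Here \<open>T\<^sub>p T\<^sub>w = T\<^sub>w T\<^sub>j\<close>, and \<open>T\<^sub>p\<close> acts on \<open>x\<close> by \<open>v\<close> but \<open>T\<^sub>j\<close> on \<open>y\<close> by \<open>- v\<^sup>-\<^sup>1\<close>.\<close>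

lemma xTy_zero:
  assumes w: "w \<in> perms r" and j: "Suc j < r" "g ! j = g ! Suc j"
    and s: "w (Suc j) = Suc (w j)" and f: "f ! w j = f ! w (Suc j)"
  shows "xTy w = 0"
proof -
  let ?p = "w j"
  have p: "Suc ?p < r" using perms_lt[OF w, of "Suc j"] j s by simp
  have eq: "sgen ?p \<circ> w = w \<circ> sgen j"
  proof
    fix a
    show "(sgen ?p \<circ> w) a = (w \<circ> sgen j) a"
      using s perms_eq_iff[OF w, of a j] perms_eq_iff[OF w, of a "Suc j"]
      by (cases "a = j"; cases "a = Suc j") (auto simp: o_apply sgen_apply)
  qed
  have "inv w ?p = j" "inv w (Suc ?p) = Suc j" using perms_inv_apply(2)[OF w] s by metis+
  then have "Hmult r (bas (sgen ?p)) (bas w) = bas (sgen ?p \<circ> w)"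
    using Hmult_sgen_bas[OF w p] by simp
  moreover have "Hmult r (bas w) (bas (sgen j)) = bas (w \<circ> sgen j)"
    using Hmult_bas_sgen[OF w j(1)] s by simp
  ultimately have c: "Hmult r (bas (sgen ?p)) (bas w) = Hmult r (bas w) (bas (sgen j))" using eq by simp
  have "scl vv (xTy w) = Hmult r (Hmult r (Rgen ?p (xh r la)) (bas w)) (yh r nu)"
    using p f s by (simp add: xh_gen Hmult_lin xTy_def)
  also have "\<dots> = Hmult r (Hmult r (xh r la) (Hmult r (bas w) (bas (sgen j)))) (yh r nu)"
    by (simp only: Rgen_Hmult[OF xh_yh_Hc(1) p] Hmult_assoc[OF xh_yh_Hc(1) Hc_basic(5)[OF
        perms_sgen[OF p]] Hc_basic(5)[OF w]] c)
  also have "\<dots> = Hmult r (Hmult r (xh r la) (bas w)) (Hgen r j (yh r nu))"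
    using j w by (simp add: Hgen_Hmult Hmult_assoc)
  also have "\<dots> = scl (- inverse vv) (xTy w)" using j by (simp add: yh_gen Hmult_lin xTy_def)
  finally have "vv * xTy w u = - inverse vv * xTy w u" for u by (metis scl_apply)
  then have "(vv - - inverse vv) * xTy w u = 0" for u unfolding left_diff_distrib by simp
  then have "xTy w u = 0" for u using vv_neq by (metis eq_iff_diff_eq_0 mult_eq_0_iff)
  then show ?thesis by (auto simp: fun_eq_iff zero_fun_apply)
qed

text \<open>A descent inside a block of g or f can be split off w and absorbed by y or x at the
  price of a scalar; this shortens w without leaving its double coset.\<close>

lemma xTy_reduce:
  "w \<in> perms r \<Longrightarrow> \<exists>c u. u \<in> perms r \<and> blockmono r f g u \<and> xTy w = scl c (xTy u) \<and> (pairinj r f g u \<longleftrightarrow>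
      pairinj r f g w)"
proof (induction "slen r w" arbitrary: w rule: less_induct)
  case less
  show ?case
  proof (cases "blockmono r f g w")
    case True
    then show ?thesis using less.prems by (intro exI[of _ 1] exI[of _ w]) simp
  next
    case False
    then consider j where "Suc j < r" "g ! j = g ! Suc j" "\<not> w j < w (Suc j)"
      | j where "Suc j < r" "f ! j = f ! Suc j" "\<not> inv w j < inv w (Suc j)"
      by (auto simp: blockmono_def)
    then show ?thesis
    proof cases
      case 1
      then have d: "w (Suc j) < w j" using perms_eq_iff[OF less.prems, of j "Suc j"] by (simp add:
          linorder_neq_iff)
      have w': "w \<circ> sgen j \<in> perms r" using 1 less.prems by simp
      obtain c u where "u \<in> perms r" "blockmono r f g u" "xTy (w \<circ> sgen j) = scl c (xTy u)"
        "pairinj r f g u \<longleftrightarrow> pairinj r f g (w \<circ> sgen j)"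
        using less.hyps[OF _ w'] slen_desc[of j r w] 1 d by auto
      then show ?thesis using xTy_right[OF less.prems 1(1,2) d] pairinj_sgen_right[OF 1(1,2) less.prems]
        by (intro exI[of _ "- inverse vv * c"] exI[of _ u]) simp
    next
      case 2
      then have d: "inv w (Suc j) < inv w j"
        using perms_eq_iff[OF perms_inv[OF less.prems], of j "Suc j"] by (simp add: linorder_neq_iff)
      have w': "sgen j \<circ> w \<in> perms r" using 2 less.prems by simp
      obtain c u where "u \<in> perms r" "blockmono r f g u" "xTy (sgen j \<circ> w) = scl c (xTy u)"
        "pairinj r f g u \<longleftrightarrow> pairinj r f g (sgen j \<circ> w)"
        using less.hyps[OF _ w'] slen_left_iff[of w r j] 2 d less.prems by auto
      then show ?thesis using xTy_left[OF less.prems 2(1,2) d] pairinj_sgen_left[OF 2(1,2) less.prems]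
        by (intro exI[of _ "vv * c"] exI[of _ u]) simp
    qed
  qed
qed

lemma blockmono_right:
  "blockmono r f g w \<Longrightarrow> i < j \<Longrightarrow> j < r \<Longrightarrow> g ! i = g ! j \<Longrightarrow> w i < w j"
  using block_increasing[of g w i j] omega_list_props[OF nu] by (auto simp: blockmono_def)

lemma blockmono_left:
  "blockmono r f g w \<Longrightarrow> p < q \<Longrightarrow> q < r \<Longrightarrow> f ! p = f ! q \<Longrightarrow> inv w p < inv w q"
  using block_increasing[of f "inv w" p q] omega_list_props[OF la] by (auto simp: blockmono_def)

lemma sorted_f: "p \<le> q \<Longrightarrow> q < r \<Longrightarrow> f ! p \<le> f ! q"
  using omega_list_props[OF la] by (simp add: sorted_nth_mono)

lemma sorted_g: "p \<le> q \<Longrightarrow> q < r \<Longrightarrow> g ! p \<le> g ! q"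
  using omega_list_props[OF nu] by (simp add: sorted_nth_mono)

text \<open>If i < j carry the same pair of letters, then so do i and i+1, since w i < w (i+1) \<le>
  w j within one block of f. Monotonicity of \<open>inv w\<close> makes these two values adjacent,
  which is the case of \<open>xTy_zero\<close>.\<close>

lemma xTy_blockmono_noninj:
  assumes w: "w \<in> perms r" and bm: "blockmono r f g w" and ni: "\<not> pairinj r f g w"
  shows "xTy w = 0"
proof -
  obtain i j where ij: "i < j" "j < r" "f ! w i = f ! w j" "g ! i = g ! j"
    using ni unfolding pairinj_def inj_on_def by (metis Pair_inject lessThan_iff linorder_neqE_nat)
  have i: "Suc i < r" using ij by simp
  have g: "g ! i = g ! Suc i" using sorted_g[of i "Suc i"] sorted_g[of "Suc i" j] ij by simp
  have w1: "w i < w (Suc i)" using blockmono_right[OF bm _ i g] by simp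
  have w2: "w (Suc i) \<le> w j"
    using blockmono_right[OF bm, of "Suc i" j] ij g by (cases "Suc i = j") auto
  have lt: "w j < r" "w (Suc i) < r" using perms_lt[OF w] ij by auto
  have f: "f ! p = f ! w i" if "w i \<le> p" "p \<le> w (Suc i)" for p
    using sorted_f[of "w i" p] sorted_f[of p "w j"] that w2 lt ij by simp
  \<comment> \<open>A value strictly between would have a preimage strictly between i and i + 1,
    because \<open>inv w\<close> increases on the block of f.\<close>
  have "w (Suc i) = Suc (w i)"
  proof (rule ccontr)
    assume ne: "w (Suc i) \<noteq> Suc (w i)"
    then have p: "w i < Suc (w i)" "Suc (w i) < w (Suc i)" using w1 by auto
    have "inv w (w i) < inv w (Suc (w i))"
      using blockmono_left[OF bm p(1)] p lt f[of "Suc (w i)"] by simp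
    moreover have "inv w (Suc (w i)) < inv w (w (Suc i))"
      using blockmono_left[OF bm p(2) lt(2)] f[of "Suc (w i)"] f[of "w (Suc i)"] p by simp
    ultimately show False using perms_inv_apply(2)[OF w] by simp
  qed
  then show ?thesis using xTy_zero[OF w i g] f[of "w (Suc i)"] w1 by simp
qed

lemma xTy_noninj: "w \<in> perms r \<Longrightarrow> \<not> pairinj r f g w \<Longrightarrow> xTy w = 0"
  using xTy_reduce[of w] xTy_blockmono_noninj by fastforce

lemma xHy_expand:
  "h \<in> Hcarrier r \<Longrightarrow> Hmult r (Hmult r (xh r la) h) (yh r nu) = (\<Sum>w\<in>perms r. scl (h w) (xTy w))"
proof -
  assume h: "h \<in> Hcarrier r"
  have "Hmult r (Hmult r (xh r la) (\<Sum>w\<in>perms r. scl (h w) (bas w))) (yh r nu) = (\<Sum>w\<in>perms r. scl (h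
      w) (xTy w))"
    by (simp add: Hmult_sum Hmult_lin xTy_def)
  then show ?thesis unfolding H_expand[OF h, symmetric] .
qed

text \<open>By \<open>asc\<close> every inversion of w compares two letters in strict order, so
  along a reduced word each generator meets two strictly ascending neighbours and merely swaps
  them.\<close>

lemma bvec_VT:
  assumes l: "length l = r" and w: "w \<in> perms r"
    and asc: "\<And>i k. i < k \<Longrightarrow> k < r \<Longrightarrow> w k < w i \<Longrightarrow> l ! w k < l ! w i"
  shows "VT r w (bvec l) = bvec (permute_list w l)"
  using w asc
proof (induction rule: slen_induct)
  case id
  have "VT r id (bvec l) = bvec l" using l by (simp add: VT_eq)
  then show ?case by (metis permute_list_id)
next
  case (desc w j)
  let ?w = "w \<circ> sgen j"
  let ?m = "permute_list ?w l"
  have w': "?w \<in> perms r" using desc by simp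
  have "VT r ?w (bvec l) = bvec ?m"
  proof (rule desc.IH)
    fix i k assume ik: "i < k" "k < r" "?w k < ?w i"
    have "(i, k) \<noteq> (j, Suc j)" using ik desc.hyps by (auto simp: o_apply)
    then have "sgen j i < sgen j k" "sgen j k < r" using ik desc.hyps by (auto simp: sgen_apply)
    then show "l ! ?w k < l ! ?w i" using desc.prems[of "sgen j i" "sgen j k"] ik by (simp add: o_apply)
  qed
  moreover have "bas w = Rgen j (bas ?w)" using desc.hyps by (simp add: Rgen_bas o_apply)
  ultimately have "VT r w (bvec l) = Vgen j (bvec ?m)"
    using l w' desc.hyps by (simp add: VT_eq Vact_Rgen)
  also have "\<dots> = bvec (swapl j ?m)"
  proof
    fix k
    have m: "length ?m = r" "?m ! j < ?m ! Suc j"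
      using l desc.hyps desc.prems[of j "Suc j"] by (auto simp: permute_list_def o_apply)
    then have ne: "swapl j ?m \<noteq> ?m" using swapl_nth[of j ?m j] desc.hyps by auto
    show "Vgen j (bvec ?m) k = bvec (swapl j ?m) k"
    proof (cases "length k = r")
      case True
      have "swapl j k = ?m \<longleftrightarrow> k = swapl j ?m" using True m desc.hyps by (metis swapl_swapl)
      then show ?thesis using True m ne desc.hyps by (auto simp: Vgen_def bvec_def swapl_nth)
    next
      case False
      then have "k \<noteq> ?m" "swapl j k \<noteq> ?m" "k \<noteq> swapl j ?m" using m by (metis length_swapl)+
      then show ?thesis by (simp add: Vgen_def bvec_def)
    qed
  qed
  also have "swapl j ?m = permute_list (?w \<circ> sgen j) l"
    using permute_list_swapl[of j l ?w] l w' desc.hyps by simp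
  finally show ?case by simp
qed

text \<open>Tested in the tensor space: omega_la T_w is the single word m = f o w, and m T_b is
  again a single word for b in the Young subgroup of nu. The letters of m are distinct within each
  block of g, so m itself returns only for b = \<open>id\<close> and has coefficient 1 in m
  y.\<close>

lemma xTy_nonzero:
  assumes w: "w \<in> perms r" and bm: "blockmono r f g w" and inj: "pairinj r f g w"
  shows "xTy w \<noteq> 0"
proof
  assume z: "xTy w = 0"
  define m where "m = permute_list w f"
  have lf: "length f = r" using omega_list_props[OF la] by simp
  have lm: "length m = r" and nth: "\<And>i. i < r \<Longrightarrow> m ! i = f ! w i" using lf by (auto simp: m_def
      permute_list_def)
  have inv_eq: "i < k" if "w i < w k" "f ! w i = f ! w k" "i < r" "k < r" for i k
    using blockmono_left[OF bm that(1)] that perms_lt[OF w] perms_inv_apply(2)[OF w] by simp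
  have "VT r w (omega la) = bvec m"
    unfolding omega_def m_def
  proof (rule bvec_VT[OF lf w])
    fix i k assume ik: "i < k" "k < r" "w k < w i"
    have "f ! w k \<le> f ! w i" using sorted_f[of "w k" "w i"] ik perms_lt[OF w] by simp
    moreover have "f ! w k \<noteq> f ! w i" using inv_eq[of k i] ik by auto
    ultimately show "f ! w k < f ! w i" by simp
  qed
  then have "Vact r (bvec m) (yh r nu) = Vact r (omega la) (Hmult r (bas w) (yh r nu))"
    using w la by (simp add: VT_eq Vact_Vact[symmetric])
  also have "\<dots> = 0"
  proof (rule wembed_inj[of _ r])
    fix k :: "int list" assume k: "length k = r" "sorted k"
    show "wembed r k (Vact r (omega la) (Hmult r (bas w) (yh r nu))) = wembed r k 0"
    proof (cases "k = f")
      case True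
      then show ?thesis using z k w
        by (simp add: wembed_Vact wembed_omega[OF la] wembed_lin xTy_def Hmult_assoc)
    next
      case False
      then show ?thesis using k w by (simp add: wembed_Vact wembed_omega[OF la] wembed_lin)
    qed
  qed (use la in auto)
  finally have "Vact r (bvec m) (yh r nu) m = 0" by (simp add: zero_fun_apply)
  moreover have "yh r nu b * VT r b (bvec m) m = (if b = id then 1 else 0)" if b: "b \<in> perms r" for b
  proof (cases "b \<in> young r nu")
    case True
    have gb: "g ! b i = g ! i" if "i < r" for i using young_nth[OF True that] .
    have "VT r b (bvec m) = bvec (permute_list b m)"
    proof (rule bvec_VT[OF lm b])
      fix i k assume ik: "i < k" "k < r" "b k < b i"
      have bl: "b i < r" "b k < r" using ik perms_lt[OF b] by auto
      have "g ! b k = g ! b i" using sorted_g[of i k] sorted_g[of "b k" "b i"] gb[of i] gb[of k] ik bl by simp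
      then have "w (b k) < w (b i)" "f ! w (b k) \<noteq> f ! w (b i)"
        using blockmono_right[OF bm ik(3) bl(1)] pairinjD[OF inj bl(2,1)] ik by auto
      moreover have "f ! w (b k) \<le> f ! w (b i)"
        using sorted_f[of "w (b k)" "w (b i)"] calculation bl perms_lt[OF w] by simp
      ultimately show "m ! b k < m ! b i" using nth bl by simp
    qed
    moreover have "b = id" if "permute_list b m = m"
    proof
      fix i
      show "b i = id i"
      proof (cases "i < r")
        case True
        then have "m ! b i = m ! i" using that lm by (metis permute_list_eq_iff)
        then show ?thesis using pairinjD[OF inj, of "b i" i] True nth gb perms_lt[OF b] by (simp
            add: id_apply)
      qed (simp add: perms_fix[OF b] id_apply)
    qed
    ultimately show ?thesis using True by (auto simp: bvec_def yh_apply)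
  next
    case False
    moreover have "id \<in> young r nu" by (simp add: young_def id_apply)
    ultimately show ?thesis by (auto simp: yh_apply)
  qed
  then have "Vact r (bvec m) (yh r nu) m = 1"
    by (simp add: Vact_eq sum_fun_apply scl_apply)
  ultimately show False by simp
qed

text \<open>w is the standardization of its word: w j counts the positions whose letter is smaller,
  or equal and further left.\<close>

lemma blockmono_determined:
  assumes w: "w \<in> perms r" "blockmono r f g w" and u: "u \<in> perms r" "blockmono r f g u"
    and eq: "\<And>i. i < r \<Longrightarrow> f ! w i = f ! u i"
  shows "w = u"
proof
  fix j
  have *: "w j = card {i. i < r \<and> (f ! w i < f ! w j \<or> f ! w i = f ! w j \<and> i < j)}"
    if w: "w \<in> perms r" "blockmono r f g w" and j: "j < r" for w
  proof -
    have iff: "w i < w j \<longleftrightarrow> f ! w i < f ! w j \<or> f ! w i = f ! w j \<and> i < j" if i: "i < r" for i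
    proof -
      have lt: "w i < r" "w j < r" using perms_lt[OF w(1)] i j by auto
      have "w i < w j \<Longrightarrow> f ! w i = f ! w j \<Longrightarrow> i < j" "w j < w i \<Longrightarrow> f ! w j = f ! w i \<Longrightarrow> j < i"
        using blockmono_left[OF w(2)] lt perms_inv_apply(2)[OF w(1)] by (metis)+
      then show ?thesis using sorted_f[of "w i" "w j"] sorted_f[of "w j" "w i"] lt perms_eq_iff[OF
          w(1), of i j]
        by (cases "w i" "w j" rule: linorder_cases) auto
    qed
    have "w ` {i. i < r \<and> w i < w j} = {..<w j}"
    proof (intro set_eqI iffI)
      fix p assume p: "p \<in> {..<w j}"
      then have "inv w p < r" using perms_lt[OF perms_inv[OF w(1)], of p] perms_lt[OF w(1), of j] j by auto
      then show "p \<in> w ` {i. i < r \<and> w i < w j}"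
        using p perms_inv_apply(1)[OF w(1), of p] by (intro image_eqI[of _ _ "inv w p"]) auto
    qed auto
    moreover have "inj_on w {i. i < r \<and> w i < w j}" using perms_eq_iff[OF w(1)] by (auto simp: inj_on_def)
    ultimately have "w j = card {i. i < r \<and> w i < w j}" by (metis card_image card_lessThan)
    also have "{i. i < r \<and> w i < w j} = {i. i < r \<and> (f ! w i < f ! w j \<or> f ! w i = f ! w j \<and> i < j)}"
      using iff by auto
    finally show ?thesis .
  qed
  show "w j = u j"
  proof (cases "j < r")
    case True
    have "{i. i < r \<and> (f ! w i < f ! w j \<or> f ! w i = f ! w j \<and> i < j)}
        = {i. i < r \<and> (f ! u i < f ! u j \<or> f ! u i = f ! u j \<and> i < j)}"
      using eq True by auto
    then show ?thesis using *[OF w True] *[OF u True] by simp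
  qed (simp add: perms_fix[OF w(1)] perms_fix[OF u(1)])
qed

end

hide_const (open) f g

section \<open>Young diagrams\<close>

lemma ex_bij_betw_fibers:
  assumes "finite A" "finite B" and eq: "\<And>k. card {a \<in> A. \<phi> a = k} = card {b \<in> B. \<psi> b = k}"
  shows "\<exists>h. bij_betw h A B \<and> (\<forall>a\<in>A. \<psi> (h a) = \<phi> a)"
proof -
  have "\<forall>k. \<exists>h. bij_betw h {a \<in> A. \<phi> a = k} {b \<in> B. \<psi> b = k}"
    using assms by (intro allI finite_same_card_bij) auto
  then obtain H where H: "\<And>k. bij_betw (H k) {a \<in> A. \<phi> a = k} {b \<in> B. \<psi> b = k}" by metis
  have im: "H (\<phi> a) a \<in> B" "\<psi> (H (\<phi> a) a) = \<phi> a" if "a \<in> A" for a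
    using bij_betwE[OF H[of "\<phi> a"]] that by auto
  have "inj_on (\<lambda>a. H (\<phi> a) a) A"
  proof (rule inj_onI)
    fix a b assume ab: "a \<in> A" "b \<in> A" "H (\<phi> a) a = H (\<phi> b) b"
    then have "\<phi> a = \<phi> b" using im(2) by metis
    then show "a = b" using ab bij_betw_imp_inj_on[OF H[of "\<phi> a"]] by (auto simp: inj_on_def)
  qed
  moreover have "(\<lambda>a. H (\<phi> a) a) ` A = B"
  proof (intro set_eqI iffI)
    fix b assume "b \<in> B"
    then have "b \<in> H (\<psi> b) ` {a \<in> A. \<phi> a = \<psi> b}" using bij_betw_imp_surj_on[OF H[of "\<psi> b"]] by auto
    then obtain a where "a \<in> A" "\<phi> a = \<psi> b" "b = H (\<psi> b) a" by blast
    then show "b \<in> (\<lambda>a. H (\<phi> a) a) ` A" by (intro image_eqI[of _ _ a]) simp_all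
  qed (use im in auto)
  ultimately show ?thesis using im by (intro exI[of _ "\<lambda>a. H (\<phi> a) a"]) (auto simp: bij_betw_def)
qed

lemma count_list_card: "count_list xs k = card {i. i < length xs \<and> xs ! i = k}"
  by (simp add: count_list_eq_length_filter length_filter_conv_card eq_commute)

lemma card_word: "la \<in> comps r \<Longrightarrow> card {p. p < r \<and> omega_list la ! p = k} = la k"
  using count_list_card[of "omega_list la" k] omega_list_props[of la r] by simp

text \<open>Cells are pairs of row and column. Rows may carry any integer index, as for general
  compositions, while columns are numbered from 1 as in \<open>conjp\<close>.\<close>

definition diagram :: "(int \<Rightarrow> nat) \<Rightarrow> (int \<times> int) set" where
  "diagram la = {(i, c). 1 \<le> c \<and> c \<le> int (la i)}"

lemma diagram_Sigma: "diagram la = (SIGMA i:{i. la i \<noteq> 0}. {1..int (la i)})"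
  by (auto simp: diagram_def)

lemma finite_diagram: "la \<in> comps r \<Longrightarrow> finite (diagram la)"
  by (auto simp: diagram_Sigma comps_def)

lemma card_diagram: "la \<in> comps r \<Longrightarrow> card (diagram la) = r"
  by (simp add: diagram_Sigma comps_def)

lemma card_diagram_row: "card {d \<in> diagram la. fst d = i} = la i"
proof -
  have "{d \<in> diagram la. fst d = i} = {i} \<times> {1..int (la i)}" by (auto simp: diagram_def)
  then show ?thesis by simp
qed

lemma conjp_card: "1 \<le> c \<Longrightarrow> conjp la c = card {i. c \<le> int (la i)}"
  by (simp add: conjp_def nat_le_iff)

lemma card_diagram_col: "card {d \<in> diagram la. snd d = c} = conjp la c"
proof (cases "1 \<le> c")
  case True
  then have "{d \<in> diagram la. snd d = c} = {i. c \<le> int (la i)} \<times> {c}" by (auto simp: diagram_def)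
  then show ?thesis using True by (simp add: conjp_card card_cartesian_product)
next
  case False
  then have "{d \<in> diagram la. snd d = c} = {}" by (auto simp: diagram_def)
  then show ?thesis using False by (simp only: card.empty conjp_def if_False)
qed

lemma conjp_comps:
  assumes "la \<in> comps r" shows "conjp la \<in> comps r"
proof -
  note fin = finite_diagram[OF assms]
  have supp: "{c. conjp la c \<noteq> 0} = snd ` diagram la"
    using fin by (auto simp: card_diagram_col[symmetric] card_gt_0_iff intro: rev_image_eqI)
  have "r = (\<Sum>d\<in>diagram la. 1)" using card_diagram[OF assms] by (simp add: id_apply)
  also have "\<dots> = (\<Sum>c\<in>snd ` diagram la. \<Sum>d\<in>{d \<in> diagram la. snd d = c}. 1)"
    by (rule sum.image_gen[OF fin])
  also have "\<dots> = (\<Sum>c\<in>{c. conjp la c \<noteq> 0}. conjp la c)"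
    unfolding supp card_eq_sum[symmetric] card_diagram_col ..
  finally have "r = (\<Sum>c\<in>{c. conjp la c \<noteq> 0}. conjp la c)" .
  moreover have "finite {c. conjp la c \<noteq> 0}" unfolding supp using fin by simp
  ultimately show ?thesis by (simp add: comps_def)
qed

text \<open>Labels the positions of the word by cells so that letters become rows; together with its
  column counterpart it translates permutations into matchings of cells.\<close>

lemma word_diagram_row:
  assumes "la \<in> comps r"
  shows "\<exists>h. bij_betw h {..<r} (diagram la) \<and> (\<forall>p<r. fst (h p) = omega_list la ! p)"
proof -
  have "card {p \<in> {..<r}. omega_list la ! p = k} = card {d \<in> diagram la. fst d = k}" for k
    using card_word[OF assms] card_diagram_row by simp
  then show ?thesis using ex_bij_betw_fibers[of "{..<r}" "diagram la" "\<lambda>p. omega_list la ! p" fst]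
      finite_diagram[OF assms]
    by auto
qed

lemma word_diagram_col:
  assumes "la \<in> comps r"
  shows "\<exists>h. bij_betw h {..<r} (diagram la) \<and> (\<forall>p<r. snd (h p) = omega_list (conjp la) ! p)"
proof -
  have "card {p \<in> {..<r}. omega_list (conjp la) ! p = k} = card {d \<in> diagram la. snd d = k}" for k
    using card_word[OF conjp_comps[OF assms]] card_diagram_col by simp
  then show ?thesis
    using ex_bij_betw_fibers[of "{..<r}" "diagram la" "\<lambda>p. omega_list (conjp la) ! p" snd]
        finite_diagram[OF assms]
    by auto
qed

section \<open>Partitions and partial sums\<close>

lemma partitions_comps: "la \<in> partitions r \<Longrightarrow> la \<in> comps r"
  by (simp add: partitions_def)

lemma partitions_antimono:
  assumes "la \<in> partitions r" "1 \<le> i" "i \<le> j" shows "la j \<le> la i"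
  using assms(3)
proof (induction j rule: int_ge_induct)
  case (step j)
  then have "la (j + 1) \<le> la j" using assms by (auto simp: partitions_def)
  then show ?case using step by simp
qed simp

lemma partitions_pos: "la \<in> partitions r \<Longrightarrow> la i \<noteq> 0 \<Longrightarrow> 1 \<le> i"
  by (rule ccontr) (auto simp: partitions_def)

lemma int_initial_segment:
  assumes "finite S" "\<And>i. i \<in> S \<Longrightarrow> 1 \<le> i" "\<And>i j. j \<in> S \<Longrightarrow> 1 \<le> i \<Longrightarrow> i \<le> j \<Longrightarrow> i \<in> S"
  shows "S = {1..int (card S)}"
proof (cases "S = {}")
  case False
  note m = Max_in[OF assms(1) False]
  have "i \<in> S \<longleftrightarrow> i \<in> {1..Max S}" for i
    using assms(2)[of i] assms(3)[OF m, of i] Max_ge[OF assms(1), of i] by auto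
  then have "S = {1..Max S}" by blast
  moreover have "1 \<le> Max S" by (rule assms(2)[OF m])
  ultimately obtain m where "S = {1..m}" "1 \<le> m" by blast
  then show ?thesis by simp
qed simp

lemma partition_column:
  assumes la: "la \<in> partitions r" and c: "1 \<le> c"
  shows "{i. c \<le> int (la i)} = {1..int (conjp la c)}"
proof -
  have "finite {i. la i \<noteq> 0}" using la by (auto simp: partitions_def comps_def)
  then have "finite {i. c \<le> int (la i)}" by (rule rev_finite_subset) (use c in auto)
  then show ?thesis unfolding conjp_card[OF c]
  proof (rule int_initial_segment)
    show "1 \<le> i" if "i \<in> {i. c \<le> int (la i)}" for i
      using that c partitions_pos[OF la, of i] by auto
    show "i \<in> {i. c \<le> int (la i)}" if "j \<in> {i. c \<le> int (la i)}" "1 \<le> i" "i \<le> j" for i j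
      using that partitions_antimono[OF la, of i j] by simp
  qed
qed

text \<open>The partial sum of la up to k, read off the sorted word; comparing these for all k is
  the dominance order.\<close>

definition rowsum :: "(int \<Rightarrow> nat) \<Rightarrow> nat \<Rightarrow> int \<Rightarrow> nat" where
  "rowsum la r k = card {p. p < r \<and> omega_list la ! p \<le> k}"

definition colpart :: "(int \<Rightarrow> nat) \<Rightarrow> int \<Rightarrow> int \<Rightarrow> nat" where
  "colpart la c k = card {d \<in> diagram la. snd d = c \<and> fst d \<le> k}"

lemma colpart_eq:
  assumes "la \<in> partitions r" "1 \<le> c" shows "colpart la c k = nat (min k (int (conjp la c)))"
proof -
  have "{d \<in> diagram la. snd d = c \<and> fst d \<le> k} = {1..min k (int (conjp la c))} \<times> {c}"
    using partition_column[OF assms] assms(2) by (auto simp: diagram_def set_eq_iff)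
  then show ?thesis by (simp add: colpart_def card_cartesian_product)
qed

lemma sum_colpart:
  assumes la: "la \<in> comps r"
  shows "(\<Sum>c\<in>snd ` diagram la. colpart la c k) = rowsum la r k"
proof -
  obtain h where h: "bij_betw h {..<r} (diagram la)" "\<forall>p<r. fst (h p) = omega_list la ! p"
    using word_diagram_row[OF la] by blast
  have im: "h ` {p. p < r \<and> omega_list la ! p \<le> k} = {d \<in> diagram la. fst d \<le> k}"
  proof (intro set_eqI iffI)
    fix d assume d: "d \<in> {d \<in> diagram la. fst d \<le> k}"
    then obtain p where "p < r" "d = h p" using bij_betw_imp_surj_on[OF h(1)] by blast
    then show "d \<in> h ` {p. p < r \<and> omega_list la ! p \<le> k}" using h(2) d by auto
  qed (use h bij_betwE[OF h(1)] in auto)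
  have "inj_on h {p. p < r \<and> omega_list la ! p \<le> k}"
    using h(1) unfolding bij_betw_def by (auto elim: inj_on_subset)
  then have "rowsum la r k = card {d \<in> diagram la. fst d \<le> k}"
    unfolding rowsum_def im[symmetric] by (rule card_image[symmetric])
  also have "\<dots> = (\<Sum>d\<in>diagram la. if fst d \<le> k then 1 else 0)"
    using finite_diagram[OF la] by (simp add: sum.If_cases Int_def id_apply)
  also have "\<dots> = (\<Sum>c\<in>snd ` diagram la. \<Sum>d\<in>{d \<in> diagram la. snd d = c}. if fst d \<le> k then 1 else 0)"
    by (rule sum.image_gen[OF finite_diagram[OF la]])
  also have "\<dots> = (\<Sum>c\<in>snd ` diagram la. colpart la c k)"
    using finite_diagram[OF la] by (intro sum.cong) (simp_all add: sum.If_cases colpart_def Int_def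
        conj_ac id_apply)
  finally show ?thesis ..
qed

section \<open>0-1 matrices and dominance\<close>

context
  fixes r :: nat and la nu :: "int \<Rightarrow> nat" and w :: perm
  assumes la: "la \<in> partitions r" and nu: "nu \<in> partitions r"
    and w: "w \<in> perms r" and inj: "pairinj r (omega_list la) (omega_list (conjp nu)) w"
begin

abbreviation (input) "ff \<equiv> omega_list la"
abbreviation (input) "gg \<equiv> omega_list (conjp nu)"

lemma gg_diagram: "j < r \<Longrightarrow> gg ! j \<in> snd ` diagram nu"
proof -
  assume j: "j < r"
  obtain h where h: "bij_betw h {..<r} (diagram nu)" "\<forall>p<r. snd (h p) = gg ! p"
    using word_diagram_col[OF partitions_comps[OF nu]] by blast
  show ?thesis using h j bij_betwE[OF h(1)] by (intro image_eqI[of _ _ "h j"]) auto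
qed

lemma ff_pos: "p < r \<Longrightarrow> 1 \<le> ff ! p"
proof -
  assume p: "p < r"
  have "card {q. q < r \<and> ff ! q = ff ! p} \<noteq> 0" using p by (auto simp: card_eq_0_iff)
  then have "la (ff ! p) \<noteq> 0" using card_word[OF partitions_comps[OF la]] by simp
  then show ?thesis by (rule partitions_pos[OF la])
qed

text \<open>The letters f ! w j over one column are distinct and at least 1, so at most k of them
  are \<le> k; nor can there be more than the column has cells.\<close>

lemma column_le: "card {j. j < r \<and> gg ! j = c \<and> ff ! w j \<le> k} \<le> colpart nu c k"
proof (cases "1 \<le> c")
  case True
  let ?J = "{j. j < r \<and> gg ! j = c \<and> ff ! w j \<le> k}"
  have "card ?J \<le> card {j. j < r \<and> gg ! j = c}" by (rule card_mono) auto
  then have 1: "card ?J \<le> conjp nu c" using card_word[OF conjp_comps[OF partitions_comps[OF nu]]] by simp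
  have "card ?J \<le> card {1..k}"
  proof (rule card_inj_on_le[of "\<lambda>j. ff ! w j"])
    show "inj_on (\<lambda>j. ff ! w j) ?J" using pairinjD[OF inj] by (auto simp: inj_on_def)
    show "(\<lambda>j. ff ! w j) ` ?J \<subseteq> {1..k}"
    proof
      fix i assume "i \<in> (\<lambda>j. ff ! w j) ` ?J"
      then obtain j where "j < r" "i = ff ! w j" "i \<le> k" by blast
      then show "i \<in> {1..k}" using ff_pos[of "w j"] perms_lt[OF w, of j] by simp
    qed
  qed simp
  then show ?thesis using 1 by (simp add: colpart_eq[OF nu True])
next
  case False
  have "{j. j < r \<and> gg ! j = c} = {}"
    using card_word[OF conjp_comps[OF partitions_comps[OF nu]], of c] False by (simp add: conjp_def)
  then have "{j. j < r \<and> gg ! j = c \<and> ff ! w j \<le> k} = {}" by auto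
  then show ?thesis by (simp only: card.empty)
qed

lemma sum_column:
  "(\<Sum>c\<in>snd ` diagram nu. card {j. j < r \<and> gg ! j = c \<and> ff ! w j \<le> k}) = rowsum la r k"
proof -
  have im: "w ` {j. j < r \<and> ff ! w j \<le> k} = {p. p < r \<and> ff ! p \<le> k}"
  proof (intro set_eqI iffI)
    fix p assume "p \<in> {p. p < r \<and> ff ! p \<le> k}"
    then show "p \<in> w ` {j. j < r \<and> ff ! w j \<le> k}"
      using perms_lt[OF perms_inv[OF w], of p] perms_inv_apply(1)[OF w, of p]
      by (intro image_eqI[of _ _ "inv w p"]) auto
  qed (use perms_lt[OF w] in auto)
  have "inj_on w {j. j < r \<and> ff ! w j \<le> k}" using perms_eq_iff[OF w] by (auto simp: inj_on_def)
  then have "rowsum la r k = card {j. j < r \<and> ff ! w j \<le> k}"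
    unfolding rowsum_def im[symmetric] by (rule card_image)
  also have "{j. j < r \<and> ff ! w j \<le> k} = (\<Union>c\<in>snd ` diagram nu. {j. j < r \<and> gg ! j = c \<and> ff ! w j \<le> k})"
    using gg_diagram by auto
  also have "card \<dots> = (\<Sum>c\<in>snd ` diagram nu. card {j. j < r \<and> gg ! j = c \<and> ff ! w j \<le> k})"
    using finite_diagram[OF partitions_comps[OF nu]] by (intro card_UN_disjoint) auto
  finally show ?thesis ..
qed

text \<open>One half of the Gale-Ryser theorem: the column bounds are summed, and the columns of nu,
  filled from the top, attain them.\<close>

lemma pairinj_dominance: "rowsum la r k \<le> rowsum nu r k"
  unfolding sum_column[symmetric] sum_colpart[OF partitions_comps[OF nu], symmetric]
  by (rule sum_mono) (rule column_le)

text \<open>For la = nu the column bounds have equal totals on both sides, so each of them is an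
  equality.\<close>

lemma pairinj_columns:
  assumes "la = nu" "1 \<le> c"
  shows "card {j. j < r \<and> gg ! j = c \<and> ff ! w j \<le> k} = nat (min k (int (conjp nu c)))"
proof (cases "c \<in> snd ` diagram nu")
  case True
  have "card {j. j < r \<and> gg ! j = c \<and> ff ! w j \<le> k} = colpart nu c k"
  proof (rule sum_mono_inv[OF _ column_le True])
    show "(\<Sum>c\<in>snd ` diagram nu. card {j. j < r \<and> gg ! j = c \<and> ff ! w j \<le> k}) = (\<Sum>c\<in>snd ` diagram nu.
        colpart nu c k)"
      using sum_column sum_colpart[OF partitions_comps[OF nu]] assms(1) by simp
  qed (use finite_diagram[OF partitions_comps[OF nu]] in auto)
  then show ?thesis using colpart_eq[OF nu assms(2)] by simp
next
  case False
  then have "{d \<in> diagram nu. snd d = c} = {}" by (auto intro: rev_image_eqI)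
  then have "conjp nu c = 0" using card_diagram_col[of nu c] by (simp only: card.empty)
  moreover have "{j. j < r \<and> gg ! j = c \<and> ff ! w j \<le> k} = {}" using False gg_diagram by auto
  ultimately show ?thesis by (simp only: card.empty)
qed

text \<open>The 0-1 matrix with row sums \<open>\<mu>\<close> and column sums \<open>\<mu>\<^sup>t\<close> is unique, so a block-monotone \<open>w\<close>
  runs through each column from top to bottom.\<close>

lemma pairinj_word:
  assumes eq: "la = nu" and bm: "blockmono r ff gg w" and j: "j < r"
  shows "ff ! w j = int (card {i. i < r \<and> gg ! i = gg ! j \<and> i \<le> j})"
proof -
  note laC = partitions_comps[OF la] and nuC = conjp_comps[OF partitions_comps[OF nu]]
  let ?c = "gg ! j"
  have c: "1 \<le> ?c" using gg_diagram[OF j] by (auto simp: diagram_def)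
  have lt: "ff ! w i < ff ! w k" if "i < k" "k < r" "gg ! i = gg ! k" for i k
  proof -
    have "w i < w k" using blockmono_right[OF laC nuC bm that] .
    then have "ff ! w i \<le> ff ! w k" using sorted_f[OF laC nuC, of "w i" "w k"] perms_lt[OF w] that by simp
    moreover have "ff ! w i \<noteq> ff ! w k" using pairinjD[OF inj, of i k] that by auto
    ultimately show ?thesis by simp
  qed
  have "{i. i < r \<and> gg ! i = ?c \<and> ff ! w i \<le> ff ! w j} = {i. i < r \<and> gg ! i = ?c \<and> i \<le> j}"
  proof (intro Collect_cong conj_cong refl)
    fix i assume i: "i < r" "gg ! i = ?c"
    show "ff ! w i \<le> ff ! w j \<longleftrightarrow> i \<le> j"
      using lt[of i j] lt[of j i] i j by (cases i j rule: linorder_cases) auto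
  qed
  then have 1: "card {i. i < r \<and> gg ! i = ?c \<and> i \<le> j} = nat (min (ff ! w j) (int (conjp nu ?c)))"
    using pairinj_columns[OF eq c, of "ff ! w j"] by simp
  \<comment> \<open>With k the length of the column all its letters are counted, so none exceeds
    that length and the minimum above is \<open>ff ! w j\<close>.\<close>
  let ?B = "{i. i < r \<and> gg ! i = ?c}"
  have "card {i. i < r \<and> gg ! i = ?c \<and> ff ! w i \<le> int (conjp nu ?c)} = card ?B"
    using pairinj_columns[OF eq c, of "int (conjp nu ?c)"] card_word[OF nuC] by simp
  then have "{i. i < r \<and> gg ! i = ?c \<and> ff ! w i \<le> int (conjp nu ?c)} = ?B"
    by (intro card_subset_eq) auto
  then have "ff ! w j \<le> int (conjp nu ?c)" using j by blast
  moreover have "1 \<le> ff ! w j" using ff_pos perms_lt[OF w] j by simp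
  ultimately show ?thesis using 1 by simp
qed

end

hide_const (open) ff gg

text \<open>Dominance both ways makes all partial sums equal, and a part is the difference of two
  consecutive ones.\<close>

lemma pairinj_antisym:
  assumes "la \<in> partitions r" "nu \<in> partitions r"
    and "w \<in> perms r" "pairinj r (omega_list la) (omega_list (conjp nu)) w"
    and "u \<in> perms r" "pairinj r (omega_list nu) (omega_list (conjp la)) u"
  shows "la = nu"
proof
  fix k
  have eq: "rowsum la r k = rowsum nu r k" for k
    using pairinj_dominance[of la r nu w k] pairinj_dominance[of nu r la u k] assms by simp
  have "mu k + rowsum mu r (k - 1) = rowsum mu r k" if "mu \<in> partitions r" for mu
  proof -
    have "{p. p < r \<and> omega_list mu ! p \<le> k} = {p. p < r \<and> omega_list mu ! p = k} \<union> {p. p < r \<and>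
        omega_list mu ! p \<le> k - 1}"
      by auto
    then have "rowsum mu r k = card {p. p < r \<and> omega_list mu ! p = k} + rowsum mu r (k - 1)"
      unfolding rowsum_def by (simp add: card_Un_disjoint disjoint_iff)
    then show ?thesis using card_word[OF partitions_comps[OF that]] by simp
  qed
  then show "la k = nu k" using eq assms(1,2) by (metis add_right_cancel)
qed

section \<open>The permutation w_mu\<close>

context
  fixes r :: nat and mu :: "int \<Rightarrow> nat"
  assumes mu: "mu \<in> partitions r"
begin

abbreviation (input) "fm \<equiv> omega_list mu"
abbreviation (input) "gm \<equiv> omega_list (conjp mu)"

lemma blockmono_pairinj_unique:
  assumes "w \<in> perms r" "blockmono r fm gm w" "pairinj r fm gm w"
    "u \<in> perms r" "blockmono r fm gm u" "pairinj r fm gm u"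
  shows "w = u"
  using assms pairinj_word[OF mu mu _ _ refl] mu
  by (intro blockmono_determined[of mu r "conjp mu"]) (auto simp: partitions_comps conjp_comps)

text \<open>Number the cells once along rows and once along columns: w sends the position of a cell
  in the second numbering to its position in the first, so the pair of letters at j is the cell
  itself.\<close>

lemma pairinj_exists: "\<exists>w\<in>perms r. pairinj r fm gm w"
proof -
  obtain a where a: "bij_betw a {..<r} (diagram mu)" "\<forall>p<r. fst (a p) = fm ! p"
    using word_diagram_row[OF partitions_comps[OF mu]] by blast
  obtain b where b: "bij_betw b {..<r} (diagram mu)" "\<forall>p<r. snd (b p) = gm ! p"
    using word_diagram_col[OF partitions_comps[OF mu]] by blast
  define c where "c = inv_into {..<r} a"
  have c: "bij_betw (c \<circ> b) {..<r} {..<r}"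
    using bij_betw_trans[OF b(1) bij_betw_inv_into[OF a(1)]] by (simp add: c_def)
  define w where "w = (\<lambda>j. if j < r then (c \<circ> b) j else j)"
  have "bij_betw w {..<r} {..<r}" using c by (subst bij_betw_cong[of _ _ "c \<circ> b"]) (auto simp: w_def)
  then have wp: "w \<in> perms r"
    unfolding perms_lessThan by (intro CollectI bij_imp_permutes) (auto simp: w_def)
  have "(fm ! w j, gm ! j) = b j" if j: "j < r" for j
  proof -
    have bj: "b j \<in> diagram mu" using bij_betwE[OF b(1)] j by auto
    have wj: "w j < r" using perms_lt[OF wp] j by simp
    have "a (w j) = b j" using bj j by (simp add: w_def c_def o_apply bij_betw_inv_into_right[OF a(1)])
    then have "fm ! w j = fst (b j)" using a(2) wj by metis
    then show ?thesis using b(2) j by (simp add: prod_eq_iff)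
  qed
  then have "inj_on (\<lambda>j. (fm ! w j, gm ! j)) {..<r}"
    using bij_betw_imp_inj_on[OF b(1)] by (subst inj_on_cong[of _ _ b]) auto
  then show ?thesis using wp by (auto simp: pairinj_def)
qed

lemma not_desc_blockmono:
  assumes w: "w \<in> perms r"
    and 1: "\<And>j. Suc j < r \<Longrightarrow> gm ! j = gm ! Suc j \<Longrightarrow> slen r w \<le> slen r (w \<circ> sgen j)"
    and 2: "\<And>j. Suc j < r \<Longrightarrow> fm ! j = fm ! Suc j \<Longrightarrow> slen r w \<le> slen r (sgen j \<circ> w)"
  shows "blockmono r fm gm w"
  unfolding blockmono_def
proof (intro conjI allI impI)
  fix j assume j: "Suc j < r"
  show "w j < w (Suc j)" if "gm ! j = gm ! Suc j"
    using 1[OF j that] slen_desc_iff[OF w j] perms_eq_iff[OF w, of j "Suc j"] by simp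
  show "inv w j < inv w (Suc j)" if "fm ! j = fm ! Suc j"
    using 2[OF j that] slen_left_iff[OF w j] perms_eq_iff[OF perms_inv[OF w], of j "Suc j"] by simp
qed

lemma pairinj_young:
  assumes "w \<in> perms r" "pairinj r fm gm w" "a \<in> young r mu" "b \<in> young r (conjp mu)"
  shows "pairinj r fm gm (a \<circ> w \<circ> b)"
  using pairinj_conj[OF assms(2,1) young_perms[OF assms(4)]] young_nth[OF assms(3)] young_nth[OF
      assms(4)] by blast

text \<open>Minimality in the double coset yields \<open>blockmono\<close>, trivial intersection
  yields \<open>pairinj\<close>, and at most one permutation has both. Existence comes from a
  shortest permutation satisfying \<open>pairinj\<close>.\<close>

lemma wlam_props: "wlam r mu \<in> perms r" "blockmono r fm gm (wlam r mu)" "pairinj r fm gm (wlam r mu)"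
proof -
  let ?P = "\<lambda>w. distinguished r (young r mu) (young r (conjp mu)) w \<and>
      (\<forall>u\<in>young r mu. inv w \<circ> u \<circ> w \<in> young r (conjp mu) \<longrightarrow> inv w \<circ> u \<circ> w = id)"
  have idy: "id \<in> young r la" for la by (simp add: young_def id_apply)
  have admissible: "w \<in> perms r \<and> blockmono r fm gm w \<and> pairinj r fm gm w" if P: "?P w" for w
  proof -
    have w: "w \<in> perms r" using P by (simp add: distinguished_def)
    have min: "slen r w \<le> slen r (a \<circ> w \<circ> b)" if "a \<in> young r mu" "b \<in> young r (conjp mu)" for a b
      using P that by (simp add: distinguished_def)
    have bm: "blockmono r fm gm w"
    proof (rule not_desc_blockmono[OF w])
      fix j assume j: "Suc j < r"
      show "slen r w \<le> slen r (w \<circ> sgen j)" if "gm ! j = gm ! Suc j"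
        using min[OF idy young_sgen[OF j that]] by simp
      show "slen r w \<le> slen r (sgen j \<circ> w)" if "fm ! j = fm ! Suc j"
        using min[OF young_sgen[OF j that] idy] by simp
    qed
    have "pairinj r fm gm w"
    proof (rule ccontr)
      assume "\<not> pairinj r fm gm w"
      then obtain i j where ij: "i < r" "j < r" "i \<noteq> j" "fm ! w i = fm ! w j" "gm ! i = gm ! j"
        by (auto simp: pairinj_def inj_on_def)
      \<comment> \<open>Exchanging two positions with the same pair of letters is a transposition in
        the column subgroup whose conjugate u lies in the row subgroup, against the trivial
        intersection.\<close>
      define t where "t = transpose i j"
      define u where "u = w \<circ> t \<circ> inv w"
      have t: "t \<in> perms r" using ij by (simp add: t_def perms_def permutes_swap_id)
      have ti: "t a = (if a = i then j else if a = j then i else a)" for a by (auto simp: t_def transpose_def)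
      have ty: "t \<in> young r (conjp mu)" using t ij by (auto simp: young_def ti)
      have "fm ! u a = fm ! a" if a: "a < r" for a
        using ij perms_inv_apply(1)[OF w, of a] by (auto simp: u_def o_apply ti)
      then have uy: "u \<in> young r mu" using t w by (simp add: young_def u_def)
      have "inv w \<circ> u \<circ> w = t"
        by (rule ext) (simp add: u_def o_apply perms_inv_apply[OF w])
      then have "t = id" using P uy ty by metis
      then have "t i = i" by (simp add: id_apply)
      then show False using ij by (simp add: ti)
    qed
    then show ?thesis using w bm by blast
  qed
  \<comment> \<open>Minimality is imposed among all permutations with \<open>pairinj\<close>; that
    property is constant on double cosets, so w is in particular distinguished.\<close>
  obtain w where w: "w \<in> perms r" "pairinj r fm gm w"
    and min: "\<And>u. u \<in> perms r \<Longrightarrow> pairinj r fm gm u \<Longrightarrow> slen r w \<le> slen r u"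
    using ex_has_least_nat[of "\<lambda>w. w \<in> perms r \<and> pairinj r fm gm w" _ "slen r"] pairinj_exists by blast
  have "inv w \<circ> u \<circ> w = id" if u: "u \<in> young r mu" and t: "inv w \<circ> u \<circ> w \<in> young r (conjp mu)" for u
  proof
    fix j
    let ?t = "inv w \<circ> u \<circ> w"
    have tp: "?t \<in> perms r" using t by (rule young_perms)
    show "?t j = id j"
    proof (cases "j < r")
      case True
      have "fm ! w (?t j) = fm ! w j"
        using young_nth[OF u, of "w j"] perms_lt[OF w(1)] True by (simp add: o_apply perms_inv_apply[OF w(1)])
      then show ?thesis using pairinjD[OF w(2), of "?t j" j] young_nth[OF t True] perms_lt[OF tp] True
        by (simp add: id_apply)
    qed (simp add: perms_fix[OF tp] id_apply)
  qed
  moreover have "distinguished r (young r mu) (young r (conjp mu)) w"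
    unfolding distinguished_def using w min pairinj_young young_perms by (auto intro!: min)
  ultimately have "?P w" by blast
  moreover have "u = w" if "?P u" for u
    using admissible[OF that] admissible[OF \<open>?P w\<close>] blockmono_pairinj_unique by blast
  ultimately have "?P (wlam r mu)" unfolding wlam_def by (intro theI[of ?P w])
  then show "wlam r mu \<in> perms r" "blockmono r fm gm (wlam r mu)" "pairinj r fm gm (wlam r mu)"
    using admissible by blast+
qed

end

hide_const (open) fm gm

section \<open>Primitive idempotents\<close>

definition specht_gen :: "nat \<Rightarrow> (int \<Rightarrow> nat) \<Rightarrow> hecke" where
  "specht_gen r mu = Hmult r (Hmult r (xh r mu) (Tw r (wlam r mu))) (yh r (conjp mu))"

definition specht_norm :: "nat \<Rightarrow> (int \<Rightarrow> nat) \<Rightarrow> K" where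
  "specht_norm r mu = (SOME c. c \<noteq> 0 \<and> Hmult r (Hmult r (specht_gen r mu) (hstar r (specht_gen r
      mu))) (specht_gen r mu) = scl c (specht_gen r mu))"

definition pidem :: "nat \<Rightarrow> (int \<Rightarrow> nat) \<Rightarrow> hecke" where
  "pidem r mu = scl (inverse (specht_norm r mu)) (Hmult r (hstar r (specht_gen r mu)) (specht_gen r mu))"

text \<open>The scalar c in e h e = c e, where e is \<open>pidem r mu\<close>
  (\<open>pidem_sandwich\<close>): the coefficient at \<open>id\<close>, which is a trace, taken on
  both sides gives this quotient.\<close>

definition pcoeff :: "nat \<Rightarrow> (int \<Rightarrow> nat) \<Rightarrow> hecke \<Rightarrow> K" where
  "pcoeff r mu h = Hmult r h (pidem r mu) id / pidem r mu id"

definition casimir :: "nat \<Rightarrow> hecke \<Rightarrow> hecke" where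
  "casimir r h = (\<Sum>w\<in>perms r. Hmult r (Hmult r (bas (inv w)) h) (bas w))"

text \<open>The constant makes the element idempotent: e times the Casimir element is this sum of
  squares times e (\<open>pidem_casimir\<close>), and the sum is positive since its term for
  \<open>id\<close> is 1.\<close>

definition cidem :: "nat \<Rightarrow> (int \<Rightarrow> nat) \<Rightarrow> hecke" where
  "cidem r mu = scl (inverse (\<Sum>w\<in>perms r. pcoeff r mu (bas w) * pcoeff r mu (bas w))) (casimir r
      (pidem r mu))"

definition central :: "nat \<Rightarrow> hecke \<Rightarrow> bool" where
  "central r z \<longleftrightarrow> z \<in> Hcarrier r \<and> (\<forall>j. Suc j < r \<longrightarrow> Rgen j z = Hgen r j z)"

context fixes r :: nat begin

lemma Tw_Hc [simp]: "w \<in> perms r \<Longrightarrow> Tw r w \<in> Hcarrier r"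
  by (simp add: Tw_bas)

lemma central_commute:
  assumes z: "central r z" and h: "h \<in> Hcarrier r" shows "Hmult r z h = Hmult r h z"
proof -
  have zH: "z \<in> Hcarrier r" and zj: "Suc j < r \<Longrightarrow> Rgen j z = Hgen r j z" for j
    using z by (auto simp: central_def)
  show ?thesis using h
  proof (induction rule: H_induct)
    case (gen j h)
    have "Hmult r z (Rgen j h) = Rgen j (Hmult r h z)" using gen by (simp add: Hmult_Rgen)
    also have "\<dots> = Hmult r h (Rgen j z)" using gen zH by (simp add: Hmult_Rgen)
    also have "\<dots> = Hmult r h (Hmult r (bas (sgen j)) z)" using gen zH zj by (simp add: Hgen_Hmult)
    also have "\<dots> = Hmult r (Rgen j h) z" using gen zH by (simp add: Rgen_Hmult[of h r] Hmult_assoc)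
    finally show ?case .
  qed (use zH in \<open>simp_all add: Hmult_lin\<close>)
qed

lemma casimir_Hc [simp]: "casimir r h \<in> Hcarrier r"
  by (simp add: casimir_def)

text \<open>A generator on the right turns w into w s_j in the right factor, one on the left does so
  in the left factor; the extra terms at descents are the same, and \<open>casimir_right\<close>
  equates the rest.\<close>

lemma casimir_central:
  assumes h: "h \<in> Hcarrier r" shows "central r (casimir r h)"
  unfolding central_def
proof (intro conjI allI impI)
  fix j assume j: "Suc j < r"
  let ?G = "\<lambda>u w. Hmult r (Hmult r (bas (inv u)) h) (bas w)"
  let ?D = "\<lambda>w. if w (Suc j) < w j then scl vdiff (?G w w) else 0"
  have 1: "Rgen j (?G w w) = ?G w (w \<circ> sgen j) + ?D w" if w: "w \<in> perms r" for w
    using Hmult_Rgen[of "bas w" r j "Hmult r (bas (inv w)) h"] w j by (auto simp: Rgen_bas Hmult_lin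
        split: if_splits)
  have 2: "Hgen r j (?G w w) = ?G (w \<circ> sgen j) w + ?D w" if w: "w \<in> perms r" for w
  proof -
    have "inv (w \<circ> sgen j) = sgen j \<circ> inv w" using perms_inv_comp[OF w perms_sgen[OF j]] by simp
    moreover have "Hgen r j (?G w w) = Hmult r (Hmult r (Hgen r j (bas (inv w))) h) (bas w)"
      using w j h by (simp add: Hgen_Hmult Hmult_assoc)
    ultimately show ?thesis using w j by (auto simp: Hgen_bas Hmult_lin)
  qed
  show "Rgen j (casimir r h) = Hgen r j (casimir r h)"
    unfolding casimir_def Rgen_lin Hgen_lin using 1 2 casimir_right[OF j, of ?G] by (simp add: sum.distrib)
qed simp

section \<open>Idempotents of a single partition\<close>

context
  fixes mu :: "int \<Rightarrow> nat"
  assumes mu: "mu \<in> partitions r"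
begin

lemma specht_gen_Hc [simp]: "specht_gen r mu \<in> Hcarrier r" by (simp add: specht_gen_def)

text \<open>Reduction ends at a block-monotone u. Either \<open>pairinj\<close> fails and the
  product is zero, or it holds and u is the single such permutation
  \<open>wlam r mu\<close>.\<close>

lemma xTy_multiple:
  assumes w: "w \<in> perms r"
  shows "\<exists>c. xTy r mu (conjp mu) w = scl c (specht_gen r mu)"
proof -
  note C = partitions_comps[OF mu] conjp_comps[OF partitions_comps[OF mu]]
  let ?w = "wlam r mu"
  have specht_gen: "specht_gen r mu = scl (vv ^ slen r ?w) (xTy r mu (conjp mu) ?w)"
    by (simp add: specht_gen_def xTy_def[OF C] Tw_bas Hmult_lin)
  then have XYw: "xTy r mu (conjp mu) ?w = scl (inverse (vv ^ slen r ?w)) (specht_gen r mu)" by simp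
  obtain c u where u: "u \<in> perms r" "blockmono r (omega_list mu) (omega_list (conjp mu)) u"
    "xTy r mu (conjp mu) w = scl c (xTy r mu (conjp mu) u)"
    using xTy_reduce[OF C w] by blast
  show ?thesis
  proof (cases "pairinj r (omega_list mu) (omega_list (conjp mu)) u")
    case True
    then have "u = ?w" using blockmono_pairinj_unique[OF mu u(1,2) True wlam_props[OF mu]] by simp
    then show ?thesis using u(3) XYw by auto
  next
    case False
    then have "xTy r mu (conjp mu) w = scl 0 (specht_gen r mu)" using u xTy_noninj[OF C u(1)] by simp
    then show ?thesis by blast
  qed
qed

lemma specht_gen_nonzero: "specht_gen r mu \<noteq> 0"
proof -
  note C = partitions_comps[OF mu] conjp_comps[OF partitions_comps[OF mu]]
  have "xTy r mu (conjp mu) (wlam r mu) = scl (inverse (vv ^ slen r (wlam r mu))) (specht_gen r mu)"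
    by (simp add: specht_gen_def xTy_def[OF C] Tw_bas Hmult_lin)
  then show ?thesis using xTy_nonzero[OF C wlam_props[OF mu]] by auto
qed

lemma xHy_multiple:
  assumes h: "h \<in> Hcarrier r"
  shows "\<exists>c. Hmult r (Hmult r (xh r mu) h) (yh r (conjp mu)) = scl c (specht_gen r mu)"
proof -
  note C = partitions_comps[OF mu] conjp_comps[OF partitions_comps[OF mu]]
  obtain c where c: "\<And>w. w \<in> perms r \<Longrightarrow> xTy r mu (conjp mu) w = scl (c w) (specht_gen r mu)"
    using xTy_multiple by metis
  have "Hmult r (Hmult r (xh r mu) h) (yh r (conjp mu)) = (\<Sum>w\<in>perms r. scl (h w * c w) (specht_gen r mu))"
    unfolding xHy_expand[OF C h] by (intro sum.cong refl) (simp add: c)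
  then show ?thesis unfolding scl_sum_left[symmetric] by blast
qed

text \<open>n h n starts with x_mu and ends with the column symmetrizer y, so it lies in x_mu H y, a
  line spanned by n.\<close>

lemma specht_gen_sandwich:
  assumes h: "h \<in> Hcarrier r" shows "\<exists>c. Hmult r (Hmult r (specht_gen r mu) h) (specht_gen r mu) =
      scl c (specht_gen r mu)"
proof -
  let ?T = "Tw r (wlam r mu)" and ?y = "yh r (conjp mu)"
  have T: "?T \<in> Hcarrier r" using wlam_props[OF mu] by simp
  have "Hmult r (Hmult r (specht_gen r mu) h) (specht_gen r mu)
      = Hmult r (Hmult r (xh r mu) (Hmult r ?T (Hmult r ?y (Hmult r h (Hmult r (xh r mu) ?T))))) ?y"
    using h T by (simp add: specht_gen_def Hmult_assoc)
  then show ?thesis using xHy_multiple[of "Hmult r ?T (Hmult r ?y (Hmult r h (Hmult r (xh r mu)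
      ?T)))"] T by simp
qed

text \<open>Were the scalar zero, positivity would apply twice: with N for \<open>hstar\<close> of
  n, <N n, N n> = <n, n N n> = 0 gives N n = 0, and then <n, n> = <N n, 1> = 0 gives n = 0.\<close>

lemma specht_norm: "specht_norm r mu \<noteq> 0" "Hmult r (Hmult r (specht_gen r mu) (hstar r (specht_gen r
    mu))) (specht_gen r mu) = scl (specht_norm r mu) (specht_gen r mu)"
proof -
  let ?n = "specht_gen r mu" and ?N = "hstar r (specht_gen r mu)"
  obtain c where c: "Hmult r (Hmult r ?n ?N) ?n = scl c ?n" using specht_gen_sandwich[of ?N] by auto
  have "c \<noteq> 0"
  proof
    assume "c = 0"
    then have z: "Hmult r ?n (Hmult r ?N ?n) = 0" using c by (simp add: Hmult_assoc)
    have "hform r (Hmult r ?N ?n) (Hmult r ?N ?n) = hform r ?n (Hmult r ?n (Hmult r ?N ?n))"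
      by (simp add: hform_mult_left)
    then have "hform r (Hmult r ?N ?n) (Hmult r ?N ?n) = 0" by (simp add: z hform_def zero_fun_apply)
    then have Nn: "Hmult r ?N ?n = 0" using hform_pos[of "Hmult r ?N ?n" r] by fastforce
    have "hform r (Hmult r ?N ?n) (bas id) = hform r ?n ?n" by (simp add: hform_mult_left)
    then have "hform r ?n ?n = 0" by (simp add: Nn hform_def zero_fun_apply)
    then show False using hform_pos[OF specht_gen_Hc specht_gen_nonzero] by simp
  qed
  then have "\<exists>c. c \<noteq> 0 \<and> Hmult r (Hmult r ?n ?N) ?n = scl c ?n" using c by blast
  from someI_ex[OF this] show "specht_norm r mu \<noteq> 0" "Hmult r (Hmult r ?n ?N) ?n = scl (specht_norm r mu) ?n"
    by (auto simp: specht_norm_def)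
qed

lemma pidem_Hc [simp]: "pidem r mu \<in> Hcarrier r" by (simp add: pidem_def)

lemma star_pidem [simp]: "hstar r (pidem r mu) = pidem r mu"
  by (simp add: pidem_def star_lin star_Hmult)

lemma specht_gen_pidem [simp]: "Hmult r (specht_gen r mu) (pidem r mu) = specht_gen r mu"
  using specht_norm by (simp add: pidem_def Hmult_lin Hmult_assoc)

lemma pidem_idem [simp]: "Hmult r (pidem r mu) (pidem r mu) = pidem r mu"
  by (subst pidem_def) (simp add: Hmult_lin Hmult_assoc, simp add: pidem_def)

lemma pidem_nonzero: "pidem r mu \<noteq> 0"
  using specht_gen_pidem specht_gen_nonzero by (metis Hmult_0(1))

lemma pidem_id_pos: "pidem r mu id > 0"
  using trace_mult[of "pidem r mu" r "pidem r mu"] hform_pos[OF pidem_Hc pidem_nonzero] by simp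

lemma pidem_sandwich:
  assumes h: "h \<in> Hcarrier r"
  shows "Hmult r (Hmult r (pidem r mu) h) (pidem r mu) = scl (pcoeff r mu h) (pidem r mu)"
proof -
  let ?e = "pidem r mu" and ?n = "specht_gen r mu" and ?N = "hstar r (specht_gen r mu)"
  obtain c where c: "Hmult r (Hmult r ?n (Hmult r h ?N)) ?n = scl c ?n" using specht_gen_sandwich h
      by fastforce
  have "Hmult r (Hmult r ?e h) ?e = scl (inverse (specht_norm r mu) * inverse (specht_norm r mu))
      (Hmult r ?N (Hmult r (Hmult r ?n (Hmult r h ?N)) ?n))"
    using h by (simp add: pidem_def Hmult_lin Hmult_assoc)
  also have "\<dots> = scl (inverse (specht_norm r mu) * c) ?e" unfolding c by (simp add: pidem_def
      Hmult_lin ac_simps)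
  finally have d: "Hmult r (Hmult r ?e h) ?e = scl (inverse (specht_norm r mu) * c) ?e" .
  have "Hmult r (Hmult r ?e h) ?e id = Hmult r ?e (Hmult r h ?e) id" using h by (simp add: Hmult_assoc)
  also have "\<dots> = Hmult r (Hmult r h ?e) ?e id" using h by (intro trace_commute) simp_all
  also have "\<dots> = Hmult r h ?e id" using h by (simp add: Hmult_assoc)
  finally have "inverse (specht_norm r mu) * c = pcoeff r mu h"
    unfolding d pcoeff_def using pidem_id_pos by (simp add: scl_apply eq_divide_eq)
  then show ?thesis using d by simp
qed

lemma pcoeff_star: "h \<in> Hcarrier r \<Longrightarrow> pcoeff r mu (hstar r h) = pcoeff r mu h"
proof -
  assume h: "h \<in> Hcarrier r"
  then show ?thesis using hform_star[of r h "pidem r mu"] by (simp add: trace_mult pcoeff_def)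
qed

lemma pcoeff_one: "pcoeff r mu (bas id) = 1"
  using pidem_id_pos by (simp add: pcoeff_def)

lemma pcoeff_sum_pos: "(\<Sum>w\<in>perms r. pcoeff r mu (bas w) * pcoeff r mu (bas w)) > 0"
  by (rule sum_pos2[of _ id]) (simp_all add: pcoeff_one)

text \<open>Since the Casimir element z is central and e idempotent, e z = e z e, and each summand
  collapses to a product of two sandwich scalars. They agree because \<open>pcoeff\<close> is
  invariant under \<open>hstar\<close>, which makes the total a sum of squares.\<close>

lemma pidem_casimir: "Hmult r (pidem r mu) (casimir r (pidem r mu)) = scl (\<Sum>w\<in>perms r. pcoeff r mu
    (bas w) * pcoeff r mu (bas w)) (pidem r mu)"
proof -
  let ?e = "pidem r mu"
  have k: "pcoeff r mu (bas (inv w)) = pcoeff r mu (bas w)" if "w \<in> perms r" for w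
    using pcoeff_star[of "bas w"] that by (simp add: star_bas)
  have t: "Hmult r (Hmult r ?e (Hmult r (Hmult r (bas (inv w)) ?e) (bas w))) ?e
      = scl (pcoeff r mu (bas w) * pcoeff r mu (bas w)) ?e" if w: "w \<in> perms r" for w
  proof -
    have "Hmult r (Hmult r ?e (Hmult r (Hmult r (bas (inv w)) ?e) (bas w))) ?e
      = Hmult r (Hmult r (Hmult r ?e (bas (inv w))) ?e) (Hmult r (bas w) ?e)"
      using w by (simp add: Hmult_assoc)
    also have "\<dots> = Hmult r (scl (pcoeff r mu (bas w)) ?e) (Hmult r (bas w) ?e)"
      using w by (simp only: pidem_sandwich[OF Hc_basic(5)[OF perms_inv[OF w]]] k)
    also have "\<dots> = scl (pcoeff r mu (bas w)) (Hmult r (Hmult r ?e (bas w)) ?e)"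
      using w by (simp add: Hmult_lin Hmult_assoc)
    finally show ?thesis using w by (simp add: pidem_sandwich)
  qed
  have "Hmult r ?e (casimir r ?e) = Hmult r (Hmult r ?e ?e) (casimir r ?e)" by simp
  also have "\<dots> = Hmult r (Hmult r ?e (casimir r ?e)) ?e"
    using central_commute[OF casimir_central[OF pidem_Hc] pidem_Hc] by (simp add: Hmult_assoc del: pidem_idem)
  also have "\<dots> = (\<Sum>w\<in>perms r. scl (pcoeff r mu (bas w) * pcoeff r mu (bas w)) ?e)"
    unfolding casimir_def Hmult_sum by (intro sum.cong refl t)
  finally show ?thesis by (simp add: scl_sum_left)
qed

lemma cidem_Hc [simp]: "cidem r mu \<in> Hcarrier r" by (simp add: cidem_def)

lemma cidem_central: "central r (cidem r mu)"
  using casimir_central[OF pidem_Hc] by (simp add: cidem_def central_def Rgen_lin Hgen_lin)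

lemma pidem_cidem: "Hmult r (pidem r mu) (cidem r mu) = pidem r mu"
  using pcoeff_sum_pos by (simp add: cidem_def Hmult_lin pidem_casimir)

lemma cidem_nonzero: "cidem r mu \<noteq> 0"
  using pidem_cidem pidem_nonzero by auto

end

text \<open>e_mu h e_nu contains n_mu h times \<open>hstar\<close> of n_nu, hence a factor in x_mu H
  y with y the column symmetrizer of nu, which vanishes unless some w satisfies
  \<open>pairinj\<close>. By \<open>pairinj_antisym\<close> this fails for (mu, nu) or for (nu, mu),
  and \<open>hstar\<close> exchanges the two cases.\<close>

lemma pidem_ortho:
  assumes mu: "mu \<in> partitions r" and nu: "nu \<in> partitions r" and ne: "mu \<noteq> nu" and h: "h \<in> Hcarrier r"
  shows "Hmult r (Hmult r (pidem r mu) h) (pidem r nu) = 0"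
proof -
  have *: "Hmult r (Hmult r (pidem r mu) h) (pidem r nu) = 0"
    if mu: "mu \<in> partitions r" and nu: "nu \<in> partitions r" and h: "h \<in> Hcarrier r"
      and no: "\<not> (\<exists>w\<in>perms r. pairinj r (omega_list mu) (omega_list (conjp nu)) w)" for mu nu h
  proof -
    note C = partitions_comps[OF mu] conjp_comps[OF partitions_comps[OF nu]]
    have z: "Hmult r (Hmult r (xh r mu) k) (yh r (conjp nu)) = 0" if k: "k \<in> Hcarrier r" for k
      unfolding xHy_expand[OF C k] using xTy_noninj[OF C] no by simp
    let ?Tm = "Tw r (wlam r mu)" and ?Tn = "Tw r (wlam r nu)"
    have T: "?Tm \<in> Hcarrier r" "?Tn \<in> Hcarrier r" using wlam_props mu nu by simp_all
    have "Hmult r (specht_gen r mu) (Hmult r h (hstar r (specht_gen r nu))) =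
      Hmult r (Hmult r (Hmult r (xh r mu) (Hmult r ?Tm (Hmult r (yh r (conjp mu)) h))) (yh r (conjp nu)))
        (Hmult r (hstar r ?Tn) (xh r nu))"
      using T h by (simp add: specht_gen_def star_Hmult Hmult_assoc)
    also have "\<dots> = 0" using T h by (simp add: z)
    finally have 0: "Hmult r (specht_gen r mu) (Hmult r h (hstar r (specht_gen r nu))) = 0" .
    have "Hmult r (Hmult r (hstar r (specht_gen r mu)) (specht_gen r mu)) (Hmult r h (Hmult r (hstar
        r (specht_gen r nu)) (specht_gen r nu)))
       = Hmult r (hstar r (specht_gen r mu)) (Hmult r (Hmult r (specht_gen r mu) (Hmult r h (hstar r
           (specht_gen r nu)))) (specht_gen r nu))"
      using h mu nu by (simp add: Hmult_assoc)
    also have "\<dots> = 0" unfolding 0 by simp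
    finally show ?thesis using h mu nu by (simp add: pidem_def Hmult_lin Hmult_assoc)
  qed
  consider "\<not> (\<exists>w\<in>perms r. pairinj r (omega_list mu) (omega_list (conjp nu)) w)"
    | "\<not> (\<exists>w\<in>perms r. pairinj r (omega_list nu) (omega_list (conjp mu)) w)"
    using pairinj_antisym[OF mu nu] ne by blast
  then show ?thesis
  proof cases
    case 1
    then show ?thesis using *[OF mu nu h] by simp
  next
    case 2
    have "hstar r (Hmult r (Hmult r (pidem r nu) (hstar r h)) (pidem r mu)) = 0"
      using *[OF nu mu, of "hstar r h"] 2 by (simp add: star_lin)
    then show ?thesis using h mu nu by (simp add: star_Hmult Hmult_assoc)
  qed
qed

lemma eps_mult:
  assumes mu: "mu \<in> partitions r" and nu: "nu \<in> partitions r"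
  shows "Hmult r (cidem r mu) (cidem r nu) = (if mu = nu then cidem r mu else 0)"
proof -
  have "Hmult r (pidem r mu) (cidem r nu) = 0" if "mu \<noteq> nu"
  proof -
    have "Hmult r (pidem r mu) (Hmult r (Hmult r (bas (inv w)) (pidem r nu)) (bas w)) = 0" if "w \<in>
        perms r" for w
    proof -
      have "Hmult r (pidem r mu) (Hmult r (Hmult r (bas (inv w)) (pidem r nu)) (bas w))
        = Hmult r (Hmult r (Hmult r (pidem r mu) (bas (inv w))) (pidem r nu)) (bas w)"
        using that mu nu by (simp add: Hmult_assoc)
      then show ?thesis using pidem_ortho[OF mu nu \<open>mu \<noteq> nu\<close>, of "bas (inv w)"] that by simp
    qed
    then show ?thesis by (simp add: cidem_def casimir_def Hmult_lin Hmult_sum)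
  qed
  then have e: "Hmult r (pidem r mu) (cidem r nu) = (if mu = nu then pidem r mu else 0)"
    using pidem_cidem[OF mu] by auto
  have "Hmult r (casimir r (pidem r mu)) (cidem r nu)
      = (\<Sum>w\<in>perms r. Hmult r (Hmult r (bas (inv w)) (Hmult r (pidem r mu) (cidem r nu))) (bas w))"
    unfolding casimir_def Hmult_sum
  proof (intro sum.cong refl)
    fix w assume w: "w \<in> perms r"
    have "Hmult r (bas w) (cidem r nu) = Hmult r (cidem r nu) (bas w)"
      using central_commute[OF cidem_central[OF nu], of "bas w"] w by simp
    then show "Hmult r (Hmult r (Hmult r (bas (inv w)) (pidem r mu)) (bas w)) (cidem r nu)
      = Hmult r (Hmult r (bas (inv w)) (Hmult r (pidem r mu) (cidem r nu))) (bas w)"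
      using w mu nu by (simp add: Hmult_assoc)
  qed
  then have "Hmult r (casimir r (pidem r mu)) (cidem r nu) = (if mu = nu then casimir r (pidem r mu) else 0)"
    by (simp add: e casimir_def)
  moreover have "Hmult r (cidem r mu) (cidem r nu)
      = scl (inverse (\<Sum>w\<in>perms r. pcoeff r mu (bas w) * pcoeff r mu (bas w))) (Hmult r (casimir r
          (pidem r mu)) (cidem r nu))"
    by (subst (1) cidem_def) (simp add: Hmult_lin)
  ultimately show ?thesis
    by (cases "mu = nu") (simp_all add: cidem_def[of r mu, symmetric] cidem_def[of r nu, symmetric])
qed

end

section \<open>Conjugacy classes of the symmetric group\<close>

text \<open>Cycles are lists with a chosen starting point. As they must cover S, fixed points occur
  as lists of length one.\<close>

definition cycles_of :: "perm \<Rightarrow> nat set \<Rightarrow> nat list set \<Rightarrow> bool" where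
  "cycles_of w S C \<longleftrightarrow> finite C \<and> (\<forall>cs\<in>C. cs \<noteq> [] \<and> distinct cs \<and> (\<forall>i<length cs. w (cs ! i) = cs !
      (Suc i mod length cs)))
     \<and> (\<forall>cs\<in>C. \<forall>ds\<in>C. cs \<noteq> ds \<longrightarrow> set cs \<inter> set ds = {}) \<and> (\<Union>cs\<in>C. set cs) = S"

text \<open>That p fixes everything outside I is carried through the induction: it lets the old
  cycles and the new one act independently.\<close>

lemma cycles_of_ex:
  assumes "cycle_decomp I p" shows "(\<exists>C. cycles_of p I C) \<and> (\<forall>a. a \<notin> I \<longrightarrow> p a = a)"
  using assms
proof (induction rule: cycle_decomp.induct)
  case empty
  have "\<exists>C. cycles_of p {} C" for p by (intro exI[of _ "{}"]) (simp add: cycles_of_def)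
  then show ?case by (simp add: id_apply)
next
  case (comp I p cs)
  obtain C where C: "cycles_of p I C" using comp by blast
  let ?p = "cycle_of_list cs \<circ> p"
  have fixI: "p a = a" if "a \<notin> I" for a using comp that by blast
  have out: "cycle_of_list cs a = a" if "a \<notin> set cs" for a using id_outside_supp[OF that] .
  have inI: "ds ! i \<in> I" if "ds \<in> C" "i < length ds" for ds i using C that by (auto simp: cycles_of_def)
  have old: "?p (ds ! i) = ds ! (Suc i mod length ds)" if ds: "ds \<in> C" "i < length ds" for ds i
  proof -
    have "p (ds ! i) = ds ! (Suc i mod length ds)" using C ds by (auto simp: cycles_of_def)
    moreover have "ds ! (Suc i mod length ds) \<in> I" using ds(2) by (intro inI ds(1) mod_less_divisor) linarith
    ultimately show ?thesis using comp(3) out[of "ds ! (Suc i mod length ds)"] by (auto simp: o_apply)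
  qed
  have new: "?p (cs ! i) = cs ! (Suc i mod length cs)" if i: "i < length cs" for i
  proof -
    have "map (cycle_of_list cs) cs = rotate 1 cs" using cyclic_rotation[OF comp(2), of 1] by simp
    then have "cycle_of_list cs (cs ! i) = cs ! (Suc i mod length cs)"
      using i by (metis nth_map nth_rotate1 One_nat_def rotate1_rotate_swap rotate_Suc rotate0
          id_apply length_map o_apply)
    moreover have "cs ! i \<notin> I" using comp(3) nth_mem[OF i] by blast
    then have "p (cs ! i) = cs ! i" by (rule fixI)
    ultimately show ?thesis by (simp add: o_apply)
  qed
  have fixes_out: "\<forall>a. a \<notin> set cs \<union> I \<longrightarrow> ?p a = a" using fixI out by (auto simp: o_apply)
  show ?case
  \<comment> \<open>\<open>cycle_decomp\<close> admits the empty list as a cycle, whereas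
    \<open>cycles_of\<close> consists of nonempty ones.\<close>
  proof (cases "cs = []")
    case True
    then have "cycles_of ?p (set cs \<union> I) C" using C old by (auto simp: cycles_of_def)
    then show ?thesis using fixes_out by blast
  next
    case False
    have dj: "set cs \<inter> set ds = {}" if "ds \<in> C" for ds
      using comp(3) C that unfolding cycles_of_def by blast
    then have "cycles_of ?p (set cs \<union> I) (insert cs C)"
      using C old new False comp(2) unfolding cycles_of_def by (auto simp: Int_commute)
    then show ?thesis using fixes_out by blast
  qed
qed

lemma perms_cycles: "w \<in> perms r \<Longrightarrow> \<exists>C. cycles_of w {0..<r} C"
  using cycle_decomposition[of w "{0..<r}"] cycles_of_ex by (auto simp: perms_def)

lemma cycles_of_bij:
  assumes "cycles_of w S C"
  shows "bij_betw (\<lambda>(cs, i). cs ! i) (SIGMA cs:C. {..<length cs}) S"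
  unfolding bij_betw_def
proof
  show "inj_on (\<lambda>(cs, i). cs ! i) (SIGMA cs:C. {..<length cs})"
  proof (rule inj_onI, clarsimp)
    fix cs i ds j assume *: "cs \<in> C" "i < length cs" "ds \<in> C" "j < length ds" "cs ! i = ds ! j"
    have "cs = ds"
    proof (rule ccontr)
      assume "cs \<noteq> ds"
      then have "set cs \<inter> set ds = {}" using assms * unfolding cycles_of_def by blast
      then show False using * nth_mem by (metis disjoint_iff)
    qed
    moreover have "distinct cs" using assms * unfolding cycles_of_def by blast
    ultimately show "cs = ds \<and> i = j" using * by (simp add: nth_eq_iff_index_eq)
  qed
  have "S = (\<Union>cs\<in>C. set cs)" using assms by (simp add: cycles_of_def)
  then show "(\<lambda>(cs, i). cs ! i) ` (SIGMA cs:C. {..<length cs}) = S"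
    by (force simp: in_set_conv_nth image_iff)
qed

text \<open>g sends the i-th entry of a cycle of w to the i-th entry of the matching cycle of u; as
  both permutations advance the index, u o g = g o w.\<close>

lemma cycles_of_conj:
  assumes w: "w \<in> perms r" "cycles_of w {0..<r} C" and u: "u \<in> perms r" "cycles_of u {0..<r} D"
    and h: "bij_betw h C D" "\<And>cs. cs \<in> C \<Longrightarrow> length (h cs) = length cs"
  shows "\<exists>g\<in>perms r. w = inv g \<circ> u \<circ> g"
proof -
  let ?I = "SIGMA cs:C. {..<length cs}" and ?J = "SIGMA cs:D. {..<length cs}"
  let ?b = "\<lambda>(cs, i). cs ! i" and ?H = "\<lambda>(cs, i). (h cs, i)"
  have bC: "bij_betw ?b ?I {0..<r}" and bD: "bij_betw ?b ?J {0..<r}"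
    using cycles_of_bij w u by blast+
  have "bij_betw ?H ?I ?J"
    unfolding bij_betw_def
  proof
    show "inj_on ?H ?I" using bij_betw_imp_inj_on[OF h(1)] by (auto simp: inj_on_def)
    show "?H ` ?I = ?J"
      using bij_betw_imp_surj_on[OF h(1)] h(2) by (force simp: image_iff)
  qed
  define g where "g = (\<lambda>a. if a < r then (?b \<circ> ?H \<circ> inv_into ?I ?b) a else a)"
  have "bij_betw (?b \<circ> (?H \<circ> inv_into ?I ?b)) {0..<r} {0..<r}"
    by (rule bij_betw_trans[OF bij_betw_trans[OF bij_betw_inv_into[OF bC] \<open>bij_betw ?H ?I ?J\<close>] bD])
  then have "bij_betw g {0..<r} {0..<r}"
    by (subst bij_betw_cong[of _ _ "?b \<circ> (?H \<circ> inv_into ?I ?b)"]) (auto simp: g_def o_apply)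
  then have g: "g \<in> perms r"
    unfolding perms_def by (intro CollectI bij_imp_permutes) (auto simp: g_def)
  have g_nth: "g (cs ! i) = h cs ! i" if "cs \<in> C" "i < length cs" for cs i
  proof -
    have "cs ! i < r" using bij_betwE[OF bC] that by force
    moreover have "inv_into ?I ?b (?b (cs, i)) = (cs, i)"
      using that by (intro bij_betw_inv_into_left[OF bC]) auto
    ultimately show ?thesis by (simp add: g_def o_apply)
  qed
  have "u (g a) = g (w a)" for a
  proof (cases "a < r")
    case True
    then have "a \<in> ?b ` ?I" using bij_betw_imp_surj_on[OF bC] by simp
    then obtain cs i where cs: "cs \<in> C" "i < length cs" "a = cs ! i" by auto
    have hcs: "h cs \<in> D" "length (h cs) = length cs" using bij_betwE[OF h(1)] h(2) cs by auto
    have "w a = cs ! (Suc i mod length cs)" using w(2) cs by (auto simp: cycles_of_def)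
    moreover have "u (h cs ! i) = h cs ! (Suc i mod length cs)" using u(2) hcs cs by (auto simp:
        cycles_of_def)
    moreover have "Suc i mod length cs < length cs" using cs(2) by (intro mod_less_divisor) linarith
    ultimately show ?thesis using cs g_nth by simp
  qed (simp add: perms_fix[OF g] perms_fix[OF u(1)] perms_fix[OF w(1)])
  then have "w = inv g \<circ> u \<circ> g"
    by (intro ext) (simp add: o_apply perms_inv_apply[OF g])
  then show ?thesis using g by blast
qed

text \<open>The conjugate of the usual cycle type: counting the cycles of length at least c yields a
  decreasing sequence directly, without sorting the lengths.\<close>

definition cyctype :: "nat list set \<Rightarrow> int \<Rightarrow> nat" where
  "cyctype C = (\<lambda>c. if 1 \<le> c then card {cs \<in> C. nat c \<le> length cs} else 0)"

lemma cyctype_partition: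
  assumes C: "cycles_of w {0..<r} C" shows "cyctype C \<in> partitions r"
proof -
  have fin: "finite C" and dj: "\<And>cs ds. cs \<in> C \<Longrightarrow> ds \<in> C \<Longrightarrow> cs \<noteq> ds \<Longrightarrow> set cs \<inter> set ds = {}"
    and dist: "\<And>cs. cs \<in> C \<Longrightarrow> distinct cs" and un: "(\<Union>cs\<in>C. set cs) = {0..<r}"
    using C unfolding cycles_of_def by blast+
  have le: "length cs \<le> r" if "cs \<in> C" for cs
  proof -
    have "card (set cs) \<le> card {0..<r}" using un that by (intro card_mono) auto
    then show ?thesis using dist[OF that] by (simp add: distinct_card)
  qed
  have supp: "{c. cyctype C c \<noteq> 0} \<subseteq> {1..int r}"
  proof
    fix c assume "c \<in> {c. cyctype C c \<noteq> 0}"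
    then have c: "1 \<le> c" "card {cs \<in> C. nat c \<le> length cs} \<noteq> 0" by (auto simp: cyctype_def split: if_splits)
    then have "{cs \<in> C. nat c \<le> length cs} \<noteq> {}" by (metis card.empty)
    then obtain cs where "cs \<in> C" "nat c \<le> length cs" by blast
    then show "c \<in> {1..int r}" using le[of cs] c(1) by simp
  qed
  have "(\<Sum>c\<in>{c. cyctype C c \<noteq> 0}. cyctype C c) = (\<Sum>c\<in>{1..int r}. cyctype C c)"
    by (rule sum.mono_neutral_left) (use supp in auto)
  also have "\<dots> = (\<Sum>c\<in>{1..int r}. \<Sum>cs\<in>C. if nat c \<le> length cs then 1 else 0)"
    using fin by (intro sum.cong) (auto simp: cyctype_def sum.If_cases Int_def id_apply)
  also have "\<dots> = (\<Sum>cs\<in>C. \<Sum>c\<in>{1..int r}. if nat c \<le> length cs then 1 else 0)"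
    by (rule sum.swap)
  also have "\<dots> = (\<Sum>cs\<in>C. length cs)"
  proof (intro sum.cong refl)
    fix cs assume cs: "cs \<in> C"
    have "{1..int r} \<inter> {c. nat c \<le> length cs} = {1..int (length cs)}" using le[OF cs] by auto
    then show "(\<Sum>c\<in>{1..int r}. if nat c \<le> length cs then 1 else 0) = length cs"
      by (simp add: sum.If_cases id_apply)
  qed
  also have "\<dots> = (\<Sum>cs\<in>C. card (set cs))" using dist by (intro sum.cong) (simp_all add: distinct_card)
  also have "\<dots> = card (\<Union>cs\<in>C. set cs)" using fin dj by (intro card_UN_disjoint[symmetric]) auto
  also have "\<dots> = r" using un by simp
  finally have "(\<Sum>c\<in>{c. cyctype C c \<noteq> 0}. cyctype C c) = r" .
  moreover have "finite {c. cyctype C c \<noteq> 0}" using supp by (rule finite_subset) simp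
  moreover have "cyctype C (c + 1) \<le> cyctype C c" if "1 \<le> c" for c
    using fin that by (auto simp: cyctype_def intro!: card_mono)
  ultimately show ?thesis by (simp add: partitions_def comps_def cyctype_def)
qed

lemma cyctype_card:
  assumes "cycles_of w S C" "1 \<le> k"
  shows "card {cs \<in> C. length cs = k} = cyctype C (int k) - cyctype C (int k + 1)"
proof -
  have fin: "finite C" using assms by (simp add: cycles_of_def)
  have "{cs \<in> C. length cs = k} = {cs \<in> C. k \<le> length cs} - {cs \<in> C. Suc k \<le> length cs}" by auto
  moreover have "nat (int k + 1) = Suc k" by simp
  ultimately show ?thesis
    using fin assms(2) by (simp add: cyctype_def card_Diff_subset subset_eq)
qed

lemma cyctype_conj:
  assumes "w \<in> perms r" "cycles_of w {0..<r} C" "u \<in> perms r" "cycles_of u {0..<r} D"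
    and eq: "cyctype C = cyctype D"
  shows "\<exists>g\<in>perms r. w = inv g \<circ> u \<circ> g"
proof -
  have "card {cs \<in> C. length cs = k} = card {cs \<in> D. length cs = k}" for k
  proof (cases "k = 0")
    case True
    then have "{cs \<in> C. length cs = k} = {}" "{cs \<in> D. length cs = k} = {}"
      using assms by (auto simp: cycles_of_def)
    then show ?thesis by (simp only:)
  next
    case False
    then show ?thesis using cyctype_card assms by simp
  qed
  then obtain h where "bij_betw h C D" "\<forall>cs\<in>C. length (h cs) = length cs"
    using ex_bij_betw_fibers[of C D length length] assms by (auto simp: cycles_of_def)
  then show ?thesis using cycles_of_conj[OF assms(1-4)] by blast
qed

lemma finite_partitions: "finite (partitions r)"
proof (rule finite_subset)
  show "partitions r \<subseteq> {la. {i. la i \<noteq> 0} \<subseteq> {1..int r} \<and> range la \<subseteq> {..r}}"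
  proof
    fix la assume la: "la \<in> partitions r"
    have fin: "finite {i. la i \<noteq> 0}" and sum: "(\<Sum>i\<in>{i. la i \<noteq> 0}. la i) = r"
      using la by (auto simp: partitions_def comps_def)
    have "la i \<le> r" for i
      using member_le_sum[of i "{i. la i \<noteq> 0}" la] fin sum by (cases "la i = 0") auto
    moreover have "i \<in> {1..int r}" if i: "la i \<noteq> 0" for i
    proof -
      have pos: "1 \<le> i" by (rule partitions_pos[OF la i])
      have sub: "{1..i} \<subseteq> {i. la i \<noteq> 0}" using partitions_antimono[OF la] i by fastforce
      have "nat i = (\<Sum>k\<in>{1..i}. 1)" by (simp add: id_apply)
      also have "\<dots> \<le> (\<Sum>k\<in>{1..i}. la k)" using sub by (intro sum_mono) (auto simp: Suc_le_eq)
      also have "\<dots> \<le> (\<Sum>k\<in>{i. la i \<noteq> 0}. la k)" using sub fin by (intro sum_mono2) auto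
      finally show ?thesis using sum pos by simp
    qed
    ultimately show "la \<in> {la. {i. la i \<noteq> 0} \<subseteq> {1..int r} \<and> range la \<subseteq> {..r}}" by auto
  qed
  have "{la :: int \<Rightarrow> nat. {i. la i \<noteq> 0} \<subseteq> {1..int r} \<and> range la \<subseteq> {..r}}
      \<subseteq> {la. \<forall>i. (i \<in> {1..int r} \<longrightarrow> la i \<in> {..r}) \<and> (i \<notin> {1..int r} \<longrightarrow> la i = 0)}"
    by auto
  then show "finite {la :: int \<Rightarrow> nat. {i. la i \<noteq> 0} \<subseteq> {1..int r} \<and> range la \<subseteq> {..r}}"
    by (rule finite_subset) (intro finite_set_of_finite_funs; simp)
qed

text \<open>One permutation is kept for each cycle type that occurs; cycle types are partitions and
  determine the class.\<close>

lemma class_representatives: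
  "\<exists>R. R \<subseteq> perms r \<and> card R \<le> card (partitions r) \<and> (\<forall>w\<in>perms r. \<exists>u\<in>R. \<exists>g\<in>perms r. w = inv g \<circ> u \<circ> g)"
proof -
  obtain C where C: "\<And>w. w \<in> perms r \<Longrightarrow> cycles_of w {0..<r} (C w)"
    using bchoice[of "perms r" "\<lambda>w C. cycles_of w {0..<r} C"] perms_cycles by blast
  let ?t = "\<lambda>w. cyctype (C w)"
  let ?R = "inv_into (perms r) ?t ` (?t ` perms r)"
  have "?R \<subseteq> perms r" by (auto intro: inv_into_into)
  moreover have "card ?R \<le> card (partitions r)"
  proof -
    have "card ?R \<le> card (?t ` perms r)" by (intro card_image_le finite_imageI perms_finite)
    also have "\<dots> \<le> card (partitions r)"
      using cyctype_partition C by (intro card_mono finite_partitions) blast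
    finally show ?thesis .
  qed
  moreover have "\<exists>u\<in>?R. \<exists>g\<in>perms r. w = inv g \<circ> u \<circ> g" if w: "w \<in> perms r" for w
  proof -
    let ?u = "inv_into (perms r) ?t (?t w)"
    have tw: "?t w \<in> ?t ` perms r" using w by (rule imageI)
    have u: "?u \<in> perms r" "?t ?u = ?t w" using inv_into_into[OF tw] f_inv_into_f[OF tw] by simp_all
    then show ?thesis using cyctype_conj[OF w C[OF w] u(1) C[OF u(1)]] w by auto
  qed
  ultimately show ?thesis by (intro exI[of _ ?R] conjI ballI)
qed

section \<open>Specialization at \<open>v = 1\<close>\<close>

text \<open>Clear denominators, then divide by the largest power of v - 1 common to all entries:
  every entry can then be evaluated at 1, and an entry of least order does not vanish there.\<close>

lemma fract_family_primitive:
  fixes z :: "'i \<Rightarrow> 'k::field poly fract"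
  assumes I: "finite I" "i0 \<in> I" "z i0 \<noteq> 0"
  shows "\<exists>c p. c \<noteq> 0 \<and> (\<forall>i\<in>I. z i = c * Fract (p i) 1) \<and> (\<exists>i\<in>I. poly (p i) 1 \<noteq> 0)"
proof -
  have "\<exists>a b. z i = Fract a b \<and> b \<noteq> 0" for i by (cases "z i") auto
  then obtain a b where ab: "\<And>i. z i = Fract (a i) (b i)" "\<And>i. b i \<noteq> 0" by metis
  define B where "B = (\<Prod>i\<in>I. b i)"
  have B0: "B \<noteq> 0" using I ab by (simp add: B_def)
  define p0 where "p0 = (\<lambda>i. a i * (\<Prod>k\<in>I - {i}. b k))"
  have z: "z i = Fract 1 B * Fract (p0 i) 1" if i: "i \<in> I" for i
  proof -
    have "B = b i * (\<Prod>k\<in>I - {i}. b k)" unfolding B_def by (rule prod.remove[OF I(1) i])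
    then show ?thesis using ab B0 by (simp add: p0_def eq_fract mult_ac)
  qed
  let ?J = "{i \<in> I. p0 i \<noteq> 0}"
  have "p0 i0 \<noteq> 0"
  proof
    assume "p0 i0 = 0"
    then have "z i0 = 0" using z[OF I(2)] by (simp only: Zero_fract_def[symmetric] mult_zero_right)
    then show False using I(3) by simp
  qed
  then have J: "finite ?J" "?J \<noteq> {}" using I by auto
  define m where "m = Min ((\<lambda>i. order 1 (p0 i)) ` ?J)"
  have m: "m \<le> order 1 (p0 i)" if "i \<in> I" "p0 i \<noteq> 0" for i
    unfolding m_def using J that by (intro Min_le) auto
  have "m \<in> (\<lambda>i. order 1 (p0 i)) ` ?J" unfolding m_def using J by (intro Min_in) auto
  then obtain i1 where i1: "i1 \<in> I" "p0 i1 \<noteq> 0" "order 1 (p0 i1) = m" by auto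
  let ?q = "[:- 1, 1:] ^ m :: 'k poly"
  have "?q dvd p0 i" if "i \<in> I" for i
    using order_1[of 1 "p0 i"] m[OF that] by (cases "p0 i = 0") (auto intro: power_le_dvd)
  then obtain p where p: "\<And>i. i \<in> I \<Longrightarrow> p0 i = ?q * p i" unfolding dvd_def by metis
  have q0: "?q \<noteq> 0" by simp
  have "z i = (Fract 1 B * Fract ?q 1) * Fract (p i) 1" if "i \<in> I" for i
    using z[OF that] p[OF that] by simp
  moreover have "Fract 1 B * Fract ?q 1 \<noteq> 0" using B0 q0 by (simp add: Zero_fract_def eq_fract)
  moreover have "poly (p i1) 1 \<noteq> 0"
  proof
    assume "poly (p i1) 1 = 0"
    then obtain s where "p i1 = [:- 1, 1:] * s" by (auto simp: poly_eq_0_iff_dvd dvd_def)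
    then have "p0 i1 = [:- 1, 1:] ^ Suc m * s" by (simp only: p[OF i1(1)] power_Suc mult_ac)
    then have "[:- 1, 1:] ^ Suc m dvd p0 i1" by simp
    then show False using order_2[OF i1(2), of 1] i1(3) by simp
  qed
  ultimately show ?thesis using i1(1) by blast
qed

lemma class_function:
  assumes a: "\<And>w j. w \<in> perms r \<Longrightarrow> Suc j < r \<Longrightarrow> a (sgen j \<circ> w \<circ> sgen j) = a w"
    and "g \<in> perms r" "w \<in> perms r"
  shows "a (inv g \<circ> w \<circ> g) = a w"
  using assms(2,3)
proof (induction arbitrary: w rule: slen_induct)
  case id
  have "inv id \<circ> w \<circ> id = w" by (metis inv_id comp_id id_comp)
  then show ?case by (simp only:)
next
  case (desc g j)
  let ?g = "g \<circ> sgen j"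
  have gp: "?g \<in> perms r" using desc by simp
  have "inv g = sgen j \<circ> inv ?g" using perms_inv_comp[OF gp perms_sgen[OF desc(2)]] by simp
  moreover have "g = ?g \<circ> sgen j" by simp
  ultimately have e: "inv g \<circ> w \<circ> g = sgen j \<circ> (inv ?g \<circ> w \<circ> ?g) \<circ> sgen j" by (metis comp_assoc)
  have 1: "a (sgen j \<circ> (inv ?g \<circ> w \<circ> ?g) \<circ> sgen j) = a (inv ?g \<circ> w \<circ> ?g)"
    by (rule a[OF perms_comp[OF perms_comp[OF perms_inv[OF gp] desc.prems] gp] desc.hyps(2)])
  have 2: "a (inv ?g \<circ> w \<circ> ?g) = a w" by (fact desc.IH[of w, OF desc.prems])
  show "a (inv g \<circ> w \<circ> g) = a w" unfolding e 1 2 ..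
qed

text \<open>A central element, scaled so that its coefficients are polynomials in \<open>v\<close> not all divisible
  by \<open>v - 1\<close>, becomes a nonzero class function at \<open>v = 1\<close>.\<close>

lemma central_determined:
  assumes z: "central r z" and R: "\<And>w. w \<in> perms r \<Longrightarrow> \<exists>u\<in>R. \<exists>g\<in>perms r. w = inv g \<circ> u \<circ> g"
    and RP: "R \<subseteq> perms r" and 0: "\<And>u. u \<in> R \<Longrightarrow> z u = 0"
  shows "z = 0"
proof (rule ccontr)
  assume "z \<noteq> 0"
  have zH: "z \<in> Hcarrier r" using z by (simp add: central_def)
  obtain w0 where w0: "w0 \<in> perms r" "z w0 \<noteq> 0"
    using \<open>z \<noteq> 0\<close> HcD[OF zH] by (fastforce simp: fun_eq_iff zero_fun_apply)
  obtain c p where c: "c \<noteq> 0" and p: "\<And>w. w \<in> perms r \<Longrightarrow> z w = c * Fract (p w) 1"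
    and nz: "\<exists>w\<in>perms r. poly (p w) 1 \<noteq> 0"
    using fract_family_primitive[of "perms r" w0 z] w0 by auto
  let ?X = "[:0, 1:] :: rat poly"
  \<comment> \<open>Multiplied by v, the centrality relation has polynomial coefficients, v - 1/v
    becoming v^2 - 1. At v = 1 the descent terms vanish and a relation in the group algebra
    remains.\<close>
  have comm: "poly (p (u \<circ> sgen j)) 1 = poly (p (sgen j \<circ> u)) 1" if u: "u \<in> perms r" and j: "Suc j <
      r" for u j
  proof -
    have vq: "vv * (if P then vdiff * x else 0) = (if P then (vv * vv - 1) * x else 0)" for P x
      by (simp add: algebra_simps)
    have E: "z (u \<circ> sgen j) + (if u (Suc j) < u j then vdiff * z u else 0)
      = z (sgen j \<circ> u) + (if inv u (Suc j) < inv u j then vdiff * z u else 0)"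
      unfolding Hgen_apply[OF u j, symmetric] using z j by (simp add: central_def Rgen_def fun_eq_iff)
    have "vv * z (u \<circ> sgen j) + (if u (Suc j) < u j then (vv * vv - 1) * z u else 0)
      = vv * z (sgen j \<circ> u) + (if inv u (Suc j) < inv u j then (vv * vv - 1) * z u else 0)"
      unfolding vq[symmetric] distrib_left[symmetric] E ..
    then have "vv * Fract (p (u \<circ> sgen j)) 1 + (if u (Suc j) < u j then (vv * vv - 1) * Fract (p u) 1 else 0)
      = vv * Fract (p (sgen j \<circ> u)) 1 + (if inv u (Suc j) < inv u j then (vv * vv - 1) * Fract (p u)
          1 else 0)"
      using c u j by (simp add: p mult.left_commute[of _ c] distrib_left[symmetric] split: if_splits)
    then have "?X * p (u \<circ> sgen j) + (if u (Suc j) < u j then (?X * ?X - 1) * p u else 0)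
      = ?X * p (sgen j \<circ> u) + (if inv u (Suc j) < inv u j then (?X * ?X - 1) * p u else 0)"
      by (simp add: vv_def One_fract_def eq_fract split: if_splits)
    then show ?thesis by (auto split: if_splits dest: arg_cong[where f = "\<lambda>q. poly q 1"])
  qed
  have cf: "poly (p (sgen j \<circ> w \<circ> sgen j)) 1 = poly (p w) 1" if "w \<in> perms r" "Suc j < r" for w j
    using comm[of "sgen j \<circ> w" j] that by simp
  obtain w where w: "w \<in> perms r" "poly (p w) 1 \<noteq> 0" using nz by blast
  obtain u g where u: "u \<in> R" "g \<in> perms r" "w = inv g \<circ> u \<circ> g" using R[OF w(1)] by blast
  have up: "u \<in> perms r" using u RP by blast
  have "poly (p w) 1 = poly (p u) 1"
    unfolding u(3) by (rule class_function[of r "\<lambda>w. poly (p w) 1", OF cf u(2) up])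
  moreover have "Fract (p u) 1 = 0" using 0[OF u(1)] p[OF up] c by simp
  then have "p u = 0" by (simp add: Zero_fract_def eq_fract)
  ultimately show False using w by simp
qed

section \<open>Completeness of the central idempotents\<close>

text \<open>By \<open>central_determined\<close> a central element vanishing on the class
  representatives is zero. More idempotents than classes would have a nontrivial combination
  vanishing there, yet orthogonal idempotents are linearly independent.\<close>

lemma central_idempotents_card:
  assumes fin: "finite E" and E: "\<And>a. a \<in> E \<Longrightarrow> central r a \<and> a \<noteq> 0 \<and> Hmult r a a = a"
    and orth: "\<And>a b. a \<in> E \<Longrightarrow> b \<in> E \<Longrightarrow> a \<noteq> b \<Longrightarrow> Hmult r a b = 0"
  shows "card E \<le> card (partitions r)"
proof (rule ccontr)
  assume big: "\<not> ?thesis"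
  obtain R where R: "R \<subseteq> perms r" "card R \<le> card (partitions r)"
    "\<And>w. w \<in> perms r \<Longrightarrow> \<exists>u\<in>R. \<exists>g\<in>perms r. w = inv g \<circ> u \<circ> g"
    using class_representatives[of r] by blast
  have finR: "finite R" using R(1) perms_finite by (rule finite_subset)
  obtain c where c: "\<exists>a\<in>E. c a \<noteq> 0" "\<forall>u\<in>R. (\<Sum>a\<in>E. c a * a u) = 0"
    using linear_dependence[OF finR fin, of "\<lambda>a u. a u"] R(2) big by auto
  let ?z = "\<Sum>a\<in>E. scl (c a) a"
  have "central r ?z" using E by (simp add: central_def Rgen_lin Hgen_lin)
  then have z: "?z = 0"
    by (rule central_determined[OF _ R(3,1)]) (use c(2) in \<open>simp_all add: sum_fun_apply scl_apply\<close>)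
  obtain b where b: "b \<in> E" "c b \<noteq> 0" using c(1) by blast
  have "Hmult r ?z b = (\<Sum>a\<in>E. if a = b then scl (c b) b else 0)"
    unfolding Hmult_sum by (intro sum.cong refl) (use E orth b in \<open>auto simp: Hmult_lin\<close>)
  then have "scl (c b) b = 0" using z fin b by simp
  then have "scl (inverse (c b)) (scl (c b) b) = 0" by (simp only: scl_simps)
  then show False using b E[OF b(1)] by simp
qed

text \<open>Otherwise the defect, 1 minus the sum, would be one more central idempotent orthogonal
  to the existing ones, of which there is already one for each partition.\<close>

lemma sum_cidem: "(\<Sum>mu\<in>partitions r. cidem r mu) = bas id"
proof (rule ccontr)
  let ?z = "bas id - (\<Sum>mu\<in>partitions r. cidem r mu)"
  assume "\<not> ?thesis"
  then have z0: "?z \<noteq> 0" by (metis eq_iff_diff_eq_0)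
  let ?E = "insert ?z (cidem r ` partitions r)"
  have S: "(\<Sum>mu\<in>partitions r. cidem r mu) \<in> Hcarrier r" by simp
  have ze: "Hmult r ?z (cidem r nu) = 0" if nu: "nu \<in> partitions r" for nu
  proof -
    have "Hmult r (\<Sum>mu\<in>partitions r. cidem r mu) (cidem r nu) = (\<Sum>mu\<in>partitions r. if mu = nu then
        cidem r mu else 0)"
      unfolding Hmult_sum by (intro sum.cong refl) (simp add: eps_mult nu)
    then show ?thesis using finite_partitions nu by (simp add: Hmult_diff)
  qed
  have zc: "central r ?z"
  proof -
    have "Rgen j (bas id) = Hgen r j (bas id)" if "Suc j < r" for j using gen_bas_id[OF that] by simp
    moreover have "Rgen j (a - b) = Rgen j a - Rgen j b" "Hgen r j (a - b) = Hgen r j a - Hgen r j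
        b" for a b j
      unfolding diff_conv_add_uminus minus_scl by (simp_all add: Rgen_lin Hgen_lin)
    ultimately show ?thesis using cidem_central by (simp add: central_def Rgen_lin Hgen_lin)
  qed
  have zH: "?z \<in> Hcarrier r" by simp
  have zz: "Hmult r ?z ?z = ?z"
    using ze zH by (simp add: Hmult_diff(1)[of r ?z] Hmult_sum(1)[of r ?z])
  have ez: "Hmult r (cidem r nu) ?z = 0" if "nu \<in> partitions r" for nu
    using central_commute[OF zc, of "cidem r nu"] ze that by simp
  have inj: "inj_on (cidem r) (partitions r)"
    by (rule inj_onI) (metis eps_mult cidem_nonzero)
  have "?z \<notin> cidem r ` partitions r"
    using zz ze z0 by (metis (no_types, lifting) imageE)
  then have "card ?E = Suc (card (partitions r))"
    using finite_partitions inj by (simp add: card_image)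
  moreover have "card ?E \<le> card (partitions r)"
  proof (rule central_idempotents_card)
    show "finite ?E" using finite_partitions by simp
    show "central r a \<and> a \<noteq> 0 \<and> Hmult r a a = a" if "a \<in> ?E" for a
      using that zc z0 zz cidem_central cidem_nonzero eps_mult by auto
    show "Hmult r a b = 0" if "a \<in> ?E" "b \<in> ?E" "a \<noteq> b" for a b
      using that ze ez eps_mult by auto
  qed
  ultimately show False by simp
qed

section \<open>The bimodule decomposition\<close>

lemma Vc_sum_lt: "(\<And>i. i < n \<Longrightarrow> f i \<in> Vcarrier r) \<Longrightarrow> (\<Sum>i<n. f i) \<in> Vcarrier r" for n :: nat
  by (intro Vc_sum) simp

lemma Vact_sum_lt: "(\<And>i. i < n \<Longrightarrow> x i \<in> Vcarrier r) \<Longrightarrow> h \<in> Hcarrier r \<Longrightarrow>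
    Vact r (\<Sum>i<n. x i) h = (\<Sum>i<n. Vact r (x i) h)" for n :: nat
  by (intro Vact_sum) simp_all

lemma Salg_sum_lt: "s \<in> Salg r \<Longrightarrow> (\<And>i. i < n \<Longrightarrow> x i \<in> Vcarrier r) \<Longrightarrow>
    s (\<Sum>i<n. x i) = (\<Sum>i<n. s (x i))" for n :: nat
  by (intro Salg_sum) simp_all

text \<open>The image of omega_varpi under z_mu. Under omega_mu h \<mapsto> x_mu h it corresponds to
  the generator n of the Specht module.\<close>

definition weyl_gen :: "nat \<Rightarrow> (int \<Rightarrow> nat) \<Rightarrow> vec" where
  "weyl_gen r mu = Vact r (omega mu) (Hmult r (Tw r (wlam r mu)) (yh r (conjp mu)))"

text \<open>A general tensor in the coordinates that identify the Weyl module with V e and write the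
  Specht module as n H: the i-th term is q_i tensor n h_i.\<close>

definition etsum :: "nat \<Rightarrow> (int \<Rightarrow> nat) \<Rightarrow> nat \<Rightarrow> (nat \<Rightarrow> vec) \<Rightarrow> (nat \<Rightarrow> hecke) \<Rightarrow> tens" where
  "etsum r mu n q h = (\<lambda>p. \<Sum>i<n. etens (reg_hom r (q i)) (Hmult r (specht_gen r mu) (h i)) p)"

text \<open>On \<open>f \<otimes> s\<close> with \<open>f\<close> in the Weyl and \<open>s\<close> in the Specht module this is \<open>f (\<omega>\<^sub>\<varpi> h\<^sub>0 s)\<close>,
  where \<open>n h\<^sub>0 n = n\<close> for the generator \<open>n\<close> of the Specht module.\<close>

definition Phi :: "nat \<Rightarrow> (int \<Rightarrow> nat) \<Rightarrow> tens \<Rightarrow> vec" where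
  "Phi r mu F = (\<lambda>l. \<Sum>u\<in>perms r.
     F ((Vact r (omega_reg r) (Hmult r (scl (inverse (specht_norm r mu)) (hstar r (specht_gen r
         mu))) (bas u)), l), u))"

context
  fixes r :: nat and mu :: "int \<Rightarrow> nat"
  assumes mu: "mu \<in> partitions r"
begin

text \<open>The map omega_mu h \<mapsto> x_mu h is injective: the embedding for the content mu
  detects omega_mu H, and those for other contents kill it.\<close>

lemma omega_cong:
  assumes "a \<in> Hcarrier r" "b \<in> Hcarrier r" and eq: "Hmult r (xh r mu) a = Hmult r (xh r mu) b"
  shows "Vact r (omega mu) a = Vact r (omega mu) b"
proof (rule wembed_inj[of _ r])
  fix f :: "int list" assume f: "length f = r" "sorted f"
  then show "wembed r f (Vact r (omega mu) a) = wembed r f (Vact r (omega mu) b)"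
    using assms wembed_omega[OF partitions_comps[OF mu]]
    by (cases "f = omega_list mu") (auto simp: wembed_Vact)
qed (use partitions_comps[OF mu] in simp_all)

lemma weyl_gen_Vc [simp]: "weyl_gen r mu \<in> Vcarrier r"
  using partitions_comps[OF mu] by (simp add: weyl_gen_def)

lemma wlam_Hc [simp]: "Tw r (wlam r mu) \<in> Hcarrier r"
  using wlam_props[OF mu] by simp

lemma pidem_Hc' [simp]: "pidem r mu \<in> Hcarrier r" by (rule pidem_Hc[OF mu])

lemma weyl_gen_pidem: "Vact r (weyl_gen r mu) (pidem r mu) = weyl_gen r mu"
proof -
  have "Vact r (weyl_gen r mu) (pidem r mu)
      = Vact r (omega mu) (Hmult r (Hmult r (Tw r (wlam r mu)) (yh r (conjp mu))) (pidem r mu))"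
    using partitions_comps[OF mu] by (simp add: weyl_gen_def Vact_Vact)
  also have "\<dots> = weyl_gen r mu"
    unfolding weyl_gen_def using specht_gen_pidem[OF mu] by (intro omega_cong) (simp_all add:
        specht_gen_def Hmult_assoc)
  finally show ?thesis .
qed

lemma weyl_gen_nonzero: "weyl_gen r mu \<noteq> 0"
proof
  assume "weyl_gen r mu = 0"
  then have "wembed r (omega_list mu) (weyl_gen r mu) = 0" by (simp add: wembed_lin)
  moreover have "wembed r (omega_list mu) (weyl_gen r mu) = specht_gen r mu"
    using partitions_comps[OF mu] omega_list_props[of mu r]
    by (simp add: weyl_gen_def wembed_Vact wembed_omega specht_gen_def Hmult_assoc)
  ultimately show False using specht_gen_nonzero[OF mu] by simp
qed

lemma zmu_reg_hom: "zmu r mu = reg_hom r (weyl_gen r mu)"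
proof
  fix x
  show "zmu r mu x = reg_hom r (weyl_gen r mu) x"
    using partitions_comps[OF mu]
    by (simp add: zmu_def reg_hom_def The_coord weyl_gen_def Vact_Vact vec_ops)
qed

lemma Salg_reg_hom: "s \<in> Salg r \<Longrightarrow> q \<in> Vcarrier r \<Longrightarrow> s (reg_hom r q x) = reg_hom r (s q) x"
  by (simp add: reg_hom_def SalgD)

text \<open>The form on \<open>u H\<close> is given by an element \<open>G = G e\<close> with \<open>e G e = \<kappa> e\<close>, where \<open>\<kappa>\<close> is
  a positive multiple of \<open>\<langle>u, u\<rangle>\<close>.\<close>

lemma Salg_transitive:
  assumes q: "q \<in> Vcarrier r" "Vact r q (pidem r mu) = q"
  shows "\<exists>s\<in>Salg r. s (weyl_gen r mu) = q"
proof -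
  let ?u = "weyl_gen r mu" and ?e = "pidem r mu"
  define G where "G = (\<Sum>w\<in>perms r. scl (vform (VT r w ?u) ?u) (bas w))"
  have GH: "G \<in> Hcarrier r" by (simp add: G_def)
  have Gw: "G w = vform (Vact r ?u (bas w)) ?u" if "w \<in> perms r" for w
    using that by (simp add: G_def sum_fun_apply scl_apply bas_apply VT_eq if_distrib cong: if_cong)
  have hG: "hform r G k = vform (Vact r ?u k) ?u" if k: "k \<in> Hcarrier r" for k
  proof -
    have left: "vform (\<Sum>w\<in>A. scl (c w) (Vact r ?u (bas w))) ?u = (\<Sum>w\<in>A. c w * vform (Vact r ?u (bas
        w)) ?u)" for A c
      by (induction A rule: infinite_finite_induct) (simp_all add: vform_left(1)[of _ r]
          vform_left(2)[of _ r 0] vform_right)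
    have "vform (Vact r ?u (\<Sum>w\<in>perms r. scl (k w) (bas w))) ?u = (\<Sum>w\<in>perms r. k w * vform (Vact r ?u
        (bas w)) ?u)"
      by (simp add: Vact_sum_right Vact_lin_right left)
    also have "\<dots> = hform r G k" unfolding hform_def by (intro sum.cong refl) (simp add: Gw)
    finally show ?thesis unfolding H_expand[OF k, symmetric] ..
  qed
  have Ge: "Hmult r G ?e = G"
  proof (rule Hc_eqI[of _ r])
    fix w assume w: "w \<in> perms r"
    have reg_hom: "hform r h (bas w) = h w" for h
      using w by (simp add: hform_def bas_apply if_distrib cong: if_cong)
    have "Hmult r G ?e w = hform r (Hmult r G ?e) (bas w)" by (simp only: reg_hom)
    also have "\<dots> = hform r G (Hmult r (bas w) ?e)" using w GH star_pidem[OF mu] by (simp add: hform_mult)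
    also have "\<dots> = vform (Vact r (Vact r ?u (bas w)) ?e) ?u" using w by (simp add: hG Vact_Vact)
    also have "\<dots> = vform (Vact r ?u (bas w)) ?u"
      using w star_pidem[OF mu] by (simp add: vform_Vact[of _ r] weyl_gen_pidem)
    finally show "Hmult r G ?e w = G w" using w by (simp add: Gw)
  qed (use GH in simp_all)
  have k0: "pcoeff r mu G \<noteq> 0"
  proof -
    have "G id = vform ?u ?u" by (simp add: Gw)
    then show ?thesis
      using vform_pos[OF weyl_gen_Vc weyl_gen_nonzero] pidem_id_pos[OF mu] by (simp add: pcoeff_def Ge)
  qed
  \<comment> \<open>The rescaling cancels the scalar in q G = \<kappa> q, where \<kappa> is
    \<open>pcoeff r mu G\<close>.\<close>
  define q' where "q' = scl (inverse (pcoeff r mu G)) q"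
  have q': "q' \<in> Vcarrier r" using q by (simp add: q'_def)
  have "Vact r q G = Vact r (Vact r q ?e) (Hmult r G ?e)" using q Ge by simp
  also have "\<dots> = Vact r q (Hmult r (Hmult r ?e G) ?e)" using q(1) GH by (simp add: Vact_Vact Hmult_assoc)
  also have "\<dots> = scl (pcoeff r mu G) q" using q by (simp add: pidem_sandwich[OF mu GH] Vact_lin_right)
  finally have qG: "Vact r q G = scl (pcoeff r mu G) q" .
  have "dyad r ?u q' ?u = Vact r q' G"
    by (simp add: dyad_def G_def Vact_sum_right Vact_lin_right VT_eq)
  also have "\<dots> = q" using q GH qG k0 by (simp add: q'_def Vact_lin)
  finally show ?thesis using dyad_Salg[OF weyl_gen_Vc q'] by blast
qed

text \<open>Composing s with the map of omega_varpi to u gives the map of omega_varpi to s u, so the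
  claim is that u generates V e: its multiples lie there since u e = u, and
  \<open>Salg_transitive\<close> reaches the rest.\<close>

lemma weyl_eq: "weyl r mu = {reg_hom r q | q. q \<in> Vcarrier r \<and> Vact r q (pidem r mu) = q}"
proof (intro set_eqI iffI)
  fix f assume "f \<in> weyl r mu"
  then obtain s where s: "s \<in> Salg r" "f = s \<circ> reg_hom r (weyl_gen r mu)" by (auto simp: weyl_def zmu_reg_hom)
  have "f = reg_hom r (s (weyl_gen r mu))" using s by (auto simp: o_apply Salg_reg_hom)
  moreover have "Vact r (s (weyl_gen r mu)) (pidem r mu) = s (weyl_gen r mu)"
    using SalgD(5)[OF s(1) weyl_gen_Vc pidem_Hc'] weyl_gen_pidem by simp
  ultimately show "f \<in> {reg_hom r q | q. q \<in> Vcarrier r \<and> Vact r q (pidem r mu) = q}"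
    using SalgD(2)[OF s(1) weyl_gen_Vc] by blast
next
  fix f assume "f \<in> {reg_hom r q | q. q \<in> Vcarrier r \<and> Vact r q (pidem r mu) = q}"
  then obtain q where q: "q \<in> Vcarrier r" "Vact r q (pidem r mu) = q" "f = reg_hom r q" by blast
  obtain s where s: "s \<in> Salg r" "s (weyl_gen r mu) = q" using Salg_transitive[OF q(1,2)] by blast
  have "f = s \<circ> zmu r mu" using s q(3) by (auto simp: zmu_reg_hom o_apply Salg_reg_hom)
  then show "f \<in> weyl r mu" using s(1) by (auto simp: weyl_def)
qed

lemma specht_eq: "specht r mu = {Hmult r (specht_gen r mu) h | h. h \<in> Hcarrier r}"
  by (simp add: specht_def specht_gen_def)

definition admissible :: "nat \<Rightarrow> (nat \<Rightarrow> vec) \<Rightarrow> (nat \<Rightarrow> hecke) \<Rightarrow> bool" where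
  "admissible n q h \<longleftrightarrow> (\<forall>i<n. q i \<in> Vcarrier r \<and> Vact r (q i) (pidem r mu) = q i \<and> h i \<in> Hcarrier r)"

lemma tensprod_iff:
  "F \<in> tensprod (weyl r mu) (specht r mu) \<longleftrightarrow> (\<exists>n q h. admissible n q h \<and> F = etsum r mu n q h)"
proof
  assume "F \<in> tensprod (weyl r mu) (specht r mu)"
  then have "\<exists>(n::nat) a b. (\<forall>i<n. a i \<in> weyl r mu \<and> b i \<in> specht r mu) \<and> F = (\<lambda>p. \<Sum>i<n. etens (a i) (b i) p)"
    by (simp add: tensprod_def)
  then obtain n :: nat where "\<exists>a b. (\<forall>i<n. a i \<in> weyl r mu \<and> b i \<in> specht r mu) \<and> F = (\<lambda>p. \<Sum>i<n.
      etens (a i) (b i) p)" ..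
  then obtain a where "\<exists>b. (\<forall>i<n. a i \<in> weyl r mu \<and> b i \<in> specht r mu) \<and> F = (\<lambda>p. \<Sum>i<n. etens (a i)
      (b i) p)" ..
  then obtain b where "(\<forall>i<n. a i \<in> weyl r mu \<and> b i \<in> specht r mu) \<and> F = (\<lambda>p. \<Sum>i<n. etens (a i) (b i) p)" ..
  then have ab: "\<forall>i<n. a i \<in> weyl r mu \<and> b i \<in> specht r mu"
    and F: "F = (\<lambda>p. \<Sum>i<n. etens (a i) (b i) p)" by auto
  have "\<forall>i. \<exists>q h. i < n \<longrightarrow> q \<in> Vcarrier r \<and> Vact r q (pidem r mu) = q \<and> a i = reg_hom r q
      \<and> h \<in> Hcarrier r \<and> b i = Hmult r (specht_gen r mu) h"
    using ab unfolding weyl_eq specht_eq by blast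
  then obtain q h where qh: "\<forall>i<n. q i \<in> Vcarrier r \<and> Vact r (q i) (pidem r mu) = q i \<and> a i = reg_hom r (q i)
      \<and> h i \<in> Hcarrier r \<and> b i = Hmult r (specht_gen r mu) (h i)" by metis
  have "F = etsum r mu n q h" unfolding F etsum_def using qh by (auto intro!: sum.cong)
  moreover have "admissible n q h" using qh by (auto simp: admissible_def)
  ultimately show "\<exists>n q h. admissible n q h \<and> F = etsum r mu n q h" by blast
next
  assume "\<exists>n q h. admissible n q h \<and> F = etsum r mu n q h"
  then obtain n q h where g: "admissible n q h" and F: "F = etsum r mu n q h" by blast
  have "\<forall>i<n. reg_hom r (q i) \<in> weyl r mu \<and> Hmult r (specht_gen r mu) (h i) \<in> specht r mu"
    using g unfolding weyl_eq specht_eq admissible_def by blast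
  then show "F \<in> tensprod (weyl r mu) (specht r mu)"
    unfolding tensprod_def F etsum_def
    by (intro CollectI exI[of _ n] exI[of _ "\<lambda>i. reg_hom r (q i)"] exI[of _ "\<lambda>i. Hmult r (specht_gen
        r mu) (h i)"] conjI refl)
qed

lemma etsum_apply:
  "etsum r mu n q h ((x, l), u) = (\<Sum>i<n. reg_hom r (q i) x l * Hmult r (specht_gen r mu) (h i) u)"
  by (simp add: etsum_def etens_def)

text \<open>The element ?h0 is chosen so that ?h0 n = e. Hence the i-th term becomes q_i e h_i = q_i
  h_i.\<close>

lemma Phi_etsum:
  assumes g: "admissible n q h" shows "Phi r mu (etsum r mu n q h) = (\<Sum>i<n. Vact r (q i) (h i))"
proof
  fix l
  let ?h0 = "scl (inverse (specht_norm r mu)) (hstar r (specht_gen r mu))"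
  have t: "(\<Sum>u\<in>perms r. reg_hom r (q i) (Vact r (omega_reg r) (Hmult r ?h0 (bas u))) l * Hmult r
      (specht_gen r mu) (h i) u) = Vact r (q i) (h i) l"
    if "i < n" for i
  proof -
    have qi: "q i \<in> Vcarrier r" "Vact r (q i) (pidem r mu) = q i" "h i \<in> Hcarrier r" using g that by
        (auto simp: admissible_def)
    let ?s = "Hmult r (specht_gen r mu) (h i)"
    have sH: "?s \<in> Hcarrier r" using qi by simp
    have "(\<Sum>u\<in>perms r. reg_hom r (q i) (Vact r (omega_reg r) (Hmult r ?h0 (bas u))) l * ?s u)
      = Vact r (q i) (Hmult r ?h0 (\<Sum>u\<in>perms r. scl (?s u) (bas u))) l"
      by (simp add: reg_hom_def Hmult_sum Hmult_lin Vact_sum_right Vact_lin_right sum_fun_apply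
          scl_apply coord_lin ac_simps)
    also have "Hmult r ?h0 (\<Sum>u\<in>perms r. scl (?s u) (bas u)) = Hmult r (pidem r mu) (h i)"
      unfolding H_expand[OF sH, symmetric] using qi specht_gen_Hc[OF mu] by (simp add: pidem_def
          Hmult_lin Hmult_assoc)
    also have "Vact r (q i) \<dots> = Vact r (q i) (h i)" using qi by (simp add: Vact_Vact[symmetric])
    finally show ?thesis .
  qed
  show "Phi r mu (etsum r mu n q h) l = (\<Sum>i<n. Vact r (q i) (h i)) l"
    unfolding Phi_def etsum_apply sum_fun_apply using t by (subst sum.swap) simp
qed

lemma tSact_etsum:
  assumes g: "admissible n q h" and s: "s \<in> Salg r"
  shows "tSact s (etsum r mu n q h) = etsum r mu n (\<lambda>i. s (q i)) h" "admissible n (\<lambda>i. s (q i)) h"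
proof -
  have evV: "reg_hom r (q i) x \<in> Vcarrier r" if "i < n" for i x using g that by (auto simp:
      reg_hom_def admissible_def)
  have "tSact s (etsum r mu n q h) ((x, l), u) = etsum r mu n (\<lambda>i. s (q i)) h ((x, l), u)" for x l u
  proof -
    have "(\<lambda>l'. etsum r mu n q h ((x, l'), u)) = (\<Sum>i<n. scl (Hmult r (specht_gen r mu) (h i) u)
        (reg_hom r (q i) x))"
      by (auto simp: etsum_apply sum_fun_apply scl_apply mult.commute)
    then have "tSact s (etsum r mu n q h) ((x, l), u) = s (\<Sum>i<n. scl (Hmult r (specht_gen r mu) (h
        i) u) (reg_hom r (q i) x)) l"
      by (simp add: tSact_def)
    also have "s (\<Sum>i<n. scl (Hmult r (specht_gen r mu) (h i) u) (reg_hom r (q i) x)) = (\<Sum>i<n. scl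
        (Hmult r (specht_gen r mu) (h i) u) (reg_hom r (s (q i)) x))"
      using s evV g by (simp add: Salg_sum_lt SalgD(4) Salg_reg_hom admissible_def)
    finally show ?thesis by (simp add: etsum_apply sum_fun_apply scl_apply mult.commute)
  qed
  then show "tSact s (etsum r mu n q h) = etsum r mu n (\<lambda>i. s (q i)) h" by auto
  show "admissible n (\<lambda>i. s (q i)) h"
    unfolding admissible_def using g s SalgD(5)[OF s _ pidem_Hc', symmetric] by (auto simp:
        admissible_def SalgD(2))
qed

lemma tHact_etsum:
  assumes g: "admissible n q h" and k: "k \<in> Hcarrier r"
  shows "tHact r (etsum r mu n q h) k = etsum r mu n q (\<lambda>i. Hmult r (h i) k)" "admissible n q (\<lambda>i.
      Hmult r (h i) k)"
proof -
  have "tHact r (etsum r mu n q h) k ((x, l), u) = etsum r mu n q (\<lambda>i. Hmult r (h i) k) ((x, l), u)" for x l u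
  proof -
    have "(\<lambda>u'. etsum r mu n q h ((x, l), u')) = (\<Sum>i<n. scl (reg_hom r (q i) x l) (Hmult r
        (specht_gen r mu) (h i)))"
      by (auto simp: etsum_apply sum_fun_apply scl_apply)
    then have "tHact r (etsum r mu n q h) k ((x, l), u)
        = Hmult r (\<Sum>i<n. scl (reg_hom r (q i) x l) (Hmult r (specht_gen r mu) (h i))) k u" by (simp
            add: tHact_def)
    also have "\<dots> = (\<Sum>i<n. scl (reg_hom r (q i) x l) (Hmult r (specht_gen r mu) (Hmult r (h i) k))) u"
      unfolding Hmult_sum Hmult_lin using g k specht_gen_Hc[OF mu] by (simp add: Hmult_assoc admissible_def)
    finally show ?thesis by (simp add: etsum_apply sum_fun_apply scl_apply)
  qed
  then show "tHact r (etsum r mu n q h) k = etsum r mu n q (\<lambda>i. Hmult r (h i) k)" by auto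
  show "admissible n q (\<lambda>i. Hmult r (h i) k)" using g k by (simp add: admissible_def)
qed

text \<open>Each summand of x eps_mu has the form q_w T_w with q_w e = q_w, so it is the image of
  q_w tensor n T_w. The scalar g normalizes the Casimir element.\<close>

lemma Phi_cidem:
  assumes x: "x \<in> Vcarrier r"
  shows "\<exists>F\<in>tensprod (weyl r mu) (specht r mu). Phi r mu F = Vact r x (cidem r mu)"
proof -
  let ?N = "card (perms r)" and ?e = "pidem r mu"
  obtain b where b: "bij_betw b {0..<?N} (perms r)" using ex_bij_betw_nat_finite[OF perms_finite] by blast
  define g where "g = inverse (\<Sum>w\<in>perms r. pcoeff r mu (bas w) * pcoeff r mu (bas w))"
  define q where "q = (\<lambda>w. Vact r x (Hmult r (scl g (bas (inv w))) ?e))"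
  have bp: "b i \<in> perms r" if "i < ?N" for i using bij_betwE[OF b] that by simp
  have qe: "q w \<in> Vcarrier r" "Vact r (q w) ?e = q w" if "w \<in> perms r" for w
    using that x pidem_idem[OF mu] by (simp_all add: q_def Vact_Vact Hmult_assoc)
  have admissible: "admissible ?N (\<lambda>i. q (b i)) (\<lambda>i. bas (b i))" using qe bp by (simp add: admissible_def)
  have "(\<Sum>i<?N. Vact r (q (b i)) (bas (b i))) = (\<Sum>w\<in>perms r. Vact r (q w) (bas w))"
    using sum.reindex_bij_betw[OF b, of "\<lambda>w. Vact r (q w) (bas w)"] by (simp add: lessThan_atLeast0)
  also have "\<dots> = (\<Sum>w\<in>perms r. Vact r x (scl g (Hmult r (Hmult r (bas (inv w)) ?e) (bas w))))"
    using x by (intro sum.cong refl) (simp add: q_def Vact_Vact Hmult_lin)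
  also have "\<dots> = Vact r x (cidem r mu)"
    by (simp add: cidem_def casimir_def g_def Vact_sum_right Vact_lin_right scl_sum)
  finally have "Phi r mu (etsum r mu ?N (\<lambda>i. q (b i)) (\<lambda>i. bas (b i))) = Vact r x (cidem r mu)"
    using Phi_etsum[OF admissible] by simp
  then show ?thesis using admissible tensprod_iff by blast
qed

text \<open>With tau the coefficient at \<open>id\<close> and T = \<open>bas (inv u)\<close>, the
  left side is tau(n h T) = tau(h T n), and n = n e turns this into tau(e) times a sandwich scalar.
  So the coordinates of the Specht factor can be extracted by multiplications in H.\<close>

lemma specht_gen_coeff:
  assumes h: "h \<in> Hcarrier r" and u: "u \<in> perms r"
  shows "Hmult r (specht_gen r mu) h u = pidem r mu id * pcoeff r mu (Hmult r h (Hmult r (bas (inv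
      u)) (specht_gen r mu)))"
proof -
  have sH: "specht_gen r mu \<in> Hcarrier r" by (rule specht_gen_Hc[OF mu])
  have "Hmult r (Hmult r h (Hmult r (bas (inv u)) (specht_gen r mu))) (pidem r mu) = Hmult r (Hmult
      r h (bas (inv u))) (specht_gen r mu)"
    using h u sH specht_gen_pidem[OF mu] by (simp add: Hmult_assoc)
  moreover have "Hmult r (Hmult r h (bas (inv u))) (specht_gen r mu) id = Hmult r (Hmult r
      (specht_gen r mu) h) (bas (inv u)) id"
    using h u sH by (subst trace_commute) (simp_all add: Hmult_assoc)
  moreover have "\<dots> = hform r (Hmult r (specht_gen r mu) h) (bas u)"
    using h u sH by (simp add: trace_mult star_bas)
  moreover have "\<dots> = Hmult r (specht_gen r mu) h u"
    using u by (simp add: hform_def bas_apply if_distrib cong: if_cong)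
  ultimately show ?thesis using pidem_id_pos[OF mu] by (simp add: pcoeff_def)
qed

text \<open>Each term of the image lies in V e_mu H, and e_mu H e_nu = 0.\<close>

lemma Phi_sandwich:
  assumes F: "F \<in> tensprod (weyl r mu) (specht r mu)" and k: "k \<in> Hcarrier r" and nu: "nu \<in>
      partitions r" "nu \<noteq> mu"
  shows "Vact r (Phi r mu F) (Hmult r k (pidem r nu)) = 0"
proof -
  obtain n q h where g: "admissible n q h" and Fe: "F = etsum r mu n q h" using F tensprod_iff by blast
  have nH: "pidem r nu \<in> Hcarrier r" by (rule pidem_Hc[OF nu(1)])
  have "Vact r (Vact r (q i) (h i)) (Hmult r k (pidem r nu)) = 0" if "i < n" for i
  proof -
    have qi: "q i \<in> Vcarrier r" "Vact r (q i) (pidem r mu) = q i" "h i \<in> Hcarrier r" using g that by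
        (auto simp: admissible_def)
    have "Vact r (Vact r (Vact r (q i) (pidem r mu)) (h i)) (Hmult r k (pidem r nu))
        = Vact r (q i) (Hmult r (Hmult r (pidem r mu) (Hmult r (h i) k)) (pidem r nu))"
      using qi(1,3) k nH by (simp add: Vact_Vact Hmult_assoc)
    also have "\<dots> = 0" using pidem_ortho[OF mu nu(1) nu(2)[symmetric], of "Hmult r (h i) k"] k by
        (simp add: Vact_lin_right)
    finally show ?thesis using qi(2) by simp
  qed
  moreover have "Phi r mu F = (\<Sum>i<n. Vact r (q i) (h i))" unfolding Fe by (rule Phi_etsum[OF g])
  ultimately show ?thesis using g k nH by (simp add: Vact_sum_lt admissible_def)
qed

text \<open>Multiplying the sum of the q_i h_i by \<open>bas (inv u)\<close> n e replaces each h_i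
  by a scalar, which \<open>specht_gen_coeff\<close> relates to the coefficient of n h_i at u;
  applying the result to \<open>coord r y\<close> restores the Weyl factor. A tensor is thus
  recovered from its image.\<close>

lemma Phi_inverse:
  assumes F: "F \<in> tensprod (weyl r mu) (specht r mu)"
  shows "F ((y, l), u) = (if u \<in> perms r \<and> y \<in> Vcarrier r then
    pidem r mu id * Vact r (Vact r (Phi r mu F) (Hmult r (Hmult r (bas (inv u)) (specht_gen r mu))
        (pidem r mu))) (coord r y) l else 0)"
proof -
  obtain n q h where g: "admissible n q h" and Fe: "F = etsum r mu n q h" using F tensprod_iff by blast
  have sH: "specht_gen r mu \<in> Hcarrier r" by (rule specht_gen_Hc[OF mu])
  have qi: "q i \<in> Vcarrier r" "Vact r (q i) (pidem r mu) = q i" "h i \<in> Hcarrier r" if "i < n" for i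
    using g that by (auto simp: admissible_def)
  show ?thesis
  proof (cases "u \<in> perms r \<and> y \<in> Vcarrier r")
    case True
    then have u: "u \<in> perms r" and y: "y \<in> Vcarrier r" by auto
    let ?k = "Hmult r (bas (inv u)) (specht_gen r mu)"
    have kH: "?k \<in> Hcarrier r" using sH by simp
    have t: "Vact r (Vact r (q i) (h i)) (Hmult r ?k (pidem r mu)) = scl (pcoeff r mu (Hmult r (h i)
        ?k)) (q i)" if i: "i < n" for i
    proof -
      have "Vact r (Vact r (Vact r (q i) (pidem r mu)) (h i)) (Hmult r ?k (pidem r mu))
          = Vact r (q i) (Hmult r (Hmult r (pidem r mu) (Hmult r (h i) ?k)) (pidem r mu))"
        using qi(1,3)[OF i] kH by (simp add: Vact_Vact Hmult_assoc del: specht_gen_pidem)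
      also have "\<dots> = scl (pcoeff r mu (Hmult r (h i) ?k)) (q i)"
        using pidem_sandwich[OF mu, of "Hmult r (h i) ?k"] kH qi[OF i] by (simp add: Vact_lin_right)
      finally show ?thesis using qi(2)[OF i] by simp
    qed
    have "Vact r (Phi r mu F) (Hmult r ?k (pidem r mu)) = (\<Sum>i<n. scl (pcoeff r mu (Hmult r (h i) ?k)) (q i))"
      unfolding Fe Phi_etsum[OF g] using qi pidem_Hc' kH by (simp add: Vact_sum_lt t)
    then have "Vact r (Vact r (Phi r mu F) (Hmult r ?k (pidem r mu))) (coord r y)
        = (\<Sum>i<n. scl (pcoeff r mu (Hmult r (h i) ?k)) (Vact r (q i) (coord r y)))"
      using qi by (simp add: Vact_sum_lt Vact_lin(2)[of _ r 0])
    moreover have "F ((y, l), u) = (\<Sum>i<n. Vact r (q i) (coord r y) l * (pidem r mu id * pcoeff r mu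
        (Hmult r (h i) ?k)))"
      unfolding Fe etsum_apply using y qi u by (intro sum.cong refl) (simp add: reg_hom_def specht_gen_coeff)
    ultimately show ?thesis using True
      by (simp add: sum_fun_apply scl_apply sum_distrib_left ac_simps)
  next
    case False
    have "Hmult r (specht_gen r mu) (h i) u = 0" if "u \<notin> perms r" "i < n" for i
      using that HcD[of "Hmult r (specht_gen r mu) (h i)" r u] qi by simp
    then show ?thesis using False unfolding Fe etsum_apply by (auto simp: reg_hom_def zero_fun_apply)
  qed
qed

end

lemma Phi_lin: "Phi r mu (tadd F G) = Phi r mu F + Phi r mu G" "Phi r mu (tsmul c F) = scl c (Phi r mu F)"
  by (auto simp: Phi_def tadd_def tsmul_def fun_eq_iff pointwise scl_apply sum.distrib sum_distrib_left)

text \<open>Acting on x, the left ideal H e_nu sees only the component from nu;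
  \<open>Phi_inverse\<close> then expresses F nu through x alone.\<close>

lemma component_unique:
  assumes F: "\<And>mu. mu \<in> partitions r \<Longrightarrow> F mu \<in> tensprod (weyl r mu) (specht r mu)"
    and x: "x = (\<Sum>mu\<in>partitions r. Phi r mu (F mu))" and nu: "nu \<in> partitions r"
  shows "F nu ((y, l), u) = (if u \<in> perms r \<and> y \<in> Vcarrier r then
    pidem r nu id * Vact r (Vact r x (Hmult r (Hmult r (bas (inv u)) (specht_gen r nu)) (pidem r
        nu))) (coord r y) l else 0)"
proof -
  let ?k = "Hmult r (bas (inv u)) (specht_gen r nu)"
  have kH: "?k \<in> Hcarrier r" using specht_gen_Hc[OF nu] by simp
  have PV: "Phi r mu (F mu) \<in> Vcarrier r" if mu: "mu \<in> partitions r" for mu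
  proof -
    obtain n q h where g: "admissible r mu n q h" and Fe: "F mu = etsum r mu n q h"
      using F[OF mu] tensprod_iff[OF mu] by blast
    show ?thesis unfolding Fe Phi_etsum[OF mu g] using g admissible_def[OF mu] by (simp add: Vc_sum_lt)
  qed
  have "Vact r x (Hmult r ?k (pidem r nu)) = (\<Sum>mu\<in>partitions r. Vact r (Phi r mu (F mu)) (Hmult r ?k
      (pidem r nu)))"
    unfolding x using PV pidem_Hc[OF nu] by (simp add: Vact_sum)
  also have "\<dots> = (\<Sum>mu\<in>partitions r. if mu = nu then Vact r (Phi r nu (F nu)) (Hmult r ?k (pidem r
      nu)) else 0)"
    using Phi_sandwich[OF _ F kH nu] by (intro sum.cong refl) auto
  also have "\<dots> = Vact r (Phi r nu (F nu)) (Hmult r ?k (pidem r nu))" using finite_partitions nu by simp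
  finally have e: "Vact r x (Hmult r ?k (pidem r nu)) = Vact r (Phi r nu (F nu)) (Hmult r ?k (pidem r nu))" .
  show ?thesis using Phi_inverse[OF nu F[OF nu], of y l u] unfolding e .
qed

text \<open>The direct sum is encoded by families of tensors that are \<open>tzero\<close> off the
  partitions, so that unique existence of the family expresses bijectivity of the summed
  maps.\<close>

theorem theorem10p6:
  fixes r :: nat
  assumes "0 < r"
  shows "(\<exists>\<Phi> :: (int \<Rightarrow> nat) \<Rightarrow> tens \<Rightarrow> vec.
           (\<forall>\<mu>\<in>partitions r.
              (\<forall>F\<in>tensprod (weyl r \<mu>) (specht r \<mu>). \<Phi> \<mu> F \<in> Vcarrier r) \<and>
              (\<forall>F\<in>tensprod (weyl r \<mu>) (specht r \<mu>). \<forall>G\<in>tensprod (weyl r \<mu>) (specht r \<mu>).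
                  \<Phi> \<mu> (tadd F G) = vadd (\<Phi> \<mu> F) (\<Phi> \<mu> G)) \<and>
              (\<forall>c. \<forall>F\<in>tensprod (weyl r \<mu>) (specht r \<mu>). \<Phi> \<mu> (tsmul c F) = vsmul c (\<Phi> \<mu> F)) \<and>
              (\<forall>s\<in>Salg r. \<forall>F\<in>tensprod (weyl r \<mu>) (specht r \<mu>).
                  \<Phi> \<mu> (tSact s F) = s (\<Phi> \<mu> F)) \<and>
              (\<forall>h\<in>Hcarrier r. \<forall>F\<in>tensprod (weyl r \<mu>) (specht r \<mu>).
                  \<Phi> \<mu> (tHact r F h) = Vact r (\<Phi> \<mu> F) h)) \<and>
           (\<forall>x\<in>Vcarrier r. \<exists>!F. (\<forall>\<mu>\<in>partitions r. F \<mu> \<in> tensprod (weyl r \<mu>) (specht r \<mu>)) \<and>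
                 (\<forall>\<mu>. \<mu> \<notin> partitions r \<longrightarrow> F \<mu> = tzero) \<and>
                 x = (\<lambda>l. \<Sum>\<mu>\<in>partitions r. \<Phi> \<mu> (F \<mu>) l)))
         \<and> completely_reducible r"
proof (intro conjI exI[of _ "Phi r"] ballI allI)
  fix mu F assume mu: "mu \<in> partitions r" and F: "F \<in> tensprod (weyl r mu) (specht r mu)"
  obtain n q h where g: "admissible r mu n q h" and Fe: "F = etsum r mu n q h"
    using F tensprod_iff[OF mu] by blast
  have qh: "q i \<in> Vcarrier r" "h i \<in> Hcarrier r" if "i < n" for i
    using g that by (auto simp: admissible_def[OF mu])
  have PF: "Phi r mu F = (\<Sum>i<n. Vact r (q i) (h i))" unfolding Fe by (rule Phi_etsum[OF mu g])
  show "Phi r mu F \<in> Vcarrier r" unfolding PF using qh by (simp add: Vc_sum_lt)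
  show "Phi r mu (tadd F G) = vadd (Phi r mu F) (Phi r mu G)" for G by (simp add: Phi_lin vec_ops)
  show "Phi r mu (tsmul c F) = vsmul c (Phi r mu F)" for c by (simp add: Phi_lin vec_ops)
  show "Phi r mu (tSact s F) = s (Phi r mu F)" if s: "s \<in> Salg r" for s
  proof -
    have "Phi r mu (tSact s F) = (\<Sum>i<n. Vact r (s (q i)) (h i))"
      unfolding Fe tSact_etsum(1)[OF mu g s] by (rule Phi_etsum[OF mu tSact_etsum(2)[OF mu g s]])
    also have "\<dots> = s (\<Sum>i<n. Vact r (q i) (h i))"
      using s qh by (simp add: Salg_sum_lt[OF s] SalgD(5)[OF s])
    finally show ?thesis unfolding PF .
  qed
  show "Phi r mu (tHact r F k) = Vact r (Phi r mu F) k" if k: "k \<in> Hcarrier r" for k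
  proof -
    have "Phi r mu (tHact r F k) = (\<Sum>i<n. Vact r (q i) (Hmult r (h i) k))"
      unfolding Fe tHact_etsum(1)[OF mu g k] by (rule Phi_etsum[OF mu tHact_etsum(2)[OF mu g k]])
    also have "\<dots> = Vact r (\<Sum>i<n. Vact r (q i) (h i)) k"
      using k qh by (simp add: Vact_sum_lt Vact_Vact)
    finally show ?thesis unfolding PF .
  qed
next
  fix x assume x: "x \<in> Vcarrier r"
  let ?P = "\<lambda>F. (\<forall>\<mu>\<in>partitions r. F \<mu> \<in> tensprod (weyl r \<mu>) (specht r \<mu>)) \<and>
                 (\<forall>\<mu>. \<mu> \<notin> partitions r \<longrightarrow> F \<mu> = tzero) \<and>
                 x = (\<lambda>l. \<Sum>\<mu>\<in>partitions r. Phi r \<mu> (F \<mu>) l)"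
  have fs: "(\<lambda>l. \<Sum>\<mu>\<in>partitions r. Phi r \<mu> (F \<mu>) l) = (\<Sum>\<mu>\<in>partitions r. Phi r \<mu> (F \<mu>))" for F
    by (auto simp: sum_fun_apply)
  have "\<forall>\<mu>\<in>partitions r. \<exists>F. F \<in> tensprod (weyl r \<mu>) (specht r \<mu>) \<and> Phi r \<mu> F = Vact r x (cidem r \<mu>)"
    using Phi_cidem x by blast
  then obtain F0 where F0: "\<forall>\<mu>\<in>partitions r. F0 \<mu> \<in> tensprod (weyl r \<mu>) (specht r \<mu>) \<and> Phi r \<mu> (F0
      \<mu>) = Vact r x (cidem r \<mu>)"
    using bchoice[of "partitions r" "\<lambda>\<mu> F. F \<in> tensprod (weyl r \<mu>) (specht r \<mu>) \<and> Phi r \<mu> F = Vact r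
        x (cidem r \<mu>)"] by blast
  define F where "F = (\<lambda>\<mu>. if \<mu> \<in> partitions r then F0 \<mu> else tzero)"
  have "x = Vact r x (bas id)" using x by simp
  also have "\<dots> = (\<Sum>\<mu>\<in>partitions r. Vact r x (cidem r \<mu>))" unfolding sum_cidem[of r, symmetric]
      Vact_sum_right ..
  also have "\<dots> = (\<Sum>\<mu>\<in>partitions r. Phi r \<mu> (F \<mu>))" using F0 by (intro sum.cong) (simp_all add: F_def)
  finally have "x = (\<Sum>\<mu>\<in>partitions r. Phi r \<mu> (F \<mu>))" .
  then have PF: "?P F" unfolding fs using F0 by (simp add: F_def)
  show "\<exists>!F. ?P F"
  proof (rule ex1I[of ?P F, OF PF])
    fix G assume PG: "?P G"
    show "G = F"
    proof
      fix nu
      show "G nu = F nu"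
      proof (cases "nu \<in> partitions r")
        case True
        have "G nu ((y, l), u) = F nu ((y, l), u)" for y l u
          using component_unique[of r G x nu y l u] component_unique[of r F x nu y l u] PF PG True
          unfolding fs by simp
        then show ?thesis by auto
      next
        case False
        then show ?thesis using PF PG by simp
      qed
    qed
  qed
next
  show "completely_reducible r" by (rule completely_reducible_tensor_space)
qed

end
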